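(* (a) The Identity Problem is decidable for every finitely generated nilpotent group $G$. That is, given a finite set $S$ of elements of $G$, it is possible to decide algorithmically whether the subsemigroup $S^+$ of $G$ generated by $S$ contains the identity element $e_G$. (b) The Subgroup Problem is decidable for every finitely generated nilpotent group $G$. That is, given a finite set $S$ of elements of $G$, it is possible to decide algorithmically whether the subsemigroup $S^+$ of $G$ generated by $S$ is a subgroup of $G$.
   Context: For a subset $S$ of a group $G$, $S^+$ denotes the subsemigroup of $G$ generated by $S$, i.e. the set of all products $s_1s_2\cdots s_\ell$ with $\ell\ge 1$ and $s_i\in S$ (so $S^+=\emptyset$ if $S=\emptyset$). Elements of a finitely generated group $G$ are given as words over $X\cup X^{-1}$, where $X$ is a fixed finite generating set of $G$ (finitely generated nilpotent groups are finitely presented). "Decidable" means that there is an algorithm which, on input such a finite set $S$ of words, always halts with the correct YES/NO answer. *)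

theory Defs
  imports "HOL-Algebra.Generated_Groups" "HOL-Library.Nat_Bijection"
begin

text \<open>
  Algorithms are mu-recursive programs on tuples of natural numbers, represented as lists. A
  program that meets an argument list of the wrong shape has no value; \<open>Min_Fn f\<close> searches for
  the least zero of \<open>f\<close> in its first argument and has no value if the search does not end.
\<close>

datatype program =
    Zero_Fn
  | Succ_Fn
  | Proj_Fn nat
  | Comp_Fn program "program list"
  | Rec_Fn program program
  | Min_Fn program

inductive halts_with :: "program \<Rightarrow> nat list \<Rightarrow> nat \<Rightarrow> bool" where
  Zero: "halts_with Zero_Fn xs 0"
| Succ: "halts_with Succ_Fn [x] (Suc x)"
| Proj: "i < length xs \<Longrightarrow> halts_with (Proj_Fn i) xs (xs ! i)"
| Comp: "list_all2 (\<lambda>g y. halts_with g xs y) gs ys \<Longrightarrow> halts_with f ys z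
           \<Longrightarrow> halts_with (Comp_Fn f gs) xs z"
| Rec_0: "halts_with f xs y \<Longrightarrow> halts_with (Rec_Fn f g) (0 # xs) y"
| Rec_Suc: "halts_with (Rec_Fn f g) (n # xs) y \<Longrightarrow> halts_with g (n # y # xs) z
           \<Longrightarrow> halts_with (Rec_Fn f g) (Suc n # xs) z"
| Min: "halts_with f (n # xs) 0 \<Longrightarrow> \<forall>m<n. \<exists>y. halts_with f (m # xs) (Suc y)
           \<Longrightarrow> halts_with (Min_Fn f) xs n"
monos list.rel_mono_strong

inductive_cases halts_with_elims:
  "halts_with Zero_Fn xs y"
  "halts_with Succ_Fn xs y"
  "halts_with (Proj_Fn i) xs y"
  "halts_with (Comp_Fn f gs) xs y"
  "halts_with (Rec_Fn f g) (0 # xs) y"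
  "halts_with (Rec_Fn f g) (Suc n # xs) y"
  "halts_with (Min_Fn f) xs y"

text \<open>A program never has two different values, so it cannot answer both YES and NO.\<close>

lemma halts_with_unique:
  assumes "halts_with p xs y" "halts_with p xs z"
  shows "y = z"
  using assms
proof (induction arbitrary: z rule: halts_with.induct)
  case (Comp xs gs ys f v)
  from Comp.prems obtain ys' where
    ys': "list_all2 (\<lambda>g y. halts_with g xs y) gs ys'" "halts_with f ys' z"
    by (blast elim: halts_with_elims(4))
  have "ys = ys'"
    using Comp.IH(1) ys'(1) by (auto simp: list_all2_conv_all_nth intro!: nth_equalityI)
  with Comp.IH(2) ys'(2) show ?case by simp
next
  case (Rec_Suc f g n xs y v)
  then show ?case by (metis halts_with_elims(6))
next
  case (Min f n xs)
  from Min.prems obtain zero: "halts_with f (z # xs) 0"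
    and less: "\<forall>m<z. \<exists>y. halts_with f (m # xs) (Suc y)"
    by (blast elim: halts_with_elims(7))
  show ?case
  proof (rule linorder_cases[of n z])
    assume "n < z"
    with less Min.IH(1) show ?thesis by fastforce
  next
    assume "z < n"
    with Min.IH(2) zero show ?thesis by fastforce
  qed
next
  case Zero
  then show ?case by (blast elim: halts_with_elims(1))
next
  case Succ
  then show ?case by (auto elim: halts_with_elims(2))
next
  case Proj
  then show ?case by (blast elim: halts_with_elims(3))
next
  case Rec_0
  then show ?case by (blast elim: halts_with_elims(5))
qed

text \<open>
  The problem \<open>P\<close> with instances in \<open>D\<close> is decidable with respect to the encoding \<open>enc\<close> of
  instances: one program halts on every instance, with value 1 for YES and 0 for NO.
\<close>

definition decidable_problem :: "('i \<Rightarrow> nat) \<Rightarrow> 'i set \<Rightarrow> ('i \<Rightarrow> bool) \<Rightarrow> bool" where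
  "decidable_problem enc D P \<longleftrightarrow>
     (\<exists>p. \<forall>x\<in>D. halts_with p [enc x] (if P x then 1 else 0))"

definition commutator_subgroup :: "('a, 'b) monoid_scheme \<Rightarrow> 'a set \<Rightarrow> 'a set \<Rightarrow> 'a set" where
  "commutator_subgroup G H K =
     generate G (\<Union>h\<in>H. \<Union>k\<in>K. {h \<otimes>\<^bsub>G\<^esub> k \<otimes>\<^bsub>G\<^esub> inv\<^bsub>G\<^esub> h \<otimes>\<^bsub>G\<^esub> inv\<^bsub>G\<^esub> k})"

primrec lower_central :: "('a, 'b) monoid_scheme \<Rightarrow> nat \<Rightarrow> 'a set" where
  "lower_central G 0 = carrier G"
| "lower_central G (Suc n) = commutator_subgroup G (lower_central G n) (carrier G)"

definition nilpotent_group :: "('a, 'b) monoid_scheme \<Rightarrow> bool" where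
  "nilpotent_group G \<longleftrightarrow> group G \<and> (\<exists>n. lower_central G n = {\<one>\<^bsub>G\<^esub>})"

definition subsemigroup_generated :: "('a, 'b) monoid_scheme \<Rightarrow> 'a set \<Rightarrow> 'a set" where
  "subsemigroup_generated G S =
     {foldr (\<otimes>\<^bsub>G\<^esub>) ss \<one>\<^bsub>G\<^esub> |ss. ss \<noteq> [] \<and> set ss \<subseteq> S}"

text \<open>
  A letter \<open>(x, False)\<close> stands for the generator \<open>x\<close> and \<open>(x, True)\<close> for its formal inverse. A
  finite set of words is input as any list of its elements.
\<close>

type_synonym 'a word = "('a \<times> bool) list"

definition words :: "'a set \<Rightarrow> 'a word set" where
  "words X = lists (X \<times> UNIV)"

definition word_value :: "('a, 'b) monoid_scheme \<Rightarrow> 'a word \<Rightarrow> 'a" where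
  "word_value G w =
     foldr (\<otimes>\<^bsub>G\<^esub>) (map (\<lambda>(x, b). if b then inv\<^bsub>G\<^esub> x else x) w) \<one>\<^bsub>G\<^esub>"

text \<open>
  The alphabet is numbered by a function \<open>idx\<close>, which is meant to be injective on it; as the
  alphabet is finite, decidability does not depend on the numbering.
\<close>

definition encode_word :: "('a \<Rightarrow> nat) \<Rightarrow> 'a word \<Rightarrow> nat" where
  "encode_word idx w = list_encode (map (\<lambda>(x, b). 2 * idx x + of_bool b) w)"

definition encode_words :: "('a \<Rightarrow> nat) \<Rightarrow> 'a word list \<Rightarrow> nat" where
  "encode_words idx ws = list_encode (map (encode_word idx) ws)"

definition identity_problem :: "('a, 'b) monoid_scheme \<Rightarrow> 'a word list \<Rightarrow> bool" where
  "identity_problem G ws \<longleftrightarrow>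
     \<one>\<^bsub>G\<^esub> \<in> subsemigroup_generated G (word_value G ` set ws)"

definition subgroup_problem :: "('a, 'b) monoid_scheme \<Rightarrow> 'a word list \<Rightarrow> bool" where
  "subgroup_problem G ws \<longleftrightarrow>
     subgroup (subsemigroup_generated G (word_value G ` set ws)) G"

end

theory Submission
  imports Defs "HOL-Algebra.Elementary_Groups" "HOL-Algebra.FiniteProduct"
begin

text \<open>
  A subsemigroup \<open>S\<^sup>+\<close> of a finitely generated nilpotent group is a subgroup as soon as its image in
  the abelianization of the group \<open>H\<close> generated by \<open>S\<close> is one. Indeed, if \<open>c = [a, b]\<close> is central
  and \<open>S\<^sup>+\<close> meets every coset of \<open>\<langle>c\<rangle>\<close>, then it contains lifts of \<open>a\<close>, \<open>b\<close> and their inverses; the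
  products of \<open>n\<close>-th powers of these lifts in two orders are powers of \<open>c\<close> with exponents
  \<open>\<plusminus> n\<^sup>2 + O(n)\<close>, so both signs occur and all powers of \<open>c\<close> lie in \<open>S\<^sup>+\<close>. By Stiemke's lemma, either
  \<open>S\<^sup>+\<close> is a subgroup or some homomorphism \<open>f : H \<rightarrow> \<int>\<close> is nonnegative on \<open>S\<close> and not zero.

  Both alternatives are recursively enumerable. For the second, values \<open>r\<^sub>s\<close> extend to a homomorphism
  iff the elements \<open>(s, r\<^sub>s)\<close> of \<open>G \<times> \<int>\<close> generate a group that meets \<open>1 \<times> \<int>\<close> trivially, which is
  certified by descending along a central series of \<open>G \<times> \<int>\<close> with cyclic factors. Finally, the
  identity lies in \<open>S\<^sup>+\<close> iff some nonempty subset of \<open>S\<close> generates a subgroup as a semigroup.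
\<close>

text \<open>The group is fixed, so a program may contain any finite data attached to it: a central
  series, the orders of its factors, rewriting rules, a table of words. All of these are chosen
  nonconstructively. What such data cannot absorb is the dependence on \<open>S\<close>. The group
  \<open>H\<close> varies with the input and no presentation of it is at hand, so a homomorphism on
  \<open>H\<close> is handled through its graph, a subgroup of \<open>G \<times> \<int>\<close>.
  That this subgroup meets \<open>\<int>\<close> trivially is a negative statement, which an
  enumeration of words cannot confirm directly. It becomes a search because subgroups of
  \<open>G \<times> \<int>\<close> are finitely generated and split along the series, one cyclic
  factor at a time; the generator of \<open>\<int>\<close> sits at the bottom of the series, so that
  the descent ends exactly at the factor in question. Stiemke's lemma enters through the relations
  among the images of \<open>S\<close> in the abelianization of \<open>H\<close>: a strictly
  positive relation expresses the inverse of every image as a positive product, and a weight vector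
  orthogonal to all relations factors through the abelianization.\<close>

section \<open>Computable functions and recursively enumerable predicates\<close>

text \<open>
  Every number is a code, so that a partial operation such as the tail of a list is computed by a
  total function on codes and needs no test for validity.
\<close>

class codable =
  fixes encode :: "'a \<Rightarrow> nat"
  assumes bij_encode: "bij encode"

definition decode :: "nat \<Rightarrow> 'a::codable" where
  "decode = inv_into UNIV encode"

lemma decode_encode [simp]: "decode (encode x) = x"
  unfolding decode_def by (rule bij_encode[THEN bij_is_inj, THEN inv_f_f])

lemma encode_decode [simp]: "encode (decode n :: 'a::codable) = n"
  using bij_encode[where 'a = 'a] by (simp add: decode_def bij_is_surj surj_f_inv_f)

lemma encode_eq_iff [simp]: "encode x = encode y \<longleftrightarrow> x = y"
  by (metis decode_encode)

instantiation nat :: codable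
begin
definition encode_nat :: "nat \<Rightarrow> nat" where [simp]: "encode_nat n = n"
instance by standard (simp add: encode_nat_def[abs_def] bij_iff)
end

instantiation prod :: (codable, codable) codable
begin
definition encode_prod :: "'a \<times> 'b \<Rightarrow> nat" where
  "encode_prod p = prod_encode (encode (fst p), encode (snd p))"
instance
proof
  show "bij (encode :: 'a \<times> 'b \<Rightarrow> nat)"
  proof (rule o_bij)
    show "(\<lambda>n. map_prod decode decode (prod_decode n)) \<circ> encode = (id :: 'a \<times> 'b \<Rightarrow> _)"
      by (auto simp: encode_prod_def)
    show "(encode :: 'a \<times> 'b \<Rightarrow> nat) \<circ> (\<lambda>n. map_prod decode decode (prod_decode n)) = id"
      by (auto simp: encode_prod_def)
  qed
qed
end

lemma encode_Pair: "encode (x, y) = prod_encode (encode x, encode y)"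
  by (simp add: encode_prod_def)

instantiation list :: (codable) codable
begin
definition encode_list :: "'a list \<Rightarrow> nat" where
  "encode_list xs = list_encode (map encode xs)"
instance
proof
  show "bij (encode :: 'a list \<Rightarrow> nat)"
  proof (rule o_bij)
    show "(\<lambda>n. map decode (list_decode n)) \<circ> encode = (id :: 'a list \<Rightarrow> _)"
      by (auto simp: encode_list_def o_def)
    show "(encode :: 'a list \<Rightarrow> nat) \<circ> (\<lambda>n. map decode (list_decode n)) = id"
      by (auto simp: encode_list_def o_def)
  qed
qed
end

lemma encode_Nil [simp]: "encode [] = 0"
  by (simp add: encode_list_def)

lemma encode_Cons: "encode (x # xs) = Suc (encode (x, xs))"
  by (simp add: encode_list_def encode_prod_def)

lemma length_le_encode: "length xs \<le> encode xs"
proof (induction xs)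
  case (Cons x xs)
  have "encode xs \<le> prod_encode (encode x, encode xs)"
    by (rule le_prod_encode_2)
  with Cons show ?case by (simp add: encode_Cons encode_Pair)
qed simp

section \<open>Programs for arithmetic and for the pairing function\<close>

lemma halts_with_Comp1:
  "halts_with g xs y \<Longrightarrow> halts_with f [y] z \<Longrightarrow> halts_with (Comp_Fn f [g]) xs z"
  by (rule halts_with.Comp[where ys = "[y]"]) auto

lemma halts_with_Comp2:
  "halts_with g xs y \<Longrightarrow> halts_with h xs y' \<Longrightarrow> halts_with f [y, y'] z
     \<Longrightarrow> halts_with (Comp_Fn f [g, h]) xs z"
  by (rule halts_with.Comp[where ys = "[y, y']"]) auto

lemma halts_with_Proj: "i < length xs \<Longrightarrow> y = xs ! i \<Longrightarrow> halts_with (Proj_Fn i) xs y"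
  by (simp add: halts_with.Proj)

definition add_program :: program where
  "add_program = Rec_Fn (Proj_Fn 0) (Comp_Fn Succ_Fn [Proj_Fn 1])"

lemma add_program: "halts_with add_program [m, n] (m + n)"
  unfolding add_program_def
proof (induction m)
  case 0
  show ?case by (auto intro!: halts_with.Rec_0 halts_with_Proj)
next
  case (Suc m)
  have "halts_with Succ_Fn [m + n] (Suc m + n)"
    using halts_with.Succ[of "m + n"] by simp
  then show ?case
    by (intro halts_with.Rec_Suc[OF Suc] halts_with_Comp1[where y = "m + n"] halts_with_Proj) auto
qed

definition pred_program :: program where
  "pred_program = Rec_Fn Zero_Fn (Proj_Fn 0)"

lemma pred_program: "halts_with pred_program [n] (n - 1)"
  unfolding pred_program_def
proof (induction n)
  case 0
  show ?case by (auto intro!: halts_with.Rec_0 halts_with.Zero)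
next
  case (Suc n)
  show ?case by (intro halts_with.Rec_Suc[OF Suc] halts_with_Proj) auto
qed

text \<open>Recursion runs over the first argument, so the number to be subtracted comes
  first.\<close>

definition monus_program :: program where
  "monus_program = Rec_Fn (Proj_Fn 0) (Comp_Fn pred_program [Proj_Fn 1])"

lemma monus_program: "halts_with monus_program [m, n] (n - m)"
  unfolding monus_program_def
proof (induction m)
  case 0
  show ?case by (auto intro!: halts_with.Rec_0 halts_with_Proj)
next
  case (Suc m)
  have "halts_with pred_program [n - m] (n - Suc m)"
    using pred_program[of "n - m"] by simp
  then show ?case
    by (intro halts_with.Rec_Suc[OF Suc] halts_with_Comp1[where y = "n - m"] halts_with_Proj) auto
qed

definition triangle_program :: program where
  "triangle_program =
     Rec_Fn Zero_Fn (Comp_Fn Succ_Fn [Comp_Fn add_program [Proj_Fn 0, Proj_Fn 1]])"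

lemma triangle_program: "halts_with triangle_program [n] (triangle n)"
  unfolding triangle_program_def
proof (induction n)
  case 0
  show ?case by (auto intro!: halts_with.Rec_0 halts_with.Zero)
next
  case (Suc n)
  have "halts_with Succ_Fn [n + triangle n] (triangle (Suc n))"
    using halts_with.Succ[of "n + triangle n"] by (simp add: add.commute)
  then show ?case
    by (intro halts_with.Rec_Suc[OF Suc] halts_with_Comp1[where y = "n + triangle n"]
        halts_with_Comp2[OF _ _ add_program] halts_with_Proj) auto
qed

definition pair_program :: program where
  "pair_program = Comp_Fn add_program
     [Comp_Fn triangle_program [Comp_Fn add_program [Proj_Fn 0, Proj_Fn 1]], Proj_Fn 0]"

lemma pair_program: "halts_with pair_program [m, n] (prod_encode (m, n))"
proof -
  have "halts_with pair_program [m, n] (triangle (m + n) + m)"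
    unfolding pair_program_def
    by (intro halts_with_Comp2[OF _ _ add_program] halts_with_Comp1[OF _ triangle_program]
        halts_with_Proj) auto
  then show ?thesis by (simp add: prod_encode_def)
qed

lemma mono_triangle: "m \<le> n \<Longrightarrow> triangle m \<le> triangle n"
  by (induction rule: dec_induct) auto

text \<open>
  The pairing function lists the pairs by increasing sum, so the sum of the coded pair is found
  by comparing the code with triangular numbers.
\<close>

definition sum_program :: program where
  "sum_program = Min_Fn (Comp_Fn monus_program
     [Comp_Fn triangle_program [Comp_Fn Succ_Fn [Proj_Fn 0]], Comp_Fn Succ_Fn [Proj_Fn 1]])"

lemma sum_program: "halts_with sum_program [prod_encode (a, b)] (a + b)"
proof -
  let ?x = "prod_encode (a, b)"
  define p where "p = Comp_Fn monus_program
     [Comp_Fn triangle_program [Comp_Fn Succ_Fn [Proj_Fn 0]], Comp_Fn Succ_Fn [Proj_Fn 1]]"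
  have p: "halts_with p [s, ?x] (Suc ?x - triangle (Suc s))" for s
    unfolding p_def
    by (intro halts_with_Comp2[OF _ _ monus_program] halts_with_Comp1[OF _ triangle_program]
        halts_with_Comp1[OF _ halts_with.Succ] halts_with_Proj) auto
  have "halts_with (Min_Fn p) [?x] (a + b)"
  proof (rule halts_with.Min)
    have "Suc ?x - triangle (Suc (a + b)) = 0" by (simp add: prod_encode_def)
    with p[of "a + b"] show "halts_with p [a + b, ?x] 0" by argo
    show "\<forall>k<a + b. \<exists>y. halts_with p [k, ?x] (Suc y)"
    proof (intro allI impI)
      fix k assume "k < a + b"
      then have "triangle (Suc k) \<le> ?x"
        using mono_triangle[of "Suc k" "a + b"] by (simp add: prod_encode_def)
      then have "Suc ?x - triangle (Suc k) = Suc (?x - triangle (Suc k))" by linarith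
      with p[of k] show "\<exists>y. halts_with p [k, ?x] (Suc y)" by metis
    qed
  qed
  then show ?thesis by (simp only: sum_program_def p_def)
qed

text \<open>The code of \<open>(a, b)\<close> is \<open>triangle (a + b) + a\<close>, so removing
  the triangular number of the sum leaves the first component.\<close>

definition fst_program :: program where
  "fst_program = Comp_Fn monus_program [Comp_Fn triangle_program [sum_program], Proj_Fn 0]"

lemma fst_program: "halts_with fst_program [prod_encode (a, b)] a"
proof -
  have "halts_with fst_program [prod_encode (a, b)] (prod_encode (a, b) - triangle (a + b))"
    unfolding fst_program_def
    by (intro halts_with_Comp2[OF _ _ monus_program] halts_with_Comp1[OF sum_program
      triangle_program]
        halts_with_Proj) auto
  then show ?thesis by (simp add: prod_encode_def)
qed

definition snd_program :: program where
  "snd_program = Comp_Fn monus_program [fst_program, sum_program]"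

lemma snd_program: "halts_with snd_program [prod_encode (a, b)] b"
proof -
  have "halts_with snd_program [prod_encode (a, b)] (a + b - a)"
    unfolding snd_program_def
    by (intro halts_with_Comp2[OF fst_program sum_program monus_program])
  then show ?thesis by simp
qed

section \<open>Total computable functions and decidable predicates on coded types\<close>

definition computable :: "('a::codable \<Rightarrow> 'b::codable) \<Rightarrow> bool" where
  "computable f \<longleftrightarrow> (\<exists>p. \<forall>x. halts_with p [encode x] (encode (f x)))"

named_theorems computable_intros

lemma computable_compose:
  assumes "computable f" "computable g"
  shows "computable (\<lambda>x. f (g x))"
  using assms unfolding computable_def by (meson halts_with_Comp1)

text \<open>A projection computes every function that keeps codes, so passing between a type and its
  codes costs nothing.\<close>

lemma computable_same_code:
  assumes "\<And>x. encode (f x) = encode x"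
  shows "computable f"
  unfolding computable_def
  by (rule exI[of _ "Proj_Fn 0"]) (auto simp: assms intro: halts_with_Proj)

lemma computable_id [computable_intros]: "computable (\<lambda>x. x)"
  by (rule computable_same_code) simp

lemma computable_encode [computable_intros]:
  "computable f \<Longrightarrow> computable (\<lambda>x. encode (f x))"
  by (rule computable_compose[OF computable_same_code]) simp_all

lemma computable_decode [computable_intros]:
  "computable f \<Longrightarrow> computable (\<lambda>x. decode (f x))"
  by (rule computable_compose[OF computable_same_code]) simp_all

lemma computable_const [computable_intros]: "computable (\<lambda>x. c)"
proof -
  have "\<exists>p. \<forall>xs. halts_with p xs n" for n
    by (induction n) (blast intro: halts_with.Zero halts_with_Comp1 halts_with.Succ)+
  then show ?thesis unfolding computable_def by blast
qed

lemma computable_Pair [computable_intros]: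
  assumes "computable f" "computable g"
  shows "computable (\<lambda>x. (f x, g x))"
  using assms unfolding computable_def encode_Pair by (meson halts_with_Comp2 pair_program)

lemma computable_fst [computable_intros]:
  assumes "computable f"
  shows "computable (\<lambda>x. fst (f x))"
  using assms unfolding computable_def encode_prod_def by (meson halts_with_Comp1 fst_program)

lemma computable_snd [computable_intros]:
  assumes "computable f"
  shows "computable (\<lambda>x. snd (f x))"
  using assms unfolding computable_def encode_prod_def by (meson halts_with_Comp1 snd_program)

lemma computable_Suc [computable_intros]:
  assumes "computable f"
  shows "computable (\<lambda>x. Suc (f x))"
  using assms unfolding computable_def encode_nat_def by (meson halts_with_Comp1 halts_with.Succ)

lemma computable_pred:
  assumes "computable f"
  shows "computable (\<lambda>x. f x - Suc 0)"
  using assms unfolding computable_def encode_nat_def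
  by (metis One_nat_def halts_with_Comp1 pred_program)

text \<open>The recursion scheme behind the closure rules below: branching, arithmetic and list
  folds are all iterations. The parameter \<open>x\<close> stays behind the counter and the state as
  a third argument, so the iterated function may depend on it.\<close>

lemma computable_funpow [computable_intros]:
  fixes h :: "'a::codable \<Rightarrow> 'b::codable \<Rightarrow> 'b"
  assumes "computable (\<lambda>p. h (fst p) (snd p))" "computable n" "computable i"
  shows "computable (\<lambda>x. (h x ^^ n x) (i x))"
proof -
  obtain p q r
    where p: "\<And>x s. halts_with p [prod_encode (encode x, encode s)] (encode (h x s))"
      and q: "\<And>x. halts_with q [encode x] (n x)"
      and r: "\<And>x. halts_with r [encode x] (encode (i x))"
    using assms unfolding computable_def by (force simp: encode_prod_def)
  let ?g = "Comp_Fn p [Comp_Fn pair_program [Proj_Fn 2, Proj_Fn 1]]"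
  have rec: "halts_with (Rec_Fn r ?g) [k, encode x] (encode ((h x ^^ k) (i x)))" for k x
  proof (induction k)
    case 0
    show ?case using r by (auto intro: halts_with.Rec_0)
  next
    case (Suc k)
    have "halts_with ?g [k, encode ((h x ^^ k) (i x)), encode x] (encode ((h x ^^ Suc k) (i x)))"
      using p[of x "(h x ^^ k) (i x)"]
      by (auto intro!: halts_with_Comp1[OF halts_with_Comp2[OF _ _ pair_program]] halts_with_Proj)
    then show ?case by (rule halts_with.Rec_Suc[OF Suc])
  qed
  have "halts_with (Comp_Fn (Rec_Fn r ?g) [q, Proj_Fn 0]) [encode x] (encode ((h x ^^ n x) (i x)))"
    for x
    by (rule halts_with_Comp2[OF q halts_with_Proj rec]) auto
  then show ?thesis unfolding computable_def by blast
qed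

definition dec :: "('a::codable \<Rightarrow> bool) \<Rightarrow> bool" where
  "dec P \<longleftrightarrow> computable (\<lambda>x. of_bool (P x) :: nat)"

lemma computable_if [computable_intros]:
  assumes "dec P" "computable f" "computable g"
  shows "computable (\<lambda>x. if P x then f x else g x)"
proof -
  have "computable (\<lambda>x. ((\<lambda>_. f x) ^^ of_bool (P x)) (g x))"
    using assms(1)
    by (intro computable_funpow assms computable_compose[OF assms(2)] computable_intros)
      (simp add: dec_def)
  also have "(\<lambda>x. ((\<lambda>_. f x) ^^ of_bool (P x)) (g x)) = (\<lambda>x. if P x then f x else g x)"
    by auto
  finally show ?thesis .
qed

lemma computable_minus [computable_intros]:
  fixes f g :: "'a::codable \<Rightarrow> nat"
  assumes "computable f" "computable g"
  shows "computable (\<lambda>x. f x - g x)"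
proof -
  have "((\<lambda>k. k - Suc 0) ^^ n) m = m - n" for m n
    by (induction n) auto
  moreover have "computable (\<lambda>x. ((\<lambda>k. k - Suc 0) ^^ g x) (f x))"
    by (intro computable_funpow assms computable_pred computable_intros)
  ultimately show ?thesis by simp
qed

lemma computable_plus [computable_intros]:
  fixes f g :: "'a::codable \<Rightarrow> nat"
  assumes "computable f" "computable g"
  shows "computable (\<lambda>x. f x + g x)"
proof -
  have "(Suc ^^ n) m = m + n" for m n
    by (induction n) auto
  moreover have "computable (\<lambda>x. (Suc ^^ g x) (f x))"
    by (intro computable_funpow assms computable_intros)
  ultimately show ?thesis by (simp add: add.commute)
qed

lemma computable_times [computable_intros]:
  fixes f g :: "'a::codable \<Rightarrow> nat"
  assumes "computable f" "computable g"
  shows "computable (\<lambda>x. f x * g x)"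
proof -
  have "((\<lambda>k. k + m) ^^ n) 0 = m * n" for m n :: nat
    by (induction n) auto
  moreover have "computable (\<lambda>x. ((\<lambda>k. k + f x) ^^ g x) 0)"
    by (intro computable_funpow assms computable_compose[OF assms(1)] computable_intros)
  ultimately show ?thesis by simp
qed

lemma dec_compose: "dec P \<Longrightarrow> computable f \<Longrightarrow> dec (\<lambda>x. P (f x))"
  unfolding dec_def by (rule computable_compose)

lemma dec_not [computable_intros]: "dec P \<Longrightarrow> dec (\<lambda>x. \<not> P x)"
proof -
  assume "dec P"
  then have "computable (\<lambda>x. if P x then 0 else 1 :: nat)"
    by (intro computable_intros)
  then show ?thesis unfolding dec_def by (rule back_subst[of computable]) auto
qed

lemma dec_conj [computable_intros]:
  assumes "dec P" "dec Q"
  shows "dec (\<lambda>x. P x \<and> Q x)"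
proof -
  have "computable (\<lambda>x. if P x then of_bool (Q x) else 0 :: nat)"
    using assms by (intro computable_intros) (auto simp: dec_def)
  then show ?thesis unfolding dec_def by (rule back_subst[of computable]) auto
qed

lemma dec_disj [computable_intros]:
  assumes "dec P" "dec Q"
  shows "dec (\<lambda>x. P x \<or> Q x)"
  using dec_not[OF dec_conj[OF dec_not[OF assms(1)] dec_not[OF assms(2)]]] by simp

lemma dec_imp [computable_intros]:
  assumes "dec P" "dec Q"
  shows "dec (\<lambda>x. P x \<longrightarrow> Q x)"
  unfolding imp_conv_disj by (intro dec_disj dec_not assms)

lemma dec_less [computable_intros]:
  fixes f g :: "'a::codable \<Rightarrow> nat"
  assumes "computable f" "computable g"
  shows "dec (\<lambda>x. f x < g x)"
proof -
  have "computable (\<lambda>x. 1 - (1 - (g x - f x)))"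
    by (intro assms computable_intros)
  then show ?thesis unfolding dec_def by (rule back_subst[of computable]) auto
qed

lemma dec_eq [computable_intros]:
  assumes "computable f" "computable g"
  shows "dec (\<lambda>x. f x = g x)"
proof -
  have "dec (\<lambda>x. \<not> encode (f x) < encode (g x) \<and> \<not> encode (g x) < encode (f x))"
    by (intro assms computable_intros)
  moreover have "\<not> encode x < encode y \<and> \<not> encode y < encode x \<longleftrightarrow> x = y" for x y :: 'b
    by (metis encode_eq_iff linorder_neqE_nat less_irrefl)
  ultimately show ?thesis by simp
qed

lemma computable_Cons [computable_intros]:
  assumes "computable f" "computable g"
  shows "computable (\<lambda>x. f x # g x)"
proof -
  have "computable (\<lambda>x. decode (Suc (encode (f x, g x))) :: 'b list)"
    by (intro assms computable_intros)
  then show ?thesis unfolding encode_Cons[symmetric] by simp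
qed

text \<open>The list is consumed by iterating \<open>step\<close> as often as its code says. The
  code bounds the length, and \<open>step\<close> changes nothing once the list is exhausted, so
  surplus iterations are harmless.\<close>

lemma computable_foldl [computable_intros]:
  fixes h :: "'a::codable \<Rightarrow> 'b::codable \<Rightarrow> 'c::codable \<Rightarrow> 'b"
  assumes "computable (\<lambda>p. h (fst p) (fst (snd p)) (snd (snd p)))" "computable i" "computable l"
  shows "computable (\<lambda>x. foldl (h x) (i x) (l x))"
proof -
  \<comment> \<open>Removing the successor that \<open>Cons\<close> adds leaves the code of head and
    tail. At \<open>[]\<close> the result is meaningless, and \<open>step\<close> tests for
    \<open>[]\<close> before using it.\<close>
  define uncons where "uncons r = (decode (encode r - 1) :: 'c \<times> 'c list)" for r :: "'c list"
  have uncons: "uncons (y # ys) = (y, ys)" for y ys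
    by (simp add: uncons_def encode_Cons)
  define step where "step x s = (if snd s = [] then s
      else (h x (fst s) (fst (uncons (snd s))), snd (uncons (snd s))))" for x s
  have step: "(step x ^^ n) (a, ys) = (foldl (h x) a ys, [])" if "length ys \<le> n" for x n a ys
    using that
  proof (induction n arbitrary: a ys)
    case (Suc n)
    then show ?case
    proof (cases ys)
      case Nil
      then show ?thesis using Suc.IH[of "[]" a] by (simp add: funpow_swap1 step_def)
    next
      case (Cons z zs)
      then have "step x (a, ys) = (h x a z, zs)" by (simp add: step_def uncons)
      then show ?thesis using Suc Cons by (simp add: funpow_swap1)
    qed
  qed simp
  have uncons_c: "computable (\<lambda>q. uncons (k q))" if "computable k" for k :: "'d::codable \<Rightarrow> 'c list"
    unfolding uncons_def by (intro that computable_intros)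
  have h_c: "computable (\<lambda>q. h (u q) (v q) (w q))"
    if "computable u" "computable v" "computable w" for u :: "'d::codable \<Rightarrow> 'a" and v w
    using computable_compose[OF assms(1), of "\<lambda>q. (u q, v q, w q)"] that
    by (simp add: computable_intros)
  have "computable (\<lambda>p. step (fst p) (snd p))"
    unfolding step_def by (intro computable_intros uncons_c h_c)
  then have "computable (\<lambda>x. fst ((step x ^^ encode (l x)) (i x, l x)))"
    by (intro computable_intros assms)
  then show ?thesis by (simp add: step length_le_encode)
qed

lemma computable_rev [computable_intros]:
  assumes "computable f"
  shows "computable (\<lambda>x. rev (f x))"
proof -
  have "rev xs = foldl (\<lambda>a y. y # a) [] xs" for xs :: "'b list"
    by (simp add: foldl_conv_fold fold_Cons_rev)
  then show ?thesis by (simp only:) (intro assms computable_intros)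
qed

lemma computable_append [computable_intros]:
  assumes "computable f" "computable g"
  shows "computable (\<lambda>x. f x @ g x)"
proof -
  have "xs @ ys = foldl (\<lambda>a y. y # a) ys (rev xs)" for xs ys :: "'b list"
    by (simp add: foldl_conv_fold fold_Cons_rev)
  then show ?thesis by (simp only:) (intro assms computable_intros)
qed

lemma computable_map [computable_intros]:
  fixes h :: "'a::codable \<Rightarrow> 'b::codable \<Rightarrow> 'c::codable"
  assumes "computable (\<lambda>p. h (fst p) (snd p))" "computable l"
  shows "computable (\<lambda>x. map (h x) (l x))"
proof -
  have "map k ys = rev (foldl (\<lambda>a y. k y # a) [] ys)" for k :: "'b \<Rightarrow> 'c" and ys
  proof -
    have "foldl (\<lambda>a y. k y # a) zs ys = rev (map k ys) @ zs" for zs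
      by (induction ys arbitrary: zs) auto
    then show ?thesis by simp
  qed
  moreover have "computable (\<lambda>p. h (fst p) (snd (snd p)))"
    using computable_compose[OF assms(1), of "\<lambda>p. (fst p, snd (snd p))"]
    by (simp add: computable_intros)
  ultimately show ?thesis by (simp only:) (intro assms computable_intros)
qed

lemma computable_concat [computable_intros]:
  assumes "computable f"
  shows "computable (\<lambda>x. concat (f x))"
proof -
  have "concat xss = foldl (@) [] xss" for xss :: "'b list list"
  proof -
    have "foldl (@) zs xss = zs @ concat xss" for zs
      by (induction xss arbitrary: zs) auto
    then show ?thesis by simp
  qed
  then show ?thesis by (simp only:) (intro assms computable_intros)
qed

lemma computable_replicate [computable_intros]:
  assumes "computable f" "computable g"
  shows "computable (\<lambda>x. replicate (f x) (g x))"
proof -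
  have "replicate n y = ((\<lambda>ys. y # ys) ^^ n) []" for n and y :: 'b
    by (induction n) auto
  moreover have "computable (\<lambda>x. ((\<lambda>ys. g x # ys) ^^ f x) [])"
    by (intro assms computable_compose[OF assms(2)] computable_intros)
  ultimately show ?thesis by simp
qed

lemma computable_subseqs [computable_intros]:
  assumes "computable f"
  shows "computable (\<lambda>x. subseqs (f x))"
proof -
  have "subseqs xs = foldl (\<lambda>a y. map (\<lambda>z. y # z) a @ a) [[]] (rev xs)" for xs :: "'b list"
    by (induction xs) (auto simp: Let_def)
  then show ?thesis by (simp only:) (intro assms computable_intros)
qed

lemma dec_ball_set [computable_intros]:
  assumes "dec (\<lambda>p. P (fst p) (snd p))" "computable l"
  shows "dec (\<lambda>x. \<forall>y\<in>set (l x). P x y)"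
proof -
  have fold: "foldl (\<lambda>a y. if Q y then a else 0) n ys = (if \<forall>y\<in>set ys. Q y then n else 0 :: nat)"
    for Q :: "'b \<Rightarrow> bool" and n ys
    by (induction ys arbitrary: n) auto
  have "dec (\<lambda>p. P (fst p) (snd (snd p)))"
    using dec_compose[OF assms(1), of "\<lambda>p. (fst p, snd (snd p))"]
    by (simp add: computable_intros)
  then have "computable (\<lambda>x. foldl (\<lambda>a y. if P x y then a else 0) (1::nat) (l x))"
    by (intro computable_intros assms)
  then show ?thesis unfolding dec_def by (rule back_subst[of computable]) (auto simp: fold)
qed

lemma dec_bex_set [computable_intros]:
  assumes "dec (\<lambda>p. P (fst p) (snd p))" "computable l"
  shows "dec (\<lambda>x. \<exists>y\<in>set (l x). P x y)"
  using dec_not[OF dec_ball_set[OF dec_not[OF assms(1)] assms(2)]] by simp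

lemma dec_member [computable_intros]:
  assumes "computable f" "computable l"
  shows "dec (\<lambda>x. f x \<in> set (l x))"
proof -
  have "dec (\<lambda>x. \<exists>y\<in>set (l x). f x = y)"
    by (intro computable_intros assms computable_compose[OF assms(1)])
  then show ?thesis by simp
qed

lemma dec_subset [computable_intros]:
  assumes "computable f" "computable l"
  shows "dec (\<lambda>x. set (f x) \<subseteq> set (l x))"
proof -
  have "dec (\<lambda>x. \<forall>y\<in>set (f x). y \<in> set (l x))"
    by (intro computable_intros assms computable_compose[OF assms(2)])
  then show ?thesis by (rule back_subst[of dec]) auto
qed

lemma dec_subset_lessThan [computable_intros]:
  fixes f :: "'a::codable \<Rightarrow> nat list" and g :: "'a \<Rightarrow> nat"
  assumes "computable f" "computable g"
  shows "dec (\<lambda>x. set (f x) \<subseteq> {..<g x})"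
proof -
  have "dec (\<lambda>x. \<forall>y\<in>set (f x). y < g x)"
    by (intro computable_intros assms computable_compose[OF assms(2)])
  then show ?thesis by (rule back_subst[of dec]) auto
qed

text \<open>A finite table is hard-wired by nested tests, one per entry. How the entries were found
  does not matter, so they may come from choice.\<close>

lemma computable_finite_support:
  fixes t :: "nat \<Rightarrow> 'b::codable"
  assumes "finite {n. t n \<noteq> c}"
  shows "computable t"
  using assms
proof (induction "{n. t n \<noteq> c}" arbitrary: t)
  case empty
  then have "t = (\<lambda>n. c)" by auto
  then show ?case by (simp add: computable_const)
next
  case (insert k A)
  have "A = {n. (t(k := c)) n \<noteq> c}" using insert by auto
  from insert(3)[OF this] have "computable (\<lambda>n. if n = k then t k else (t(k := c)) n)"
    by (intro computable_intros)
  then show ?case by (rule back_subst[of computable]) auto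
qed

text \<open>Unbounded search, total because every \<open>x\<close> has a witness.
  \<open>Min_Fn\<close> puts the searched number first, hence the swap of the two projections before
  pairing.\<close>

lemma computable_Least:
  assumes "dec (\<lambda>p. D (fst p) (snd p))" "\<And>x. \<exists>n::nat. D x n"
  shows "computable (\<lambda>x. LEAST n. D x n)"
proof -
  obtain p where p: "\<And>x n. halts_with p [prod_encode (encode x, n)] (of_bool (\<not> D x n))"
    using dec_not[OF assms(1)] unfolding dec_def computable_def
    by (metis encode_Pair encode_nat_def fst_conv snd_conv)
  let ?f = "Comp_Fn p [Comp_Fn pair_program [Proj_Fn 1, Proj_Fn 0]]"
  have f: "halts_with ?f [n, encode x] (of_bool (\<not> D x n))" for n x
    using p[of x n]
    by (auto intro!: halts_with_Comp1[OF halts_with_Comp2[OF _ _ pair_program]] halts_with_Proj)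
  have "halts_with (Min_Fn ?f) [encode x] (encode (LEAST n. D x n))" for x
    unfolding encode_nat_def
  proof (rule halts_with.Min)
    show "halts_with ?f [LEAST n. D x n, encode x] 0"
      using f[of "LEAST n. D x n" x] LeastI_ex[OF assms(2)] by simp
    show "\<forall>m<LEAST n. D x n. \<exists>y. halts_with ?f [m, encode x] (Suc y)"
    proof (intro allI impI)
      fix m assume "m < (LEAST n. D x n)"
      then have "\<not> D x m" by (rule not_less_Least)
      with f[of m x] show "\<exists>y. halts_with ?f [m, encode x] (Suc y)" by auto
    qed
  qed
  then show ?thesis unfolding computable_def by blast
qed

section \<open>Recursively enumerable predicates\<close>

definition witnessed_by :: "('a::codable \<Rightarrow> nat \<Rightarrow> bool) \<Rightarrow> ('a \<Rightarrow> bool) \<Rightarrow> bool" where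
  "witnessed_by D P \<longleftrightarrow> dec (\<lambda>p. D (fst p) (snd p)) \<and> (\<forall>x. P x \<longleftrightarrow> (\<exists>n. D x n))"

definition re :: "('a::codable \<Rightarrow> bool) \<Rightarrow> bool" where
  "re P \<longleftrightarrow> (\<exists>D. witnessed_by D P)"

lemma reI:
  fixes D :: "'a::codable \<Rightarrow> nat \<Rightarrow> bool"
  assumes "dec (\<lambda>p. D (fst p) (snd p))" "\<And>x. P x \<longleftrightarrow> (\<exists>n. D x n)"
  shows "re P"
proof -
  have "witnessed_by D P"
    unfolding witnessed_by_def by (intro conjI allI assms)
  then show ?thesis unfolding re_def by blast
qed

lemma witnessed_byD:
  assumes "witnessed_by D P"
  shows "dec (\<lambda>p. D (fst p) (snd p))" "P x \<longleftrightarrow> (\<exists>n. D x n)"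
  using assms unfolding witnessed_by_def by simp_all

text \<open>Every number codes a pair, so two nested searches run as one.\<close>

lemma ex_code_pair:
  "(\<exists>n. R (fst (decode n :: 'a::codable \<times> 'b::codable)) (snd (decode n :: 'a \<times> 'b)))
    \<longleftrightarrow> (\<exists>a b. R a b)"
proof
  assume "\<exists>a b. R a b"
  then obtain a b where "R a b" by blast
  then have "R (fst (decode (encode (a, b)) :: 'a \<times> 'b)) (snd (decode (encode (a, b)) :: 'a \<times> 'b))"
    by simp
  then show "\<exists>n. R (fst (decode n :: 'a \<times> 'b)) (snd (decode n :: 'a \<times> 'b))" ..
qed blast

named_theorems re_intros

lemma re_dec: "dec P \<Longrightarrow> re P"
  by (rule reI[of "\<lambda>x n. P x"]) (auto intro: dec_compose[OF _ computable_fst[OF computable_id]])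

lemma re_compose:
  assumes "re P" "computable f"
  shows "re (\<lambda>x. P (f x))"
proof -
  obtain D where "witnessed_by D P"
    using assms(1) unfolding re_def by blast
  note D = witnessed_byD[OF this]
  have "dec (\<lambda>p. D (f (fst p)) (snd p))"
    using dec_compose[OF D(1), of "\<lambda>p. (f (fst p), snd p)"]
    by (simp add: computable_intros computable_compose[OF assms(2)])
  then show ?thesis using D(2) by (intro reI[of "\<lambda>x. D (f x)"])
qed

lemma re_conj [re_intros]:
  assumes "re P" "re Q"
  shows "re (\<lambda>x. P x \<and> Q x)"
proof -
  obtain D where "witnessed_by D P"
    using assms(1) unfolding re_def by blast
  note D = witnessed_byD[OF this]
  obtain E where "witnessed_by E Q"
    using assms(2) unfolding re_def by blast
  note E = witnessed_byD[OF this]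
  have "dec (\<lambda>p. D (fst p) (fst (decode (snd p) :: nat \<times> nat)))"
    using dec_compose[OF D(1), of "\<lambda>p. (fst p, fst (decode (snd p) :: nat \<times> nat))"]
    by (simp add: computable_intros)
  moreover have "dec (\<lambda>p. E (fst p) (snd (decode (snd p) :: nat \<times> nat)))"
    using dec_compose[OF E(1), of "\<lambda>p. (fst p, snd (decode (snd p) :: nat \<times> nat))"]
    by (simp add: computable_intros)
  moreover have "P x \<and> Q x \<longleftrightarrow>
    (\<exists>n. D x (fst (decode n :: nat \<times> nat)) \<and> E x (snd (decode n :: nat \<times> nat)))" for x
    unfolding D(2) E(2) ex_code_pair[of "\<lambda>a b. D x a \<and> E x b"] by blast
  ultimately show ?thesis by (rule reI[OF dec_conj])
qed

lemma re_disj [re_intros]: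
  assumes "re P" "re Q"
  shows "re (\<lambda>x. P x \<or> Q x)"
proof -
  obtain D where "witnessed_by D P"
    using assms(1) unfolding re_def by blast
  note D = witnessed_byD[OF this]
  obtain E where "witnessed_by E Q"
    using assms(2) unfolding re_def by blast
  note E = witnessed_byD[OF this]
  have "P x \<or> Q x \<longleftrightarrow> (\<exists>n. D x n \<or> E x n)" for x
    unfolding D(2) E(2) by blast
  with dec_disj[OF D(1) E(1)] show ?thesis by (rule reI)
qed

lemma re_ex [re_intros]:
  fixes P :: "'a::codable \<Rightarrow> 'b::codable \<Rightarrow> bool"
  assumes "re (\<lambda>p. P (fst p) (snd p))"
  shows "re (\<lambda>x. \<exists>y. P x y)"
proof -
  obtain D where "witnessed_by D (\<lambda>p. P (fst p) (snd p))"
    using assms unfolding re_def by blast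
  note D = witnessed_byD[OF this]
  have P: "P x y \<longleftrightarrow> (\<exists>n. D (x, y) n)" for x y
    using D(2)[of "(x, y)"] unfolding fst_conv snd_conv .
  have "dec (\<lambda>p. D (fst p, fst (decode (snd p) :: 'b \<times> nat)) (snd (decode (snd p) :: 'b \<times> nat)))"
    using dec_compose[OF D(1), of "\<lambda>p. ((fst p, fst (decode (snd p) :: 'b \<times> nat)), snd (decode
      (snd p) :: 'b \<times> nat))"]
    by (simp add: computable_intros)
  moreover have "(\<exists>y. P x y) \<longleftrightarrow> (\<exists>n. D (x, fst (decode n :: 'b \<times> nat)) (snd (decode n :: 'b \<times>
    nat)))" for x
    unfolding P ex_code_pair[of "\<lambda>y n. D (x, y) n"] by (rule refl)
  ultimately show ?thesis by (rule reI)
qed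

text \<open>A finite list that pairs each entry with its own witness is a single witness for all
  entries, so the universal quantifier stays inside one search.\<close>

lemma re_ball_set [re_intros]:
  fixes l :: "'a::codable \<Rightarrow> 'b::codable list"
  assumes "re (\<lambda>p. P (fst p) (snd p))" "computable l"
  shows "re (\<lambda>x. \<forall>y\<in>set (l x). P x y)"
proof -
  obtain D where "witnessed_by D (\<lambda>p. P (fst p) (snd p))"
    using assms(1) unfolding re_def by blast
  note D = witnessed_byD[OF this]
  have P: "P x y \<longleftrightarrow> (\<exists>n. D (x, y) n)" for x y
    using D(2)[of "(x, y)"] unfolding fst_conv snd_conv .
  have D': "dec (\<lambda>p. D (u p, v p) (w p))" if "computable u" "computable v" "computable w"
    for u v and w :: "'c::codable \<Rightarrow> nat"
    using dec_compose[OF D(1), of "\<lambda>p. ((u p, v p), w p)"] that by (simp add: computable_intros)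
  have "re (\<lambda>x. \<exists>ws :: ('b \<times> nat) list.
      (\<forall>y\<in>set (l x). \<exists>w\<in>set ws. fst w = y) \<and> (\<forall>w\<in>set ws. D (x, fst w) (snd w)))"
    by (intro re_intros re_dec computable_intros D' computable_compose[OF assms(2)])
  moreover have "(\<exists>ws. (\<forall>y\<in>set ys. \<exists>w\<in>set ws. fst w = y) \<and> (\<forall>w\<in>set ws. D (x, fst w) (snd w)))
      \<longleftrightarrow> (\<forall>y\<in>set ys. P x y)" for x ys
  proof
    assume "\<forall>y\<in>set ys. P x y"
    then obtain n where "\<forall>y\<in>set ys. D (x, y) (n y)"
      unfolding P by metis
    then show "\<exists>ws. (\<forall>y\<in>set ys. \<exists>w\<in>set ws. fst w = y) \<and> (\<forall>w\<in>set ws. D (x, fst w) (snd w))"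
      by (intro exI[of _ "map (\<lambda>y. (y, n y)) ys"]) auto
  qed (use P in fastforce)
  ultimately show ?thesis by simp
qed

text \<open>Post's theorem: a search for a witness on either side always ends, and the side on which
  it ends is the answer.\<close>

lemma dec_if_re:
  assumes "re P" "re (\<lambda>x. \<not> P x)"
  shows "dec P"
proof -
  obtain D where "witnessed_by D P"
    using assms(1) unfolding re_def by blast
  note D = witnessed_byD[OF this]
  obtain E where "witnessed_by E (\<lambda>x. \<not> P x)"
    using assms(2) unfolding re_def by blast
  note E = witnessed_byD[OF this]
  define m where "m x = (LEAST n. D x n \<or> E x n)" for x
  have ex: "\<exists>n. D x n \<or> E x n" for x
    using D(2)[of x] E(2)[of x] by blast
  then have "computable m" unfolding m_def[abs_def]
    by (intro computable_Least dec_disj D(1) E(1))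
  then have "dec (\<lambda>x. D x (m x))"
    using dec_compose[OF D(1), of "\<lambda>x. (x, m x)"] by (simp add: computable_intros)
  moreover have "D x (m x) \<longleftrightarrow> P x" for x
    using LeastI_ex[OF ex[of x]] D(2)[of x] E(2)[of x] unfolding m_def by blast
  ultimately show ?thesis by simp
qed

section \<open>Submonoids of nilpotent groups\<close>

text \<open>For \<open>x > 0\<close> the identity \<open>- x = (- b - 1) * x + x * b\<close> has
  nonnegative coefficients at the members \<open>x\<close> and \<open>b\<close>; for
  \<open>x \<le> 0\<close> the member \<open>a\<close> serves in the same way.\<close>

lemma int_submonoid_uminus:
  fixes P :: "int set"
  assumes zero: "0 \<in> P" and add: "\<And>x y. x \<in> P \<Longrightarrow> y \<in> P \<Longrightarrow> x + y \<in> P"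
    and "a \<in> P" "a > 0" "b \<in> P" "b < 0" "x \<in> P"
  shows "- x \<in> P"
proof -
  have mult: "int n * y \<in> P" if "y \<in> P" for n y
    using that zero add by (induction n) (auto simp: distrib_right)
  show ?thesis
  proof (cases "x > 0")
    case True
    have "int (nat (- b - 1)) * x + int (nat x) * b \<in> P"
      using assms by (intro add mult)
    moreover have "int (nat (- b - 1)) * x + int (nat x) * b = - x"
      using True \<open>b < 0\<close> by (simp add: algebra_simps)
    ultimately show ?thesis by simp
  next
    case False
    have "int (nat (a - 1)) * x + int (nat (- x)) * a \<in> P"
      using assms by (intro add mult)
    moreover have "int (nat (a - 1)) * x + int (nat (- x)) * a = - x"
      using False \<open>a > 0\<close> by (simp add: algebra_simps)
    ultimately show ?thesis by simp
  qed
qed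

text \<open>Eliminating one coordinate \<open>t\<close> at a time keeps everything integral. The
  induction hypothesis is applied to \<open>L\<close> and, if it yields a vector that is not
  positive at \<open>t\<close>, once more to the slice of \<open>L\<close> where coordinate
  \<open>t\<close> vanishes.\<close>

lemma integer_stiemke:
  fixes L :: "('s \<Rightarrow> int) set"
  assumes "finite S" "L \<noteq> {}"
    and "\<And>v w a b. v \<in> L \<Longrightarrow> w \<in> L \<Longrightarrow> (\<lambda>s. a * v s + b * w s) \<in> L"
  shows "(\<exists>v\<in>L. \<forall>s\<in>S. v s > 0) \<or>
    (\<exists>r. (\<forall>s\<in>S. r s \<ge> 0) \<and> (\<exists>s\<in>S. r s > 0) \<and> (\<forall>v\<in>L. (\<Sum>s\<in>S. r s * v s) = 0))"
  using assms
proof (induction S arbitrary: L)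
  case empty
  then show ?case by auto
next
  case (insert t S)
  note lin = insert.prems(2)
  have zero: "(\<lambda>s. 0) \<in> L"
  proof -
    obtain v where "v \<in> L" using insert.prems(1) by blast
    from lin[OF this this, of 0 0] show ?thesis by simp
  qed
  have extend: ?case if "\<forall>s\<in>S. r s \<ge> 0" "\<exists>s\<in>S. r s > 0" "c \<ge> 0"
    "\<forall>v\<in>L. (\<Sum>s\<in>S. r s * v s) + c * v t = 0" for r c
  proof (intro disjI2 exI[of _ "r(t := c)"] conjI ballI)
    show "\<exists>s\<in>insert t S. (r(t := c)) s > 0"
      using that(2) insert.hyps by auto
    show "(\<Sum>s\<in>insert t S. (r(t := c)) s * v s) = 0" if "v \<in> L" for v
    proof -
      have "(\<Sum>s\<in>S. (r(t := c)) s * v s) = (\<Sum>s\<in>S. r s * v s)"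
        using insert.hyps by (intro sum.cong) auto
      then show ?thesis using insert.hyps \<open>\<forall>v\<in>L. _\<close> that by (simp add: add.commute)
    qed
  qed (use that in auto)
  from insert.IH[OF insert.prems] consider
    v where "v \<in> L" "\<forall>s\<in>S. v s > 0"
  | r where "\<forall>s\<in>S. r s \<ge> 0" "\<exists>s\<in>S. r s > 0" "\<forall>v\<in>L. (\<Sum>s\<in>S. r s * v s) = 0"
    by blast
  then show ?case
  proof cases
    case 2
    then show ?thesis by (intro extend[of r 0]) auto
  next
    case v: 1
    show ?thesis
    proof (cases "v t > 0")
      case True
      with v show ?thesis by auto
    next
      case False
      let ?L = "{w \<in> L. w t = 0}"
      have "?L \<noteq> {}" using zero by blast
      moreover have "(\<lambda>s. a * w s + b * w' s) \<in> ?L" if "w \<in> ?L" "w' \<in> ?L" for w w' a b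
        using that lin by simp
      ultimately consider
        w where "w \<in> L" "w t = 0" "\<forall>s\<in>S. w s > 0"
      | r where "\<forall>s\<in>S. r s \<ge> 0" "\<exists>s\<in>S. r s > 0" "\<forall>w\<in>?L. (\<Sum>s\<in>S. r s * w s) = 0"
        using insert.IH[of ?L] by blast
      then show ?thesis
      proof cases
        case r: 2
        \<comment> \<open>\<open>r\<close> is orthogonal to the slice only. Each \<open>w\<close> in
          \<open>L\<close> is moved into the slice by the combination
          \<open>- v t * w + w t * v\<close>, and there orthogonality to \<open>r\<close> says that
          the weights \<open>- v t * r s\<close> on \<open>S\<close> and \<open>p\<close> at
          \<open>t\<close> are orthogonal to \<open>w\<close>.\<close>
        define p where "p = (\<Sum>s\<in>S. r s * v s)"
        have "p > 0"
        proof -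
          obtain s where s: "s \<in> S" "r s > 0" using r(2) by blast
          have "0 < r s * v s" using s v(2) by simp
          also have "\<dots> \<le> p" unfolding p_def
            using insert.hyps(1) s(1) r(1) v(2) by (intro member_le_sum) (auto intro:
              mult_nonneg_nonneg less_imp_le)
          finally show ?thesis .
        qed
        \<comment> \<open>Otherwise \<open>v\<close> would lie in the slice and \<open>p\<close>
          would be zero.\<close>
        have "v t \<noteq> 0" using r(3) v(1) \<open>p > 0\<close> unfolding p_def by force
        with False have "v t < 0" by simp
        obtain s where "s \<in> S" "r s > 0" using r(2) by blast
        then have pos: "\<exists>s\<in>S. - v t * r s > 0"
          using \<open>v t < 0\<close> by (auto simp: mult_neg_pos intro!: bexI[of _ s])
        show ?thesis
        proof (rule extend[of "\<lambda>s. - v t * r s" p])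
          show "\<forall>w\<in>L. (\<Sum>s\<in>S. - v t * r s * w s) + p * w t = 0"
          proof
            fix w assume "w \<in> L"
            then have "(\<lambda>s. - v t * w s + w t * v s) \<in> ?L"
              using lin[OF _ v(1), of w "- v t" "w t"] by simp
            then have "(\<Sum>s\<in>S. r s * (- v t * w s + w t * v s)) = 0"
              using r(3) by fastforce
            then show "(\<Sum>s\<in>S. - v t * r s * w s) + p * w t = 0"
              unfolding p_def by (simp add: algebra_simps sum.distrib sum_subtractf sum_negf
                sum_distrib_left sum_distrib_right)
          qed
        qed (use r \<open>v t < 0\<close> \<open>p > 0\<close> pos in \<open>auto simp: mult_nonpos_nonneg\<close>)
      next
        case w: 1
        show ?thesis
        proof (cases "\<forall>u\<in>L. u t = 0")
          case True
          with insert.hyps show ?thesis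
            by (intro disjI2 exI[of _ "\<lambda>s. of_bool (s = t)"]) (auto intro!: sum.neutral)
        next
          case False
          then obtain u where "u \<in> L" "u t \<noteq> 0" by blast
          define u' where "u' = (\<lambda>s. sgn (u t) * u s + 0 * u s)"
          have u': "u' \<in> L" "u' t > 0"
            unfolding u'_def using \<open>u t \<noteq> 0\<close> lin[OF \<open>u \<in> L\<close> \<open>u \<in> L\<close>, of "sgn (u t)" 0]
            by (simp_all add: sgn_if)
          \<comment> \<open>\<open>w\<close> is positive on \<open>S\<close> and zero at
            \<open>t\<close>. Adding \<open>N\<close> times \<open>w\<close> to \<open>u'\<close>
            keeps the positive value at \<open>t\<close> and outweighs every negative entry of
            \<open>u'\<close> on \<open>S\<close>.\<close>
          define N where "N = (\<Sum>s\<in>S. \<bar>u' s\<bar>) + 1"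
          have "(\<lambda>s. 1 * u' s + N * w s) \<in> L"
            by (rule lin[OF u'(1) w(1)])
          moreover have "1 * u' s + N * w s > 0" if "s \<in> S" for s
          proof -
            have "\<bar>u' s\<bar> \<le> (\<Sum>s\<in>S. \<bar>u' s\<bar>)"
              using insert.hyps(1) that by (intro member_le_sum) auto
            then have "\<bar>u' s\<bar> < N" by (simp add: N_def)
            moreover have "N * 1 \<le> N * w s"
              using w(3) that calculation by (intro mult_left_mono) (auto simp:
                int_one_le_iff_zero_less)
            ultimately show ?thesis by simp
          qed
          ultimately show ?thesis using u' w(2) by (intro disjI1 bexI) auto
        qed
      qed
    qed
  qed
qed

section \<open>Commutators, conjugation and saturation along one commutator\<close>

context group
begin

lemma inv_mult_cancel [simp]:
  "x \<in> carrier G \<Longrightarrow> y \<in> carrier G \<Longrightarrow> inv x \<otimes> (x \<otimes> y) = y"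
  "x \<in> carrier G \<Longrightarrow> y \<in> carrier G \<Longrightarrow> x \<otimes> (inv x \<otimes> y) = y"
  by (simp_all add: m_assoc[symmetric])

lemma central_int_pow:
  fixes m :: int
  assumes c: "c \<in> carrier G" and central: "\<And>g. g \<in> carrier G \<Longrightarrow> c \<otimes> g = g \<otimes> c"
    and that: "g \<in> carrier G"
  shows "c [^] m \<otimes> g = g \<otimes> c [^] m"
proof -
  have "c [^] m' \<otimes> g = g \<otimes> c [^] m'" for m' :: nat
    using that c central by (induction m') (simp_all add: m_assoc, metis m_assoc nat_pow_closed)
  then have nat: "c [^] (int m') \<otimes> g = g \<otimes> c [^] (int m')" for m'
    by (simp add: int_pow_int)
  show ?thesis
  proof (cases "m \<ge> 0")
    case True
    then show ?thesis using nat[of "nat m"] by simp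
  next
    case False
    have "g \<otimes> c [^] (- m) = c [^] (- m) \<otimes> g" using nat[of "nat (- m)"] False by simp
    then have "inv (c [^] (- m)) \<otimes> g = g \<otimes> inv (c [^] (- m))"
      using that c by (metis int_pow_closed inv_closed inv_solve_left m_assoc m_closed
        inv_solve_right)
    then show ?thesis using c by (simp add: int_pow_neg)
  qed
qed

lemma int_pow_minus_one [simp]: "x \<in> carrier G \<Longrightarrow> x [^] (- 1 :: int) = inv x"
  using int_pow_neg[of x 1] by simp

text \<open>Moving one \<open>b\<close> past one \<open>a\<close> costs a factor \<open>c\<close>,
  so exchanging their \<open>n\<close>-th powers costs \<open>n * n\<close> such factors, while the
  central parts of the four lifts contribute only linearly in \<open>n\<close>. The quadratic term
  fixes the sign of the exponent for large \<open>n\<close>.\<close>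

lemma commutator_pow_prod:
  assumes a: "a \<in> carrier G" and b: "b \<in> carrier G" and c: "c \<in> carrier G"
    and central: "\<And>g. g \<in> carrier G \<Longrightarrow> c \<otimes> g = g \<otimes> c"
    and ab: "a \<otimes> b = c \<otimes> (b \<otimes> a)"
  shows "(a \<otimes> c [^] i) [^] n \<otimes> (b \<otimes> c [^] j) [^] n \<otimes> (inv a \<otimes> c [^] k) [^] n
           \<otimes> (inv b \<otimes> c [^] l) [^] n = c [^] (int n * int n + int n * (i + j + k + l))"
    (is "?L = _")
proof -
  have cpow: "c [^] m \<otimes> g = g \<otimes> c [^] m" if "g \<in> carrier G" for g and m :: int
    using c central that by (rule central_int_pow)
  have ab_t: "a \<otimes> b [^] t = c [^] (int t) \<otimes> (b [^] t \<otimes> a)" for t :: nat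
  proof (induction t)
    case (Suc t)
    have "a \<otimes> b [^] Suc t = (a \<otimes> b [^] t) \<otimes> b" using a b by (simp add: m_assoc)
    also have "\<dots> = c [^] (int t) \<otimes> (b [^] t \<otimes> (a \<otimes> b))" using a b c Suc by (simp add: m_assoc)
    also have "\<dots> = c [^] (int t) \<otimes> (c \<otimes> (b [^] t \<otimes> (b \<otimes> a)))"
      unfolding ab using a b c central[of "b [^] t"] by (metis m_assoc m_closed nat_pow_closed)
    also have "\<dots> = (c [^] t \<otimes> c) \<otimes> (b [^] Suc t \<otimes> a)"
      using a b c by (simp add: m_assoc int_pow_int)
    also have "c [^] t \<otimes> c = c [^] (int (Suc t))"
      by (simp only: int_pow_int nat_pow_Suc)
    finally show ?case .
  qed (use a in simp)
  have ab_st: "a [^] s \<otimes> b [^] t = c [^] (int s * int t) \<otimes> (b [^] t \<otimes> a [^] s)" for s t :: nat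
  proof (induction s)
    case (Suc s)
    have "a [^] Suc s \<otimes> b [^] t = a [^] s \<otimes> (a \<otimes> b [^] t)" using a b by (simp add: m_assoc)
    also have "\<dots> = c [^] (int t) \<otimes> ((a [^] s \<otimes> b [^] t) \<otimes> a)"
      unfolding ab_t using a b c cpow[of "a [^] s" "int t"]
      by (metis int_pow_closed m_assoc m_closed nat_pow_closed)
    also have "\<dots> = c [^] (int t) \<otimes> (c [^] (int s * int t) \<otimes> (b [^] t \<otimes> a [^] Suc s))"
      unfolding Suc using a b c by (simp add: m_assoc)
    also have "\<dots> = c [^] (int t + int s * int t) \<otimes> (b [^] t \<otimes> a [^] Suc s)"
      using a b c by (simp add: m_assoc int_pow_mult)
    also have "int t + int s * int t = int (Suc s) * int t" by (simp add: distrib_right)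
    finally show ?case .
  qed (use b in simp)
  have pw: "(g \<otimes> c [^] m) [^] n = g [^] n \<otimes> c [^] (m * int n)" if "g \<in> carrier G" for g and m :: int
    using that c cpow[OF that] by (subst pow_mult_distrib) (simp_all flip: int_pow_int add:
      int_pow_pow)
  define x y where "x = a [^] n" and "y = b [^] n"
  have xy: "x \<in> carrier G" "y \<in> carrier G" using a b by (simp_all add: x_def y_def)
  have inv: "inv a [^] n = inv x" "inv b [^] n = inv y"
    using a b by (simp_all add: x_def y_def nat_pow_inv)
  have move: "c [^] m \<otimes> (g \<otimes> h) = g \<otimes> (c [^] m \<otimes> h)" if "g \<in> carrier G" "h \<in> carrier G"
    for g h and m :: int
    using that c cpow by (metis int_pow_closed m_assoc)
  have "?L = x \<otimes> c [^] (i * int n) \<otimes> (y \<otimes> c [^] (j * int n)) \<otimes> (inv x \<otimes> c [^] (k * int n))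
      \<otimes> (inv y \<otimes> c [^] (l * int n))"
    using a b by (simp add: pw inv x_def[symmetric] y_def[symmetric])
  also have "\<dots> = x \<otimes> (y \<otimes> (inv x \<otimes> (inv y \<otimes>
      (c [^] (i * int n) \<otimes> (c [^] (j * int n) \<otimes> (c [^] (k * int n) \<otimes> c [^] (l * int n)))))))"
    using xy c move[of y] move[of "inv x"] move[of "inv y"] by (simp add: m_assoc)
  also have "\<dots> = (x \<otimes> y) \<otimes> (inv x \<otimes> (inv y \<otimes> c [^] (i * int n + (j * int n + (k * int n + l * int
    n)))))"
    using xy c by (simp add: m_assoc int_pow_mult)
  also have "\<dots> = c [^] (int n * int n) \<otimes> c [^] (i * int n + (j * int n + (k * int n + l * int n)))"
    unfolding x_def y_def ab_st using a b c by (simp add: m_assoc)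
  also have "\<dots> = c [^] (int n * int n + int n * (i + j + k + l))"
    using c by (simp add: algebra_simps flip: int_pow_mult)
  finally show ?thesis .
qed

lemma submonoid_nat_pow:
  assumes "submonoid M G" "x \<in> M"
  shows "x [^] (n::nat) \<in> M"
  using assms by (induction n) (auto intro: submonoid.m_closed submonoid.one_closed)

lemma central_commutator_saturation:
  assumes M: "submonoid M G" and a: "a \<in> carrier G" and b: "b \<in> carrier G"
    and central: "\<And>g. g \<in> carrier G \<Longrightarrow> a \<otimes> b \<otimes> inv a \<otimes> inv b \<otimes> g = g \<otimes> (a \<otimes> b \<otimes> inv a \<otimes> inv b)"
    and cover: "\<And>g. g \<in> carrier G \<Longrightarrow> \<exists>k::int. g \<otimes> (a \<otimes> b \<otimes> inv a \<otimes> inv b) [^] k \<in> M"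
  shows "carrier G \<subseteq> M"
proof -
  define c where "c = a \<otimes> b \<otimes> inv a \<otimes> inv b"
  note central = central[folded c_def] and cover = cover[folded c_def]
  have c: "c \<in> carrier G" using a b by (simp add: c_def)
  note mult = submonoid.m_closed[OF M]
  define P where "P = {k::int. c [^] k \<in> M}"
  have zero: "0 \<in> P" using submonoid.one_closed[OF M] by (simp add: P_def)
  have add: "x + y \<in> P" if "x \<in> P" "y \<in> P" for x y
    using that c mult by (simp add: P_def int_pow_mult)
  obtain i j k l :: int where M4: "a \<otimes> c [^] i \<in> M" "b \<otimes> c [^] j \<in> M" "inv a \<otimes> c [^] k \<in> M"
    "inv b \<otimes> c [^] l \<in> M"
    using cover a b by (meson inv_closed)
  define e where "e = i + j + k + l"
  have ab: "a \<otimes> b = c \<otimes> (b \<otimes> a)" using a b by (simp add: c_def m_assoc)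
  have plus: "int n * int n + int n * e \<in> P" for n
    unfolding P_def mem_Collect_eq e_def
    by (subst commutator_pow_prod[OF a b c central ab, symmetric])
      (intro mult submonoid_nat_pow M M4 | assumption)+
  have ic: "inv c \<in> carrier G" "\<And>g. g \<in> carrier G \<Longrightarrow> inv c \<otimes> g = g \<otimes> inv c"
    using c central by (auto, metis inv_closed inv_inv inv_mult_group inv_solve_left m_closed)
  have ba: "b \<otimes> a = inv c \<otimes> (a \<otimes> b)" using a b c by (simp add: ab)
  have ipow: "inv c [^] (- m) = c [^] m" for m :: int
    using c by (simp add: int_pow_inv int_pow_neg)
  \<comment> \<open>Swapping \<open>a\<close> and \<open>b\<close> turns \<open>c\<close> into its
    inverse. The same lifts read as \<open>b \<otimes> inv c [^] (- j)\<close> and so on, so in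
    powers of \<open>c\<close> the quadratic term changes its sign and the linear term does
    not.\<close>
  have minus: "- (int n * int n) + int n * e \<in> P" for n
  proof -
    have "inv c [^] (int n * int n + int n * (- j + - i + - l + - k)) \<in> M"
      by (subst commutator_pow_prod[OF b a ic ba, symmetric], assumption)
        (unfold ipow, intro mult submonoid_nat_pow M M4)
    moreover have "int n * int n + int n * (- j + - i + - l + - k)
      = - (- (int n * int n) + int n * e)"
      by (simp add: e_def algebra_simps)
    ultimately show ?thesis unfolding P_def by (metis ipow mem_Collect_eq)
  qed
  \<comment> \<open>The lifts of \<open>a\<close> and \<open>inv a\<close> multiply to a power of
    \<open>c\<close> without a quadratic term, and so do those of \<open>b\<close> and
    \<open>inv b\<close>.\<close>
  have "e \<in> P"
  proof -
    note cg = central_int_pow[OF c central]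
    have "(a \<otimes> c [^] i) \<otimes> (inv a \<otimes> c [^] k) \<otimes> ((b \<otimes> c [^] j) \<otimes> (inv b \<otimes> c [^] l)) \<in> M"
      by (intro mult M4)
    also have "(a \<otimes> c [^] i) \<otimes> (inv a \<otimes> c [^] k) = c [^] (i + k)"
      using a c cg[of "inv a" i] by (simp add: int_pow_mult m_assoc) (simp flip: m_assoc)
    also have "(b \<otimes> c [^] j) \<otimes> (inv b \<otimes> c [^] l) = c [^] (j + l)"
      using b c cg[of "inv b" j] by (simp add: int_pow_mult m_assoc) (simp flip: m_assoc)
    finally show ?thesis using c by (simp add: P_def e_def algebra_simps flip: int_pow_mult)
  qed
  \<comment> \<open>Any \<open>n\<close> above the absolute value of \<open>e\<close> lets the
    quadratic term dominate in both exponents.\<close>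
  define n where "n = nat \<bar>e\<bar> + 1"
  have "int n * (int n + e) > 0" "int n * (int n - e) > 0"
    by (intro mult_pos_pos; simp add: n_def)+
  then have "int n * int n + int n * e > 0" "- (int n * int n) + int n * e < 0"
    by (simp_all add: algebra_simps)
  then have uminus: "- x \<in> P" if "x \<in> P" for x
    using int_submonoid_uminus[OF zero add] plus minus that by blast
  \<comment> \<open>\<open>1 + e\<close> is the case \<open>n = 1\<close> of \<open>plus\<close>,
    and \<open>- e\<close> is available now that \<open>P\<close> is closed under negation.\<close>
  have "1 \<in> P"
    using add[OF plus[of 1] uminus[OF \<open>e \<in> P\<close>]] by simp
  have "m \<in> P" for m
  proof -
    have "int q \<in> P" for q
      using zero add[OF \<open>1 \<in> P\<close>] by (induction q) auto
    then show ?thesis using uminus by (cases m rule: int_cases2) auto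
  qed
  show ?thesis
  proof
    fix g assume g: "g \<in> carrier G"
    then obtain m :: int where "g \<otimes> c [^] m \<in> M" using cover by blast
    moreover have "c [^] (- m) \<in> M" using \<open>- m \<in> P\<close> by (simp add: P_def)
    ultimately have "g \<otimes> c [^] m \<otimes> c [^] (- m) \<in> M" by (rule mult)
    then show "g \<in> M" using g c by (simp add: m_assoc flip: int_pow_mult)
  qed
qed


lemma generate_conj:
  assumes H: "H \<subseteq> carrier G" and K: "subgroup K G" and g: "g \<in> carrier G"
    and conj: "\<And>h. h \<in> H \<Longrightarrow> g \<otimes> h \<otimes> inv g \<in> K"
    and "h \<in> generate G H"
  shows "g \<otimes> h \<otimes> inv g \<in> K"
  using assms(5)
proof (induction h)
  case one
  then show ?case using g subgroup.one_closed[OF K] by simp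
next
  case (incl h)
  then show ?case by (rule conj)
next
  case (inv h)
  then have "inv (g \<otimes> h \<otimes> inv g) \<in> K"
    by (intro subgroup.m_inv_closed[OF K] conj)
  moreover have "inv (g \<otimes> h \<otimes> inv g) = g \<otimes> inv h \<otimes> inv g"
    using inv H g by (auto simp: inv_mult_group m_assoc)
  ultimately show ?case by simp
next
  case (eng h k)
  then have "(g \<otimes> h \<otimes> inv g) \<otimes> (g \<otimes> k \<otimes> inv g) \<in> K"
    by (metis subgroup.m_closed[OF K])
  moreover have "(g \<otimes> h \<otimes> inv g) \<otimes> (g \<otimes> k \<otimes> inv g) = g \<otimes> (h \<otimes> k) \<otimes> inv g"
    using generate_in_carrier[OF H eng.hyps(1)] generate_in_carrier[OF H eng.hyps(2)] g
    by (simp add: m_assoc)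
  ultimately show ?case by simp
qed

text \<open>Both directions of conjugation are assumed, since a conjugation can map a subgroup
  properly into itself; together they give invariance under all integer powers.\<close>

lemma conj_int_pow:
  fixes k :: int
  assumes K: "subgroup K G" and c: "c \<in> carrier G"
    and conj: "\<And>h. h \<in> K \<Longrightarrow> c \<otimes> h \<otimes> inv c \<in> K" "\<And>h. h \<in> K \<Longrightarrow> inv c \<otimes> h \<otimes> c \<in> K"
    and "h \<in> K"
  shows "inv (c [^] k) \<otimes> h \<otimes> c [^] k \<in> K"
proof (induction k rule: int_induct[where k = 0])
  case base
  then show ?case using \<open>h \<in> K\<close> subgroup.mem_carrier[OF K] by simp
next
  case (step1 k)
  have "inv c \<otimes> (inv (c [^] k) \<otimes> h \<otimes> c [^] k) \<otimes> c \<in> K" by (rule conj(2)[OF step1(2)])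
  then show ?case using c subgroup.mem_carrier[OF K \<open>h \<in> K\<close>]
    by (simp add: int_pow_mult inv_mult_group m_assoc)
next
  case (step2 k)
  have "c \<otimes> (inv (c [^] k) \<otimes> h \<otimes> c [^] k) \<otimes> inv c \<in> K" by (rule conj(1)[OF step2(2)])
  moreover have "c [^] (k - 1) = c [^] k \<otimes> inv c"
    using c int_pow_mult[of c k "- 1"] by simp
  ultimately show ?case using c subgroup.mem_carrier[OF K \<open>h \<in> K\<close>]
    by (simp add: inv_mult_group m_assoc)
qed

lemma generate_insert_eq:
  assumes c: "c \<in> carrier G" and K_def: "generate G H = K" and H: "H \<subseteq> carrier G"
    and conj: "\<And>h. h \<in> K \<Longrightarrow> c \<otimes> h \<otimes> inv c \<in> K" "\<And>h. h \<in> K \<Longrightarrow> inv c \<otimes> h \<otimes> c \<in> K"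
  shows "generate G (insert c H) = {c [^] k \<otimes> h |(k::int) h. h \<in> K}"
proof -
  interpret K: subgroup K G unfolding K_def[symmetric] by (rule generate_is_subgroup[OF H])
  have move: "\<exists>h'\<in>K. h \<otimes> c [^] l = c [^] l \<otimes> h'" if "h \<in> K" for h and l :: int
    using conj_int_pow[OF K.subgroup_axioms c conj that, of l] c that
    by (intro bexI[of _ "inv (c [^] l) \<otimes> h \<otimes> c [^] l"]) (simp_all add: m_assoc)
  show ?thesis
  proof (intro equalityI subsetI)
    fix x assume "x \<in> generate G (insert c H)"
    then show "x \<in> {c [^] k \<otimes> h |(k::int) h. h \<in> K}"
    proof induction
      case one
      have "\<one> = c [^] (0::int) \<otimes> \<one>" by simp
      then show ?case using K.one_closed by blast
    next
      case (incl h)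
      show ?case
      proof (cases "h = c")
        case True
        then have "h = c [^] (1::int) \<otimes> \<one>" using c by simp
        then show ?thesis using K.one_closed by blast
      next
        case False
        with incl have "h \<in> K" using K_def generate.incl by force
        moreover from this have "h = c [^] (0::int) \<otimes> h" by simp
        ultimately show ?thesis by blast
      qed
    next
      case (inv h)
      show ?case
      proof (cases "h = c")
        case True
        then have "inv h = c [^] (- 1::int) \<otimes> \<one>" using c by (simp add: int_pow_neg)
        then show ?thesis using K.one_closed by blast
      next
        case False
        with inv have "inv h \<in> K" using K_def generate.inv by force
        moreover from this have "inv h = c [^] (0::int) \<otimes> inv h" by simp
        ultimately show ?thesis by blast
      qed
    next
      case (eng x y)
      then obtain k l :: int and h h' where x: "x = c [^] k \<otimes> h" "h \<in> K" and y: "y = c [^] l \<otimes> h'"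
        "h' \<in> K"
        by blast
      obtain h'' where h'': "h'' \<in> K" "h \<otimes> c [^] l = c [^] l \<otimes> h''"
        using move[OF x(2), of l] by auto
      have "x \<otimes> y = c [^] k \<otimes> (h \<otimes> c [^] l) \<otimes> h'"
        using x y c by (simp add: m_assoc)
      also have "\<dots> = c [^] (k + l) \<otimes> (h'' \<otimes> h')"
        unfolding h''(2) using h''(1) y(2) c by (simp add: m_assoc int_pow_mult)
      finally show ?case using h''(1) y(2) by blast
    qed
  next
    fix x assume "x \<in> {c [^] k \<otimes> h |(k::int) h. h \<in> K}"
    then obtain k :: int and h where x: "x = c [^] k \<otimes> h" "h \<in> K" by blast
    have "c [^] k \<in> generate G (insert c H)"
      using c H by (intro subgroup_int_pow_closed generate_is_subgroup generate.incl) auto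
    moreover have "h \<in> generate G (insert c H)"
      using x(2) mono_generate[of H "insert c H"] K_def by auto
    ultimately show "x \<in> generate G (insert c H)" unfolding x by (rule generate.eng)
  qed
qed

end

lemma (in group_hom) submonoid_image:
  assumes M: "submonoid M G"
  shows "submonoid (h ` M) H"
proof
  show "h ` M \<subseteq> carrier H" using submonoid.subset[OF M] by auto
  show "\<one>\<^bsub>H\<^esub> \<in> h ` M" using hom_one submonoid.one_closed[OF M] by (metis imageI)
  fix x y assume "x \<in> h ` M" "y \<in> h ` M"
  then obtain m k where m: "m \<in> M" "k \<in> M" "x = h m" "y = h k" by blast
  then have "x \<otimes>\<^bsub>H\<^esub> y = h (m \<otimes> k)" using submonoid.subset[OF M] by (subst hom_mult) auto
  then show "x \<otimes>\<^bsub>H\<^esub> y \<in> h ` M" using submonoid.m_closed[OF M m(1,2)] by blast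
qed

context group
begin

text \<open>In the quotient by \<open>K\<close> the commutator \<open>c\<close> is central, which
  leads back to the central case. The result is pulled back because \<open>K \<subseteq> M\<close>
  makes membership in \<open>M\<close> a property of the coset.\<close>

lemma saturation_step:
  assumes K: "K \<lhd> G" and M: "submonoid M G" and "K \<subseteq> M"
    and a: "a \<in> carrier G" and b: "b \<in> carrier G" and c: "c = a \<otimes> b \<otimes> inv a \<otimes> inv b"
    and central: "\<And>g. g \<in> carrier G \<Longrightarrow> c \<otimes> g \<otimes> inv c \<otimes> inv g \<in> K"
    and cover: "\<And>g. g \<in> carrier G \<Longrightarrow> \<exists>k::int. g \<otimes> c [^] k \<in> M"
  shows "carrier G \<subseteq> M"
proof -
  interpret K: normal K G by (rule K)
  define Q where "Q = G Mod K"
  interpret Q: group Q unfolding Q_def by (rule K.factorgroup_is_group)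
  interpret p: group_hom G Q "\<lambda>g. K #> g"
    by unfold_locales (unfold Q_def, rule K.r_coset_hom_Mod)
  let ?p = "\<lambda>g. K #> g"
  have carrier: "carrier Q = ?p ` carrier G"
    by (auto simp: Q_def FactGroup_def RCOSETS_def)
  let ?c = "?p a \<otimes>\<^bsub>Q\<^esub> ?p b \<otimes>\<^bsub>Q\<^esub> inv\<^bsub>Q\<^esub> ?p a \<otimes>\<^bsub>Q\<^esub> inv\<^bsub>Q\<^esub> ?p b"
  have c': "c \<in> carrier G" using a b c by simp
  have pc: "?c = ?p c"
    unfolding c using a b by (simp only: p.hom_mult p.hom_inv m_closed inv_closed)
  have "carrier Q \<subseteq> ?p ` M"
  proof (rule Q.central_commutator_saturation)
    show "submonoid (?p ` M) Q" by (rule p.submonoid_image[OF M])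
    show "?p a \<in> carrier Q" "?p b \<in> carrier Q"
      using a b by simp_all
  next
    fix x assume "x \<in> carrier Q"
    then obtain g where g: "g \<in> carrier G" "x = ?p g" unfolding carrier by blast
    have "c \<otimes> g = (c \<otimes> g \<otimes> inv c \<otimes> inv g) \<otimes> (g \<otimes> c)"
      using c' g by (simp add: m_assoc)
    moreover have "?p ((c \<otimes> g \<otimes> inv c \<otimes> inv g) \<otimes> (g \<otimes> c)) = ?p (g \<otimes> c)"
      using central[OF g(1)] c' g(1)
      by (metis K.rcos_const K.subset coset_mult_assoc m_closed subsetD is_group)
    ultimately have "?p (c \<otimes> g) = ?p (g \<otimes> c)" by simp
    then show "?c
        \<otimes>\<^bsub>Q\<^esub> x = x \<otimes>\<^bsub>Q\<^esub> ?c"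
      unfolding pc g(2) using g(1) c' by simp
    obtain k :: int where "g \<otimes> c [^] k \<in> M" using cover g(1) by blast
    moreover have "?p (g \<otimes> c [^] k) = x \<otimes>\<^bsub>Q\<^esub> ?p c [^]\<^bsub>Q\<^esub> k"
      using g c' by (simp add: p.hom_int_pow)
    ultimately show "\<exists>k::int. x \<otimes>\<^bsub>Q\<^esub> ?c [^]\<^bsub>Q\<^esub> k \<in> ?p ` M"
      unfolding pc by (metis imageI)
  qed
  show ?thesis
  proof
    fix g assume g: "g \<in> carrier G"
    then have "?p g \<in> ?p ` M" using \<open>carrier Q \<subseteq> ?p ` M\<close> carrier by blast
    then obtain m where m: "m \<in> M" "?p g = ?p m" by blast
    then have "g \<in> K #> m" using rcos_self[OF g K.subgroup_axioms] by simp
    then obtain k where "k \<in> K" "g = k \<otimes> m" by (auto simp: r_coset_def)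
    then show "g \<in> M" using m(1) \<open>K \<subseteq> M\<close> submonoid.m_closed[OF M] by auto
  qed
qed

end

section \<open>Lists whose tails generate a central series with cyclic factors\<close>

fun central_series :: "('a, 'b) monoid_scheme \<Rightarrow> 'a list \<Rightarrow> bool" where
  "central_series G [] = True"
| "central_series G (c # cs) \<longleftrightarrow> c \<in> carrier G \<and> central_series G cs \<and>
     (\<forall>g\<in>carrier G. c \<otimes>\<^bsub>G\<^esub> g \<otimes>\<^bsub>G\<^esub> inv\<^bsub>G\<^esub> c \<otimes>\<^bsub>G\<^esub> inv\<^bsub>G\<^esub> g \<in> generate G (set cs))"

lemma central_series_subset: "central_series G cs \<Longrightarrow> set cs \<subseteq> carrier G"
  by (induction cs) auto

context group
begin

lemma central_series_normal:
  assumes "central_series G cs"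
  shows "generate G (set cs) \<lhd> G"
  using assms
proof (induction cs)
  case Nil
  then show ?case by (simp add: generate_empty one_is_normal)
next
  case (Cons c cs)
  interpret K: normal "generate G (set cs)" G using Cons by simp
  have c: "c \<in> carrier G" using Cons.prems by simp
  have mono: "generate G (set cs) \<subseteq> generate G (set (c # cs))"
    by (rule mono_generate) auto
  note sub = central_series_subset[OF Cons.prems]
  show ?case
  proof (rule normal_invI[OF generate_is_subgroup[OF sub]], rule generate_conj[OF sub
    generate_is_subgroup[OF sub]])
    fix h g assume h: "h \<in> set (c # cs)" and g: "g \<in> carrier G"
    show "g \<otimes> h \<otimes> inv g \<in> generate G (set (c # cs))"
    proof (cases "h = c")
      case True
      have "inv (c \<otimes> g \<otimes> inv c \<otimes> inv g) \<in> generate G (set cs)"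
        using Cons.prems g by simp
      moreover have "g \<otimes> c \<otimes> inv g = inv (c \<otimes> g \<otimes> inv c \<otimes> inv g) \<otimes> c"
        using c g by (simp add: inv_mult_group m_assoc)
      ultimately show ?thesis
        unfolding True using mono by (auto intro: generate.eng generate.incl)
    next
      case False
      with h have "h \<in> generate G (set cs)" by (auto intro: generate.incl)
      with g mono show ?thesis using K.inv_op_closed2 by blast
    qed
  qed
qed

text \<open>The set is the product \<open>M K\<close>; normality carries \<open>k\<close> past
  \<open>y\<close>.\<close>

lemma submonoid_normal_mult:
  assumes K: "K \<lhd> G" and M: "submonoid M G"
  shows "submonoid {g \<in> carrier G. \<exists>k\<in>K. g \<otimes> k \<in> M} G"
proof
  interpret K: normal K G by (rule K)
  show "\<one> \<in> {g \<in> carrier G. \<exists>k\<in>K. g \<otimes> k \<in> M}"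
    using submonoid.one_closed[OF M] K.one_closed by force
  fix x y assume "x \<in> {g \<in> carrier G. \<exists>k\<in>K. g \<otimes> k \<in> M}" "y \<in> {g \<in> carrier G. \<exists>k\<in>K. g \<otimes> k \<in> M}"
  then obtain k l where x: "x \<in> carrier G" "k \<in> K" "x \<otimes> k \<in> M" and y: "y \<in> carrier G" "l \<in> K"
    "y \<otimes> l \<in> M"
    by blast
  have "x \<otimes> k \<otimes> (y \<otimes> l) \<in> M" using M x(3) y(3) by (rule submonoid.m_closed)
  moreover have "x \<otimes> k \<otimes> (y \<otimes> l) = x \<otimes> y \<otimes> ((inv y \<otimes> k \<otimes> y) \<otimes> l)"
    using x(1,2) y(1,2) by (simp add: m_assoc)
  moreover have "(inv y \<otimes> k \<otimes> y) \<otimes> l \<in> K"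
    using x(2) y(1,2) K.inv_op_closed1 by auto
  ultimately show "x \<otimes> y \<in> {g \<in> carrier G. \<exists>k\<in>K. g \<otimes> k \<in> M}"
    using x(1) y(1) by (auto intro!: bexI[of _ "(inv y \<otimes> k \<otimes> y) \<otimes> l"])
qed auto

text \<open>The series is consumed from the top. With \<open>K\<close> generated by the tail,
  \<open>M K\<close> contains \<open>K\<close> and reaches every element up to a power of
  \<open>c\<close>, so \<open>saturation_step\<close> makes it all of \<open>G\<close>. Hence
  \<open>M\<close> meets every coset of \<open>K\<close>, which is the assumption for the
  tail.\<close>

lemma saturation:
  assumes "central_series G cs"
    and "\<forall>c\<in>set cs. \<exists>a\<in>carrier G. \<exists>b\<in>carrier G. c = a \<otimes> b \<otimes> inv a \<otimes> inv b"
    and M: "submonoid M G"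
    and "\<And>g. g \<in> carrier G \<Longrightarrow> \<exists>h\<in>generate G (set cs). g \<otimes> h \<in> M"
  shows "carrier G \<subseteq> M"
  using assms(1,2,4)
proof (induction cs)
  case Nil
  show ?case
  proof
    fix g assume "g \<in> carrier G"
    with Nil(3)[OF this] show "g \<in> M" by (simp add: generate_empty)
  qed
next
  case (Cons c cs)
  define K where "K = generate G (set cs)"
  have K: "K \<lhd> G" using central_series_normal Cons.prems(1) by (simp add: K_def)
  interpret K: normal K G by (rule K)
  define M' where "M' = {g \<in> carrier G. \<exists>k\<in>K. g \<otimes> k \<in> M}"
  obtain a b where ab: "a \<in> carrier G" "b \<in> carrier G" "c = a \<otimes> b \<otimes> inv a \<otimes> inv b"
    using Cons.prems(2) by auto
  have c: "c \<in> carrier G" using Cons.prems(1) by simp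
  have "carrier G \<subseteq> M'"
  proof (rule saturation_step[OF K _ _ ab])
    show "submonoid M' G" unfolding M'_def by (rule submonoid_normal_mult[OF K M])
    show "K \<subseteq> M'"
    proof
      fix k assume "k \<in> K"
      moreover from this have "k \<otimes> inv k \<in> M" using submonoid.one_closed[OF M] by simp
      ultimately show "k \<in> M'" unfolding M'_def by (auto intro!: bexI[of _ "inv k"])
    qed
    show "c \<otimes> g \<otimes> inv c \<otimes> inv g \<in> K" if "g \<in> carrier G" for g
      using Cons.prems(1) that by (simp add: K_def)
    show "\<exists>k::int. g \<otimes> c [^] k \<in> M'" if g: "g \<in> carrier G" for g
    proof -
      obtain h where h: "h \<in> generate G (insert c (set cs))" "g \<otimes> h \<in> M"
        using Cons.prems(3)[OF g] by auto
      then obtain k :: int and h' where "h = c [^] k \<otimes> h'" "h' \<in> K"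
        using generate_insert_eq[OF c K_def[symmetric]] central_series_subset[of G cs]
          Cons.prems(1) K.inv_op_closed1[OF c] K.inv_op_closed2[OF c] by auto
      with h(2) g c have "g \<otimes> c [^] k \<in> M'"
        unfolding M'_def by (auto simp: m_assoc)
      then show ?thesis ..
    qed
  qed
  then show ?case
    using Cons.prems by (intro Cons.IH) (auto simp: M'_def K_def)
qed


section \<open>The lower central series refined to cyclic factors\<close>

lemma central_series_append:
  assumes "central_series G cs" "set ds \<subseteq> carrier G"
    and "\<And>d g. d \<in> set ds \<Longrightarrow> g \<in> carrier G \<Longrightarrow> d \<otimes> g \<otimes> inv d \<otimes> inv g \<in> generate G (set cs)"
  shows "central_series G (ds @ cs)"
  using assms
proof (induction ds)
  case (Cons d ds)
  have "generate G (set cs) \<subseteq> generate G (set (ds @ cs))"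
    by (rule mono_generate) auto
  with Cons show ?case by auto
qed simp

lemma lower_central_normal: "lower_central G n \<lhd> G"
proof (induction n)
  case 0
  show ?case by (simp add: normal_self)
next
  case (Suc n)
  interpret N: normal "lower_central G n" G by (rule Suc)
  show ?case unfolding lower_central.simps commutator_subgroup_def
  proof (rule normal_generateI)
    fix c g assume "c \<in> (\<Union>h\<in>lower_central G n. \<Union>k\<in>carrier G. {h \<otimes> k \<otimes> inv h \<otimes> inv k})" and g:
      "g \<in> carrier G"
    then obtain h k where hk: "h \<in> lower_central G n" "k \<in> carrier G" "c = h \<otimes> k \<otimes> inv h \<otimes> inv k"
      by blast
    let ?h = "g \<otimes> h \<otimes> inv g" and ?k = "g \<otimes> k \<otimes> inv g"
    have "g \<otimes> c \<otimes> inv g = ?h \<otimes> ?k \<otimes> inv ?h \<otimes> inv ?k"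
      using hk g by (simp add: m_assoc inv_mult_group)
    moreover have "?h \<in> lower_central G n" "?k \<in> carrier G"
      using hk g N.inv_op_closed2 by auto
    ultimately show "g \<otimes> c \<otimes> inv g \<in> (\<Union>h\<in>lower_central G n. \<Union>k\<in>carrier G. {h \<otimes> k \<otimes> inv h \<otimes> inv k})"
      by blast
  qed auto
qed

lemma commutator_in_lower_central_Suc:
  "h \<in> lower_central G n \<Longrightarrow> k \<in> carrier G \<Longrightarrow> h \<otimes> k \<otimes> inv h \<otimes> inv k \<in> lower_central G (Suc n)"
  unfolding lower_central.simps commutator_subgroup_def by (intro generate.incl) blast

lemma lower_central_Suc_subset: "lower_central G (Suc n) \<subseteq> lower_central G n"
proof -
  interpret N: normal "lower_central G n" G by (rule lower_central_normal)
  have "h \<otimes> k \<otimes> inv h \<otimes> inv k \<in> lower_central G n" if "h \<in> lower_central G n" "k \<in> carrier G"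
    for h k
  proof -
    have "h \<otimes> (k \<otimes> inv h \<otimes> inv k) \<in> lower_central G n"
      using that N.inv_op_closed2 by auto
    then show ?thesis using that by (simp add: m_assoc)
  qed
  then show ?thesis unfolding lower_central.simps commutator_subgroup_def
    by (intro generate_subgroup_incl N.subgroup_axioms) auto
qed

end

text \<open>Left-normed commutators of \<open>n + 1\<close> elements of \<open>X\<close>, not the
  basic commutators of Hall.\<close>

primrec basic_commutators :: "('a, 'b) monoid_scheme \<Rightarrow> 'a set \<Rightarrow> nat \<Rightarrow> 'a set" where
  "basic_commutators G X 0 = X"
| "basic_commutators G X (Suc n) = (\<lambda>(c, x). c \<otimes>\<^bsub>G\<^esub> x \<otimes>\<^bsub>G\<^esub> inv\<^bsub>G\<^esub> c \<otimes>\<^bsub>G\<^esub> inv\<^bsub>G\<^esub> x) `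
  (basic_commutators G X n \<times> X)"

lemma finite_basic_commutators: "finite X \<Longrightarrow> finite (basic_commutators G X n)"
  by (induction n) auto

context group
begin

lemma basic_commutators_subset:
  assumes "X \<subseteq> carrier G"
  shows "basic_commutators G X n \<subseteq> lower_central G n"
proof (induction n)
  case (Suc n)
  then show ?case
    using assms commutator_in_lower_central_Suc[of _ n] by (auto simp del: lower_central.simps)
qed (use assms in simp)

text \<open>Commutators of \<open>lower_central G n\<close> with \<open>G\<close> are multiplicative
  in both arguments modulo \<open>lower_central G (n + 2)\<close>, so generators of the two groups
  suffice.\<close>

lemma lower_central_generated:
  assumes X: "X \<subseteq> carrier G" and gen: "generate G X = carrier G"
  shows "lower_central G n \<subseteq> generate G (basic_commutators G X n \<union> lower_central G (Suc n))"
proof (induction n)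
  case 0
  then show ?case using gen mono_generate[of X "X \<union> lower_central G (Suc 0)"] by auto
next
  case (Suc n)
  interpret N0: normal "lower_central G n" G by (rule lower_central_normal)
  interpret N1: normal "lower_central G (Suc n)" G by (rule lower_central_normal)
  let ?B = "basic_commutators G X (Suc n) \<union> lower_central G (Suc (Suc n))"
  define L where "L = generate G ?B"
  have B: "?B \<subseteq> lower_central G (Suc n)"
    using basic_commutators_subset[OF X] lower_central_Suc_subset by blast
  then have L: "subgroup L G" unfolding L_def
    by (intro generate_is_subgroup) (use N1.subset in blast)
  interpret L: subgroup L G by (rule L)
  have L_sub: "L \<subseteq> lower_central G (Suc n)"
    unfolding L_def by (rule generate_subgroup_incl[OF B N1.subgroup_axioms])
  have N2_L: "lower_central G (Suc (Suc n)) \<subseteq> L"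
    unfolding L_def by (auto intro: generate.incl)
  \<comment> \<open>\<open>L\<close> is normal because it lies between two consecutive terms of the
    lower central series.\<close>
  have conj: "k \<otimes> l \<otimes> inv k \<in> L" if "l \<in> L" "k \<in> carrier G" for l k
  proof -
    have "inv (l \<otimes> k \<otimes> inv l \<otimes> inv k) \<otimes> l \<in> L"
      using that L_sub N2_L commutator_in_lower_central_Suc[of l "Suc n" k] by blast
    then show ?thesis using that by (simp add: inv_mult_group m_assoc)
  qed
  have step_right: "\<forall>k\<in>carrier G. c \<otimes> k \<otimes> inv c \<otimes> inv k \<in> L"
    if c: "c \<in> basic_commutators G X n" for c
  proof
    have c': "c \<in> carrier G"
      using basic_commutators_subset[OF X, of n] c N0.subset by blast
    fix k assume "k \<in> carrier G"
    then have "k \<in> generate G X" by (simp add: gen)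
    then show "c \<otimes> k \<otimes> inv c \<otimes> inv k \<in> L"
    proof induction
      case one
      then show ?case using c' by simp
    next
      case (incl x)
      with c show ?case unfolding L_def by (force intro: generate.incl)
    next
      case (inv x)
      then have x: "x \<in> carrier G" using X by blast
      have "c \<otimes> x \<otimes> inv c \<otimes> inv x \<in> L"
        using c inv unfolding L_def by (force intro: generate.incl)
      then have "inv x \<otimes> inv (c \<otimes> x \<otimes> inv c \<otimes> inv x) \<otimes> inv (inv x) \<in> L"
        using x by (intro conj) auto
      then show ?case using x c' by (simp add: inv_mult_group m_assoc)
    next
      case (eng k l)
      then have kl: "k \<in> carrier G" "l \<in> carrier G" by (auto simp: gen)
      \<comment> \<open>The identity \<open>[c, k l] = [c, k] (k [c, l] inv k)\<close> splits the
        right argument; the left argument is split similarly further down.\<close>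
      have "(c \<otimes> k \<otimes> inv c \<otimes> inv k) \<otimes> (k \<otimes> (c \<otimes> l \<otimes> inv c \<otimes> inv l) \<otimes> inv k) \<in> L"
        using eng.IH kl by (meson L.m_closed conj)
      then show ?case using kl c' by (simp add: inv_mult_group m_assoc)
    qed
  qed
  have step_left: "h \<otimes> k \<otimes> inv h \<otimes> inv k \<in> L"
    if "h \<in> lower_central G n" and k: "k \<in> carrier G" for h k
  proof -
    have "h \<in> generate G (basic_commutators G X n \<union> lower_central G (Suc n))"
      using Suc that(1) by blast
    then have "h \<otimes> k \<otimes> inv h \<otimes> inv k \<in> L \<and> h \<in> carrier G"
    proof induction
      case one
      then show ?case using k by simp
    next
      case (incl h)
      then show ?case
        using step_right k commutator_in_lower_central_Suc[of h "Suc n" k] N2_L N1.subset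
          basic_commutators_subset[OF X, of n] N0.subset by blast
    next
      case (inv h)
      then have h: "h \<in> carrier G"
        using N1.subset basic_commutators_subset[OF X, of n] N0.subset by blast
      have "h \<otimes> k \<otimes> inv h \<otimes> inv k \<in> L"
        using inv step_right k commutator_in_lower_central_Suc[of h "Suc n" k] N2_L by blast
      then have "inv h \<otimes> inv (h \<otimes> k \<otimes> inv h \<otimes> inv k) \<otimes> inv (inv h) \<in> L"
        using h by (intro conj) auto
      then show ?case using h k by (simp add: inv_mult_group m_assoc)
    next
      case (eng h l)
      have "(h \<otimes> (l \<otimes> k \<otimes> inv l \<otimes> inv k) \<otimes> inv h) \<otimes> (h \<otimes> k \<otimes> inv h \<otimes> inv k) \<in> L"
        using eng.IH by (meson L.m_closed conj)
      then show ?case using eng k by (simp add: inv_mult_group m_assoc)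
    qed
    then show ?thesis ..
  qed
  have "lower_central G (Suc n) \<subseteq> L"
    unfolding lower_central.simps(2)[of G n] commutator_subgroup_def
    by (rule generate_subgroup_incl[OF _ L]) (use step_left in blast)
  then show ?case by (simp only: L_def)
qed

text \<open>The series is assembled from the trivial term upwards, each layer from finitely many
  left-normed commutators. Except in the topmost layer, which consists of the generators, all
  entries are commutators of elements of \<open>G\<close>, as \<open>saturation\<close>
  demands.\<close>

lemma nilpotent_central_series:
  assumes X: "finite X" "X \<subseteq> carrier G" "generate G X = carrier G"
    and "lower_central G (n + d) = {\<one>}"
  shows "\<exists>cs. central_series G cs \<and> generate G (set cs) = lower_central G n \<and>
    (n > 0 \<longrightarrow> (\<forall>c\<in>set cs. \<exists>a\<in>carrier G. \<exists>b\<in>carrier G. c = a \<otimes> b \<otimes> inv a \<otimes> inv b))"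
  using assms(4)
proof (induction d arbitrary: n)
  case 0
  then show ?case by (intro exI[of _ "[]"]) (simp add: generate_empty)
next
  case (Suc d)
  then obtain cs where cs: "central_series G cs" "generate G (set cs) = lower_central G (Suc n)"
    "\<forall>c\<in>set cs. \<exists>a\<in>carrier G. \<exists>b\<in>carrier G. c = a \<otimes> b \<otimes> inv a \<otimes> inv b"
    using Suc.IH[of "Suc n"] by auto
  obtain ds where ds: "set ds = basic_commutators G X n"
    using finite_basic_commutators[OF X(1)] finite_list by blast
  interpret N0: normal "lower_central G n" G by (rule lower_central_normal)
  have ds_sub: "set ds \<subseteq> lower_central G n"
    unfolding ds by (rule basic_commutators_subset[OF X(2)])
  have "central_series G (ds @ cs)"
  proof (rule central_series_append[OF cs(1)])
    show "d \<otimes> g \<otimes> inv d \<otimes> inv g \<in> generate G (set cs)" if "d \<in> set ds" "g \<in> carrier G" for d g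
      unfolding cs(2) using that ds_sub by (intro commutator_in_lower_central_Suc) auto
  qed (use ds_sub N0.subset in blast)
  moreover have "generate G (set (ds @ cs)) = lower_central G n"
  proof
    have "set cs \<subseteq> lower_central G n"
      using cs(2) lower_central_Suc_subset[of n] by (auto intro: generate.incl)
    then show "generate G (set (ds @ cs)) \<subseteq> lower_central G n"
      using ds_sub by (intro generate_subgroup_incl N0.subgroup_axioms) auto
    have "set (ds @ cs) \<subseteq> carrier G"
      using central_series_subset[OF \<open>central_series G (ds @ cs)\<close>] .
    moreover have "generate G (set cs) \<subseteq> generate G (set (ds @ cs))"
      by (rule mono_generate) auto
    then have "basic_commutators G X n \<union> lower_central G (Suc n) \<subseteq> generate G (set (ds @ cs))"
      using ds unfolding cs(2) by (auto intro: generate.incl)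
    ultimately have "generate G (basic_commutators G X n \<union> lower_central G (Suc n)) \<subseteq> generate G
      (set (ds @ cs))"
      by (intro generate_subgroup_incl generate_is_subgroup)
    then show "lower_central G n \<subseteq> generate G (set (ds @ cs))"
      using lower_central_generated[OF X(2,3)] by blast
  qed
  moreover have "\<exists>a\<in>carrier G. \<exists>b\<in>carrier G. c = a \<otimes> b \<otimes> inv a \<otimes> inv b"
    if n: "n > 0" and c: "c \<in> set ds" for c
  proof -
    obtain m where "n = Suc m" using n gr0_conv_Suc by blast
    then obtain a b where "a \<in> basic_commutators G X m" "b \<in> X" "c = a \<otimes> b \<otimes> inv a \<otimes> inv b"
      using c ds by auto
    moreover have "basic_commutators G X m \<subseteq> carrier G"
      using basic_commutators_subset[OF X(2)] lower_central_normal normal_imp_subgroup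
        subgroup.subset by blast
    ultimately show ?thesis using X(2) by blast
  qed
  ultimately show ?case using cs(3) by (intro exI[of _ "ds @ cs"]) auto
qed

end


section \<open>Integer exponent vectors in an abelian group\<close>

definition exponent_prod :: "('a, 'b) monoid_scheme \<Rightarrow> ('s \<Rightarrow> 'a) \<Rightarrow> 's set \<Rightarrow> ('s \<Rightarrow> int) \<Rightarrow> 'a" where
  "exponent_prod A x S v = finprod A (\<lambda>s. x s [^]\<^bsub>A\<^esub> v s) S"

context comm_group
begin

lemma exponent_prod_closed:
  "x \<in> S \<rightarrow> carrier G \<Longrightarrow> exponent_prod G x S v \<in> carrier G"
  unfolding exponent_prod_def by (intro finprod_closed) auto

lemma exponent_prod_linear:
  assumes "finite S" "x \<in> S \<rightarrow> carrier G"
  shows "exponent_prod G x S (\<lambda>s. a * v s + b * w s) =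
    exponent_prod G x S v [^] a \<otimes> exponent_prod G x S w [^] b"
  using assms
proof (induction S)
  case empty
  then show ?case by (simp add: exponent_prod_def)
next
  case (insert t S)
  then have t: "x t \<in> carrier G" and S: "x \<in> S \<rightarrow> carrier G" by auto
  then have [simp]: "(\<lambda>s. x s [^] u s) \<in> S \<rightarrow> carrier G" for u :: "_ \<Rightarrow> int" by auto
  have ins: "exponent_prod G x (insert t S) u = x t [^] u t \<otimes> exponent_prod G x S u" for u
    using insert t by (simp add: exponent_prod_def)
  have "x t [^] (a * v t + b * w t) = (x t [^] v t) [^] a \<otimes> (x t [^] w t) [^] b"
    using t by (simp add: int_pow_mult int_pow_pow mult.commute)
  then show ?case unfolding ins insert.IH[OF S]
    using t exponent_prod_closed[OF S, of v] exponent_prod_closed[OF S, of w]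
    by (simp add: int_pow_distrib m_ac)
qed

lemma exponent_prod_add:
  assumes "finite S" "x \<in> S \<rightarrow> carrier G"
  shows "exponent_prod G x S (\<lambda>s. v s + w s) = exponent_prod G x S v \<otimes> exponent_prod G x S w"
  using exponent_prod_linear[OF assms, of 1 v 1 w] exponent_prod_closed[OF assms(2)] by simp

lemma exponent_prod_zero:
  assumes "x \<in> S \<rightarrow> carrier G"
  shows "exponent_prod G x S (\<lambda>s. 0) = \<one>"
  unfolding exponent_prod_def by simp

lemma exponent_prod_unit:
  assumes "finite S" "x \<in> S \<rightarrow> carrier G" "t \<in> S"
  shows "exponent_prod G x S (\<lambda>s. of_bool (t = s)) = x t"
proof -
  have "exponent_prod G x S (\<lambda>s. of_bool (t = s)) = (\<Otimes>s\<in>S. if t = s then x s else \<one>)"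
    unfolding exponent_prod_def using assms(2)
    by (intro finprod_cong) (auto simp: simp_implies_def Pi_iff)
  then show ?thesis using finprod_singleton[OF assms(3,1,2)] by simp
qed

lemma exponent_prod_in_submonoid:
  assumes "submonoid M G" "finite S" "x \<in> S \<rightarrow> M" "\<And>s. s \<in> S \<Longrightarrow> v s \<ge> 0"
  shows "exponent_prod G x S v \<in> M"
  using assms(2-4)
proof (induction S)
  case empty
  then show ?case using submonoid.one_closed[OF assms(1)] by (simp add: exponent_prod_def)
next
  case (insert t S)
  have M: "M \<subseteq> carrier G" using submonoid.subset[OF assms(1)] .
  have "x t [^] v t = x t [^] nat (v t)" using insert.prems by (simp flip: int_pow_int)
  moreover have "x t [^] nat (v t) \<in> M"
    using insert.prems by (intro submonoid_nat_pow[OF assms(1)]) auto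
  ultimately have "x t [^] v t \<in> M" by simp
  moreover have "exponent_prod G x (insert t S) v = x t [^] v t \<otimes> exponent_prod G x S v"
    unfolding exponent_prod_def using insert M by (subst finprod_insert) auto
  ultimately show ?case
    using insert submonoid.m_closed[OF assms(1)] by auto
qed

lemma exponent_prod_surj:
  assumes S: "finite S" "x \<in> S \<rightarrow> carrier G" and "g \<in> generate G (x ` S)"
  shows "\<exists>v. exponent_prod G x S v = g"
  using assms(3)
proof induction
  case one
  then show ?case using exponent_prod_zero[OF S(2)] by blast
next
  case (incl h)
  then show ?case using exponent_prod_unit[OF S] by blast
next
  case (inv h)
  then obtain s where s: "s \<in> S" "h = x s" by blast
  have "exponent_prod G x S (\<lambda>t. (- 1) * of_bool (s = t) + 0 * of_bool (s = t)) = inv h"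
    unfolding exponent_prod_linear[OF S] exponent_prod_unit[OF S s(1)] s(2)
    using S s by (auto simp: Pi_iff)
  then show ?case by blast
next
  case (eng g h)
  then show ?case using exponent_prod_add[OF S] by metis
qed

end

section \<open>The dichotomy for subsemigroups of nilpotent groups\<close>

context group
begin

lemma foldr_mult_closed: "set ss \<subseteq> carrier G \<Longrightarrow> foldr (\<otimes>) ss \<one> \<in> carrier G"
  by (induction ss) auto

lemma foldr_mult_append:
  "set ss \<subseteq> carrier G \<Longrightarrow> set ts \<subseteq> carrier G \<Longrightarrow>
     foldr (\<otimes>) (ss @ ts) \<one> = foldr (\<otimes>) ss \<one> \<otimes> foldr (\<otimes>) ts \<one>"
  by (induction ss) (auto simp: foldr_mult_closed m_assoc)

lemma insert_one_subsemigroup_generated: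
  "insert \<one> (subsemigroup_generated G S) = {foldr (\<otimes>) ss \<one> |ss. set ss \<subseteq> S}"
  unfolding subsemigroup_generated_def by (auto intro: exI[of _ "[]"])

lemma submonoid_subsemigroup_generated:
  assumes "S \<subseteq> carrier G"
  shows "submonoid (insert \<one> (subsemigroup_generated G S)) G"
  unfolding insert_one_subsemigroup_generated
proof
  show "{foldr (\<otimes>) ss \<one> |ss. set ss \<subseteq> S} \<subseteq> carrier G"
    using assms by (auto intro!: foldr_mult_closed)
  show "\<one> \<in> {foldr (\<otimes>) ss \<one> |ss. set ss \<subseteq> S}"
    by (auto intro: exI[of _ "[]"])
  fix x y assume "x \<in> {foldr (\<otimes>) ss \<one> |ss. set ss \<subseteq> S}" "y \<in> {foldr (\<otimes>) ss \<one> |ss. set ss \<subseteq> S}"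
  then obtain ss ts where "x = foldr (\<otimes>) ss \<one>" "set ss \<subseteq> S" "y = foldr (\<otimes>) ts \<one>" "set ts \<subseteq> S"
    by blast
  then show "x \<otimes> y \<in> {foldr (\<otimes>) ss \<one> |ss. set ss \<subseteq> S}"
    using assms foldr_mult_append[of ss ts] by (intro CollectI exI[of _ "ss @ ts"]) auto
qed

lemma derived_eq_lower_central: "derived G (carrier G) = lower_central G (Suc 0)"
  by (simp add: derived_def commutator_subgroup_def)

lemma group_hom_abelianization:
  "group_hom G (G Mod derived G (carrier G)) (\<lambda>g. derived G (carrier G) #> g)"
proof -
  interpret D: normal "derived G (carrier G)" G by (rule derived_self_is_normal)
  show ?thesis
    unfolding group_hom_def group_hom_axioms_def
    using D.r_coset_hom_Mod D.factorgroup_is_group is_group by blast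
qed

theorem generating_subsemigroup_dichotomy:
  assumes nil: "lower_central G n = {\<one>}"
    and S: "finite S" "S \<subseteq> carrier G" "generate G S = carrier G" "S \<noteq> {}"
  shows "subsemigroup_generated G S = carrier G \<or>
    (\<exists>f\<in>hom G integer_group. (\<forall>s\<in>S. f s \<ge> 0) \<and> (\<exists>s\<in>S. f s > 0))"
proof -
  define D where "D = derived G (carrier G)"
  define p where "p g = D #> g" for g
  define A where "A = G Mod D"
  interpret D: normal D G unfolding D_def by (rule derived_self_is_normal)
  interpret A: comm_group A unfolding A_def D_def by (rule derived_quot_is_comm_group)
  interpret p: group_hom G A p
    unfolding p_def[abs_def] A_def D_def by (rule group_hom_abelianization)
  have pS: "p \<in> S \<rightarrow> carrier A" using S(2) by auto
  have carrier_A: "carrier A = p ` carrier G"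
    by (auto simp: A_def p_def FactGroup_def RCOSETS_def)
  have gen_A: "carrier A = generate A (p ` S)"
    using p.generate_img[OF S(2)] by (simp add: carrier_A S(3))
  define \<phi> where "\<phi> = exponent_prod A p S"
  define L where "L = {v. \<phi> v = \<one>\<^bsub>A\<^esub>}"
  have "(\<lambda>s. a * v s + b * w s) \<in> L" if "v \<in> L" "w \<in> L" for v w a b
    using that A.exponent_prod_linear[OF S(1) pS] by (simp add: L_def \<phi>_def)
  moreover have "L \<noteq> {}"
    using A.exponent_prod_zero[OF pS] by (auto simp: L_def \<phi>_def)
  ultimately consider
    v where "v \<in> L" "\<forall>s\<in>S. v s > 0"
  | r where "\<forall>s\<in>S. r s \<ge> 0" "\<exists>s\<in>S. r s > 0" "\<forall>v\<in>L. (\<Sum>s\<in>S. r s * v s) = 0"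
    using integer_stiemke[OF S(1), of L] by blast
  then show ?thesis
  proof cases
    case v: 1
    define M where "M = insert \<one> (subsemigroup_generated G S)"
    have M: "submonoid M G"
      unfolding M_def by (rule submonoid_subsemigroup_generated[OF S(2)])
    have SM: "s \<in> M" if "s \<in> S" for s
      using that S(2) unfolding M_def insert_one_subsemigroup_generated
      by (intro CollectI exI[of _ "[s]"]) auto
    have M_eq: "M = {foldr (\<otimes>) ss \<one> |ss. set ss \<subseteq> S}"
      unfolding M_def by (rule insert_one_subsemigroup_generated)
    have pM: "submonoid (p ` M) A" by (rule p.submonoid_image[OF M])
    have inv: "inv\<^bsub>A\<^esub> p s \<in> p ` M" if s: "s \<in> S" for s
    proof -
      \<comment> \<open>A relation with all exponents positive can spare one factor
        \<open>p s\<close>; what remains is a product with nonnegative exponents and equals the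
        inverse of \<open>p s\<close>.\<close>
      have "\<phi> (\<lambda>t. 1 * v t + (- 1) * of_bool (s = t)) = inv\<^bsub>A\<^esub> p s"
        unfolding \<phi>_def A.exponent_prod_linear[OF S(1) pS] A.exponent_prod_unit[OF S(1) pS s]
        using v(1) s S(2) by (subst A.int_pow_minus_one) (auto simp: L_def \<phi>_def)
      moreover have "\<phi> (\<lambda>t. 1 * v t + (- 1) * of_bool (s = t)) \<in> p ` M"
        unfolding \<phi>_def
      proof (rule A.exponent_prod_in_submonoid[OF pM S(1)])
        show "0 \<le> 1 * v t + (- 1) * of_bool (s = t)" if "t \<in> S" for t
          using v(2) that by (auto simp: of_bool_def int_one_le_iff_zero_less)
      qed (use SM in auto)
      ultimately show ?thesis by simp
    qed
    have cover: "\<exists>h\<in>D. g \<otimes> h \<in> M" if g: "g \<in> carrier G" for g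
    proof -
      have "x \<in> p ` M" if "x \<in> generate A (p ` S)" for x
        using that
      proof induction
        case (eng x y)
        then show ?case by (intro submonoid.m_closed[OF pM])
      qed (use SM inv submonoid.one_closed[OF pM] in auto)
      then have "p g \<in> p ` M" using g by (simp flip: gen_A)
      then obtain m where m: "m \<in> M" "D #> g = D #> m" by (auto simp: p_def)
      then have m': "m \<in> carrier G" using submonoid.subset[OF M] by blast
      have "m \<in> D #> g" unfolding m(2) by (rule rcos_self[OF m' D.subgroup_axioms])
      then obtain d where d: "d \<in> D" "m = d \<otimes> g" by (auto simp: r_coset_def)
      then have "inv g \<otimes> d \<otimes> g \<in> D" "g \<otimes> (inv g \<otimes> d \<otimes> g) = m"
        using g D.inv_op_closed1 by (auto simp: m_assoc)
      with m(1) show ?thesis by metis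
    qed
    \<comment> \<open>The derived subgroup is the term of index 1, so the trivial term is written
      with index \<open>1 + n\<close> to start the series there.\<close>
    have "lower_central G (Suc 0 + n) = {\<one>}"
      using nil lower_central_Suc_subset[of n] subgroup.one_closed[OF normal_imp_subgroup[OF
        lower_central_normal[of "Suc n"]]]
      by auto
    from nilpotent_central_series[OF S(1-3) this] obtain cs
      where cs: "central_series G cs" "generate G (set cs) = D"
      "\<forall>c\<in>set cs. \<exists>a\<in>carrier G. \<exists>b\<in>carrier G. c = a \<otimes> b \<otimes> inv a \<otimes> inv b"
      by (auto simp: D_def derived_eq_lower_central)
    have "carrier G \<subseteq> M"
      by (rule saturation[OF cs(1,3) M]) (use cover in \<open>simp add: cs(2)\<close>)
    \<comment> \<open>The identity was adjoined to obtain \<open>M\<close>. It lies in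
      \<open>S\<^sup>+\<close> itself as the product of some \<open>s\<close> and its inverse, the
      latter being a product of elements of \<open>S\<close>.\<close>
    moreover have "\<one> \<in> subsemigroup_generated G S"
    proof -
      obtain s where s: "s \<in> S" using S(4) by blast
      then have "inv s \<in> M" using \<open>carrier G \<subseteq> M\<close> S(2) by auto
      then obtain ss where "set ss \<subseteq> S" "inv s = foldr (\<otimes>) ss \<one>" unfolding M_eq by blast
      moreover from this have "foldr (\<otimes>) (s # ss) \<one> = \<one>" using s S(2) by (auto simp flip: \<open>inv s
        = _\<close>)
      ultimately show ?thesis
        unfolding subsemigroup_generated_def using s by (intro CollectI exI[of _ "s # ss"]) auto
    qed
    ultimately show ?thesis
      using submonoid.subset[OF M] by (auto simp: M_def)
  next
    case r: 2
    have "\<exists>v. \<phi> v = p g" if "g \<in> carrier G" for g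
      using A.exponent_prod_surj[OF S(1) pS, of "p g"] that by (simp add: \<phi>_def flip: gen_A)
    \<comment> \<open>\<open>V g\<close> is any exponent vector of \<open>p g\<close>. Two such
      vectors differ by a relation, and \<open>r\<close> is orthogonal to relations, so
      \<open>f\<close> does not depend on the choice.\<close>
    then obtain V where V: "\<And>g. g \<in> carrier G \<Longrightarrow> \<phi> (V g) = p g" by metis
    define f where "f g = (\<Sum>s\<in>S. r s * V g s)" for g
    have f: "f g = (\<Sum>s\<in>S. r s * v s)" if "\<phi> v = p g" "g \<in> carrier G" for g v
    proof -
      have "(\<lambda>s. 1 * V g s + (- 1) * v s) \<in> L"
        unfolding L_def mem_Collect_eq \<phi>_def A.exponent_prod_linear[OF S(1) pS]
        using that V[OF that(2)] by (simp add: \<phi>_def)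
          from r(3)[THEN bspec, OF this] show ?thesis
            by (simp add: f_def algebra_simps sum_subtractf)
    qed
    have "f \<in> hom G integer_group"
    proof (rule homI)
      fix g h assume gh: "g \<in> carrier G" "h \<in> carrier G"
      have "\<phi> (\<lambda>s. V g s + V h s) = p (g \<otimes> h)"
        using A.exponent_prod_add[OF S(1) pS] V gh by (simp add: \<phi>_def)
      from f[OF this] gh show "f (g \<otimes> h) = f g \<otimes>\<^bsub>integer_group\<^esub> f h"
        by (simp add: f_def algebra_simps sum.distrib)
    qed simp
    moreover have "f s = r s" if s: "s \<in> S" for s
    proof -
      have "f s = (\<Sum>t\<in>S. r t * of_bool (s = t))"
        using A.exponent_prod_unit[OF S(1) pS s] S(2) s by (intro f) (auto simp: \<phi>_def)
      also have "\<dots> = (\<Sum>t\<in>S. if s = t then r t else 0)" by (intro sum.cong) auto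
      finally show ?thesis using S(1) s by simp
    qed
    ultimately show ?thesis using r(1,2) by (intro disjI2 bexI[of _ f]) auto
  qed
qed

lemma lower_central_subgroup:
  assumes H: "subgroup H G"
  shows "lower_central (G\<lparr>carrier := H\<rparr>) n \<subseteq> lower_central G n"
proof (induction n)
  case 0
  then show ?case using subgroup.subset[OF H] by simp
next
  case (Suc n)
  interpret H: group "G\<lparr>carrier := H\<rparr>" by (rule subgroup_imp_group[OF H])
  have sub: "lower_central (G\<lparr>carrier := H\<rparr>) n \<subseteq> H"
    using H.lower_central_normal[of n] normal_imp_subgroup subgroup.subset by fastforce
  have "(\<Union>h\<in>lower_central (G\<lparr>carrier := H\<rparr>) n. \<Union>k\<in>H.
      {h \<otimes> k \<otimes> inv\<^bsub>G\<lparr>carrier := H\<rparr>\<^esub> h \<otimes> inv\<^bsub>G\<lparr>carrier := H\<rparr>\<^esub> k})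
    = (\<Union>h\<in>lower_central (G\<lparr>carrier := H\<rparr>) n. \<Union>k\<in>H. {h \<otimes> k \<otimes> inv h \<otimes> inv k})"
    using sub m_inv_consistent[OF H] by (intro SUP_cong refl) auto
  moreover have "(\<Union>h\<in>lower_central (G\<lparr>carrier := H\<rparr>) n. \<Union>k\<in>H. {h \<otimes> k \<otimes> inv h \<otimes> inv k}) \<subseteq> H"
    using sub subgroup.m_closed[OF H] subgroup.m_inv_closed[OF H] by auto
  ultimately have "lower_central (G\<lparr>carrier := H\<rparr>) (Suc n)
      = generate G (\<Union>h\<in>lower_central (G\<lparr>carrier := H\<rparr>) n. \<Union>k\<in>H. {h \<otimes> k \<otimes> inv h \<otimes> inv k})"
    using generate_consistent[OF _ H] by (simp add: commutator_subgroup_def)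
  also have "\<dots> \<subseteq> lower_central G (Suc n)"
    unfolding lower_central.simps commutator_subgroup_def
    using Suc subgroup.subset[OF H] by (intro mono_generate) blast
  finally show ?case .
qed

text \<open>The homomorphism lives on the group generated by \<open>S\<close>: it need not extend to
  \<open>G\<close>, as \<open>S\<close> may lie in the derived subgroup.\<close>

corollary subsemigroup_dichotomy:
  assumes nil: "lower_central G n = {\<one>}" and S: "finite S" "S \<subseteq> carrier G" "S \<noteq> {}"
  shows "subgroup (subsemigroup_generated G S) G \<or>
    (\<exists>f\<in>hom (G\<lparr>carrier := generate G S\<rparr>) integer_group. (\<forall>s\<in>S. f s \<ge> 0) \<and> (\<exists>s\<in>S. f s > 0))"
proof -
  define H where "H = generate G S"
  have H: "subgroup H G" unfolding H_def by (rule generate_is_subgroup[OF S(2)])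
  interpret H: group "G\<lparr>carrier := H\<rparr>" by (rule subgroup_imp_group[OF H])
  have SH: "S \<subseteq> H" by (auto simp: H_def intro: generate.incl)
  have "lower_central (G\<lparr>carrier := H\<rparr>) n = {\<one>}"
    using lower_central_subgroup[OF H, of n] nil
      subgroup.one_closed[OF normal_imp_subgroup[OF H.lower_central_normal[of n]]] by auto
  moreover have "generate (G\<lparr>carrier := H\<rparr>) S = H"
    using generate_consistent[OF SH H] by (simp add: H_def)
  moreover have "subsemigroup_generated (G\<lparr>carrier := H\<rparr>) S = subsemigroup_generated G S"
    by (simp add: subsemigroup_generated_def)
  ultimately have "subsemigroup_generated G S = H \<or>
    (\<exists>f\<in>hom (G\<lparr>carrier := H\<rparr>) integer_group. (\<forall>s\<in>S. f s \<ge> 0) \<and> (\<exists>s\<in>S. f s > 0))"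
    using H.generating_subsemigroup_dichotomy[of n S] S(1,3) SH by simp
  then show ?thesis using H by (auto simp: H_def)
qed

end

section \<open>Algorithms for groups with a central series\<close>

text \<open>The generator is 0 for the trivial subgroup, so divisibility by it covers elements of
  infinite order as well.\<close>

lemma int_subgroup_principal:
  fixes H :: "int set"
  assumes zero: "0 \<in> H" and minus: "\<And>x y. x \<in> H \<Longrightarrow> y \<in> H \<Longrightarrow> x - y \<in> H"
  shows "\<exists>q::nat. \<forall>k. k \<in> H \<longleftrightarrow> int q dvd k"
proof -
  have uminus: "- x \<in> H" if "x \<in> H" for x
    using minus[OF zero that] by simp
  have mult: "x * k \<in> H" if "x \<in> H" for x k
  proof (induction k rule: int_induct[where k = 0])
    case base
    then show ?case by (simp add: zero)
  next
    case (step1 k)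
    then show ?case using minus[OF step1(2) uminus[OF that]] by (simp add: algebra_simps)
  next
    case (step2 k)
    then show ?case using minus[OF step2(2) that] by (simp add: algebra_simps)
  qed
  show ?thesis
  proof (cases "H = {0}")
    case True
    then show ?thesis by (intro exI[of _ 0]) simp
  next
    case False
    then obtain x where "x \<in> H" "x \<noteq> 0" using zero by blast
    then have "int (nat \<bar>x\<bar>) \<in> H" "nat \<bar>x\<bar> > 0" using uminus by (auto simp: abs_if)
    then have ex: "\<exists>n::nat. n > 0 \<and> int n \<in> H" by blast
    define q where "q = (LEAST n::nat. n > 0 \<and> int n \<in> H)"
    have q: "q > 0" "int q \<in> H" using LeastI_ex[OF ex] by (simp_all add: q_def)
    have "int q dvd k" if "k \<in> H" for k
    proof (rule ccontr)
      assume "\<not> int q dvd k"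
      then have "k mod int q > 0" using q(1) pos_mod_sign[of "int q" k]
        by (metis dvd_eq_mod_eq_0 of_nat_0_less_iff order_le_less)
      moreover have "k mod int q = k - int q * (k div int q)" by (simp add: minus_mult_div_eq_mod)
      then have "k mod int q \<in> H" using minus[OF that mult[OF q(2)]] by simp
      ultimately have "nat (k mod int q) > 0 \<and> int (nat (k mod int q)) \<in> H" by simp
      then have "q \<le> nat (k mod int q)" unfolding q_def by (rule Least_le)
      then show False using q(1) \<open>k mod int q > 0\<close> pos_mod_bound[of "int q" k] by linarith
    qed
    then show ?thesis using mult[OF q(2)] by (intro exI[of _ q]) (auto simp: dvd_def)
  qed
qed

section \<open>String rewriting\<close>

definition rewrite_step :: "('x list \<times> 'x list) set \<Rightarrow> ('x list \<times> 'x list) set" where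
  "rewrite_step R = {(p @ l @ s, p @ r @ s) |p l r s. (l, r) \<in> R}"

lemma rewrite_stepI: "(l, r) \<in> R \<Longrightarrow> (p @ l @ s, p @ r @ s) \<in> rewrite_step R"
  unfolding rewrite_step_def by blast

lemma rewrite_context:
  assumes "(u, v) \<in> (rewrite_step R)\<^sup>*"
  shows "(p @ u @ s, p @ v @ s) \<in> (rewrite_step R)\<^sup>*"
  using assms
proof induction
  case (step v w)
  then obtain p' l r s' where "v = p' @ l @ s'" "w = p' @ r @ s'" "(l, r) \<in> R"
    unfolding rewrite_step_def by blast
  then have "(p @ v @ s, p @ w @ s) \<in> rewrite_step R"
    unfolding rewrite_step_def
    by (intro CollectI exI[of _ "p @ p'"] exI[of _ l] exI[of _ r] exI[of _ "s' @ s"]) simp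
  with step.IH show ?case by (rule rtrancl_into_rtrancl)
qed simp

lemma rewrite_rule: "(l, r) \<in> R \<Longrightarrow> (l, r) \<in> (rewrite_step R)\<^sup>*"
  unfolding rewrite_step_def by (intro r_into_rtrancl CollectI exI[of _
    "[]"] exI[of _ l] exI[of _ r]) simp

lemma rewrite_mono: "R \<subseteq> R' \<Longrightarrow> (u, v) \<in> (rewrite_step R)\<^sup>* \<Longrightarrow> (u, v) \<in> (rewrite_step R')\<^sup>*"
  by (rule rtrancl_mono[THEN subsetD, rotated]) (auto simp: rewrite_step_def)

lemma rewrite_append:
  assumes "(u, u') \<in> (rewrite_step R)\<^sup>*" "(v, v') \<in> (rewrite_step R)\<^sup>*"
  shows "(u @ v, u' @ v') \<in> (rewrite_step R)\<^sup>*"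
  using rewrite_context[OF assms(1), of "[]" v] rewrite_context[OF assms(2), of u' "[]"] by simp

text \<open>A triple names a rule and the context for its use, and a triple that does not fit leaves
  the word unchanged. Thus every list of triples describes a valid derivation, and a search through
  lists needs no check of validity.\<close>

definition apply_rule ::
  "('x list \<times> 'x list) list \<Rightarrow> 'x list \<Rightarrow> 'x list \<times> ('x list \<times> 'x list) \<times> 'x list \<Rightarrow> 'x list" where
  "apply_rule R w c = (if w = fst c @ fst (fst (snd c)) @ snd (snd c) \<and> fst (snd c) \<in> set R
     then fst c @ snd (fst (snd c)) @ snd (snd c) else w)"

lemma rewrite_iff_foldl:
  "(u, v) \<in> (rewrite_step (set R))\<^sup>* \<longleftrightarrow> (\<exists>cs. foldl (apply_rule R) u cs = v)"
proof
  assume "(u, v) \<in> (rewrite_step (set R))\<^sup>*"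
  then show "\<exists>cs. foldl (apply_rule R) u cs = v"
  proof induction
    case base
    show ?case by (intro exI[of _ "[]"]) simp
  next
    case (step v w)
    then obtain cs where "foldl (apply_rule R) u cs = v" by blast
    moreover obtain p l r s where "v = p @ l @ s" "w = p @ r @ s" "(l, r) \<in> set R"
      using step.hyps unfolding rewrite_step_def by blast
    ultimately have "foldl (apply_rule R) u (cs @ [(p, (l, r), s)]) = w"
      by (simp add: apply_rule_def)
    then show ?case ..
  qed
next
  have "(u, foldl (apply_rule R) u cs) \<in> (rewrite_step (set R))\<^sup>*" for cs
  proof (induction cs arbitrary: u)
    case (Cons c cs)
    have "(u, apply_rule R u c) \<in> (rewrite_step (set R))\<^sup>*"
      unfolding apply_rule_def by (cases c) (auto intro!: r_into_rtrancl rewrite_stepI)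
    with Cons[of "apply_rule R u c"] show ?case by simp
  qed simp
  then show "\<exists>cs. foldl (apply_rule R) u cs = v \<Longrightarrow> (u, v) \<in> (rewrite_step (set R))\<^sup>*"
    by blast
qed

lemma re_rewrite:
  fixes R :: "('x::codable list \<times> 'x list) list"
  assumes "computable f" "computable g"
  shows "re (\<lambda>x. (f x, g x) \<in> (rewrite_step (set R))\<^sup>*)"
proof -
  have "re (\<lambda>x. \<exists>cs. foldl (apply_rule R) (f x) cs = g x)"
    unfolding apply_rule_def
    by (intro re_intros re_dec computable_intros computable_compose[OF assms(1)]
        computable_compose[OF assms(2)])
  then show ?thesis by (simp only: rewrite_iff_foldl)
qed

section \<open>Words over a central series and their word problem\<close>

text \<open>The letter \<open>2 * i\<close> stands for the \<open>i\<close>-th generator and \<open>2 * i + 1\<close> for its inverse.\<close>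

definition inverse_letter :: "nat \<Rightarrow> nat" where
  "inverse_letter l = (if even l then l + 1 else l - 1)"

definition inverse_word :: "nat list \<Rightarrow> nat list" where
  "inverse_word w = rev (map inverse_letter w)"

lemma inverse_letter_inverse [simp]: "inverse_letter (inverse_letter l) = l"
  by (auto simp: inverse_letter_def)

lemma inverse_word_inverse [simp]: "inverse_word (inverse_word w) = w"
  by (simp add: inverse_word_def rev_map o_def)

lemma inverse_letter_less: "inverse_letter l < 2 * n \<longleftrightarrow> l < 2 * n"
  by (auto simp: inverse_letter_def elim!: evenE oddE)

lemma set_inverse_word: "set (inverse_word w) \<subseteq> {..<2 * n} \<longleftrightarrow> set w \<subseteq> {..<2 * n}"
  by (auto simp: inverse_word_def inverse_letter_less)

lemma dec_even [computable_intros]: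
  fixes f :: "'a::codable \<Rightarrow> nat"
  assumes "computable f"
  shows "dec (\<lambda>x. even (f x))"
proof -
  have "((\<lambda>b. 1 - b) ^^ n) (1::nat) = of_bool (even n)" for n
    by (induction n) auto
  moreover have "computable (\<lambda>x. ((\<lambda>b. 1 - b) ^^ f x) (1::nat))"
    by (intro computable_intros assms)
  ultimately show ?thesis by (simp add: dec_def)
qed

lemma computable_inverse_word [computable_intros]:
  "computable f \<Longrightarrow> computable (\<lambda>x. inverse_word (f x))"
  unfolding inverse_word_def inverse_letter_def by (intro computable_intros)

text \<open>For \<open>v\<close> over the lower generators, a word for an element of the coset of
  the \<open>e\<close>-th power of the \<open>i\<close>-th generator.\<close>

definition coset_word :: "nat \<Rightarrow> nat \<Rightarrow> nat list \<Rightarrow> nat list" where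
  "coset_word i e v = replicate e (2 * i) @ v"

lemma computable_coset_word [computable_intros]:
  "computable f \<Longrightarrow> computable g \<Longrightarrow> computable (\<lambda>x. coset_word i (f x) (g x))"
  unfolding coset_word_def by (intro computable_intros)

text \<open>The generators are numbered from the bottom: \<open>a 0\<close> is central, and the
  first \<open>i\<close> of them generate the \<open>i\<close>-th term of an ascending series. This
  reverses the order of the lists in \<open>central_series\<close>.\<close>

locale central_series_group = group +
  fixes a :: "nat \<Rightarrow> 'a" and m :: nat
  assumes a_closed [simp]: "i < m \<Longrightarrow> a i \<in> carrier G"
    and central: "i < m \<Longrightarrow> g \<in> carrier G \<Longrightarrow> a i \<otimes> g \<otimes> inv (a i) \<otimes> inv g \<in> generate G (a ` {..<i})"
    and generated: "generate G (a ` {..<m}) = carrier G"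
begin

definition letter :: "nat \<Rightarrow> 'a" where
  "letter l = (if even l then a (l div 2) else inv (a (l div 2)))"

definition val :: "nat list \<Rightarrow> 'a" where
  "val w = foldr (\<otimes>) (map letter w) \<one>"

definition N :: "nat \<Rightarrow> 'a set" where
  "N i = generate G (a ` {..<i})"

lemma letter_closed [simp]: "l < 2 * m \<Longrightarrow> letter l \<in> carrier G"
  by (simp add: letter_def less_mult_imp_div_less mult.commute)

lemma val_simps [simp]: "val [] = \<one>" "val (l # w) = letter l \<otimes> val w"
  by (simp_all add: val_def)

lemma val_closed [simp]: "set w \<subseteq> {..<2 * m} \<Longrightarrow> val w \<in> carrier G"
  by (induction w) auto

lemma val_append [simp]:
  "set v \<subseteq> {..<2 * m} \<Longrightarrow> set w \<subseteq> {..<2 * m} \<Longrightarrow> val (v @ w) = val v \<otimes> val w"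
  by (induction v) (auto simp: m_assoc)

lemma letter_inverse: "l < 2 * m \<Longrightarrow> letter (inverse_letter l) = inv (letter l)"
  by (auto simp: letter_def inverse_letter_def less_mult_imp_div_less mult.commute elim!: oddE)

lemma val_inverse [simp]: "set w \<subseteq> {..<2 * m} \<Longrightarrow> val (inverse_word w) = inv (val w)"
proof (induction w)
  case Nil
  then show ?case by (simp add: inverse_word_def)
next
  case (Cons l w)
  then have "set (inverse_word w) \<subseteq> {..<2 * m}" "inverse_letter l < 2 * m"
    by (auto simp: set_inverse_word inverse_letter_less)
  moreover have "inverse_word (l # w) = inverse_word w @ [inverse_letter l]"
    by (simp add: inverse_word_def)
  ultimately show ?case using Cons by (simp add: letter_inverse inv_mult_group)
qed

lemma N_gens: "i \<le> m \<Longrightarrow> a ` {..<i} \<subseteq> carrier G"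
  by auto

lemma subgroup_N: "i \<le> m \<Longrightarrow> subgroup (N i) G"
  unfolding N_def by (intro generate_is_subgroup N_gens)

lemma N_mono: "i \<le> j \<Longrightarrow> N i \<subseteq> N j"
  unfolding N_def by (intro mono_generate) auto

lemma N_normal: "i \<le> m \<Longrightarrow> N i \<lhd> G"
proof (rule normal_invI[OF subgroup_N])
  fix h g assume i: "i \<le> m" and "h \<in> N i" and g: "g \<in> carrier G"
  show "g \<otimes> h \<otimes> inv g \<in> N i"
  proof (rule generate_conj[OF N_gens[OF i] subgroup_N[OF i] g])
    show "h \<in> generate G (a ` {..<i})" using \<open>h \<in> N i\<close> by (simp add: N_def)
    fix x assume "x \<in> a ` {..<i}"
    then obtain j where j: "j < i" "x = a j" by blast
    have "a j \<otimes> g \<otimes> inv (a j) \<otimes> inv g \<in> N i"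
      using central[of j g] N_mono[of j i] i j g by (auto simp: N_def)
    then have "inv (a j \<otimes> g \<otimes> inv (a j) \<otimes> inv g) \<otimes> a j \<in> N i"
      using j i subgroup.m_inv_closed[OF subgroup_N] subgroup.m_closed[OF subgroup_N]
      by (simp add: N_def generate.incl)
    then show "g \<otimes> x \<otimes> inv g \<in> N i"
      using j i g by (simp add: inv_mult_group m_assoc)
  qed
qed

lemma val_in_N: "i \<le> m \<Longrightarrow> set w \<subseteq> {..<2 * i} \<Longrightarrow> val w \<in> N i"
proof (induction w)
  case Nil
  then show ?case using subgroup.one_closed[OF subgroup_N] by simp
next
  case (Cons l w)
  then have "a (l div 2) \<in> N i"
    by (auto simp: N_def less_mult_imp_div_less mult.commute intro!: generate.incl)
  then have "letter l \<in> N i"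
    using Cons.prems subgroup.m_inv_closed[OF subgroup_N] by (simp add: letter_def)
  with Cons show ?case using subgroup.m_closed[OF subgroup_N] by simp
qed

lemma N_val:
  assumes "i \<le> m" "h \<in> N i"
  obtains w where "set w \<subseteq> {..<2 * i}" "val w = h"
proof -
  have "\<exists>w. set w \<subseteq> {..<2 * i} \<and> val w = h"
    using assms(2) unfolding N_def
  proof induction
    case one
    then show ?case by (intro exI[of _ "[]"]) simp
  next
    case (incl h)
    then obtain j where "j < i" "h = a j" by blast
    then show ?case using assms(1) by (intro exI[of _ "[2 * j]"]) (simp add: letter_def)
  next
    case (inv h)
    then obtain j where "j < i" "h = a j" by blast
    then show ?case using assms(1) by (intro exI[of _ "[2 * j + 1]"]) (simp add: letter_def)
  next
    case (eng g h)
    then obtain v w where vw: "set v \<subseteq> {..<2 * i}" "val v = g" "set w \<subseteq> {..<2 * i}" "val w = h"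
      by blast
    moreover have "{..<2 * i} \<subseteq> {..<2 * m}" using assms(1) by auto
    ultimately show ?case by (intro exI[of _ "v @ w"]) (auto intro!: val_append)
  qed
  with that show thesis by blast
qed

lemma N_conj:
  assumes "i \<le> m" "h \<in> N i" "g \<in> carrier G"
  shows "inv g \<otimes> h \<otimes> g \<in> N i" "g \<otimes> h \<otimes> inv g \<in> N i"
proof -
  interpret normal "N i" G using assms(1) by (rule N_normal)
  show "inv g \<otimes> h \<otimes> g \<in> N i" "g \<otimes> h \<otimes> inv g \<in> N i"
    using inv_op_closed1 inv_op_closed2 assms by simp_all
qed

lemma N_Suc:
  assumes "i < m"
  shows "N (Suc i) = {a i [^] k \<otimes> h |(k::int) h. h \<in> N i}"
proof -
  have "a ` {..<Suc i} = insert (a i) (a ` {..<i})" by (auto simp: lessThan_Suc)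
  then show ?thesis
    using generate_insert_eq[of "a i" "a ` {..<i}" "N i"] N_gens[of i] N_conj[of i _ "a i"] assms
    by (simp add: N_def)
qed

text \<open>\<open>x\<close> and \<open>x \<otimes> h\<close> agree modulo \<open>K\<close>, hence
  so do their powers; the elementwise form spares the quotient group.\<close>

lemma pow_mult_normal:
  fixes k :: int
  assumes K: "K \<lhd> G" and x: "x \<in> carrier G" and h: "h \<in> K"
  shows "inv (x [^] k) \<otimes> (x \<otimes> h) [^] k \<in> K"
proof -
  interpret K: normal K G by (rule K)
  have h': "h \<in> carrier G" using h by simp
  have cancel: "(x \<otimes> h) [^] (j - 1) = (x \<otimes> h) [^] j \<otimes> (inv h \<otimes> inv x)" for j :: int
    using x h' int_pow_mult[of "x \<otimes> h" j "- 1"] by (simp add: inv_mult_group)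
  show ?thesis
  proof (induction k rule: int_induct[where k = 0])
    case base
    then show ?case by simp
  next
    case (step1 k)
    have "(inv x \<otimes> (inv (x [^] k) \<otimes> (x \<otimes> h) [^] k) \<otimes> x) \<otimes> h \<in> K"
      using step1(2) x h K.inv_op_closed1 by simp
    then show ?case using x h' by (simp add: int_pow_mult inv_mult_group m_assoc)
  next
    case (step2 k)
    have "x [^] (k - 1) = x [^] k \<otimes> inv x"
      using x int_pow_mult[of x k "- 1"] by simp
    moreover have "x \<otimes> ((inv (x [^] k) \<otimes> (x \<otimes> h) [^] k) \<otimes> inv h) \<otimes> inv x \<in> K"
      using step2(2) x h K.inv_op_closed2 by simp
    ultimately show ?case using x h' by (simp add: cancel inv_mult_group m_assoc)
  qed
qed

text \<open>The order of \<open>a i\<close> modulo \<open>N i\<close>, with 0 for infinite order. It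
  is chosen, and enters programs as a constant.\<close>

definition period :: "nat \<Rightarrow> nat" where
  "period i = (SOME q. \<forall>k::int. a i [^] k \<in> N i \<longleftrightarrow> int q dvd k)"

lemma period:
  assumes "i < m"
  shows "a i [^] (k::int) \<in> N i \<longleftrightarrow> int (period i) dvd k"
proof -
  interpret N: subgroup "N i" G using assms by (intro subgroup_N) simp
  have diff: "a i [^] (k - l) = a i [^] k \<otimes> inv (a i [^] l)" for k l :: int
    using assms int_pow_mult[of "a i" k "- l"] by (simp add: int_pow_neg)
  have "\<exists>q. \<forall>k::int. k \<in> {k. a i [^] k \<in> N i} \<longleftrightarrow> int q dvd k"
  proof (rule int_subgroup_principal)
    show "k - l \<in> {k. a i [^] k \<in> N i}"
      if "k \<in> {k. a i [^] k \<in> N i}" "l \<in> {k. a i [^] k \<in> N i}" for k l :: int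
      using that by (simp add: diff)
  qed simp
  then have "\<exists>q. \<forall>k::int. a i [^] k \<in> N i \<longleftrightarrow> int q dvd k" unfolding mem_Collect_eq .
  from someI_ex[OF this] show ?thesis unfolding period_def ..
qed

definition power_word :: "nat \<Rightarrow> int \<Rightarrow> nat list" where
  "power_word i k = (if k \<ge> 0 then replicate (nat k) (2 * i) else replicate (nat (- k)) (2 * i +
    1))"

lemma set_power_word: "i < n \<Longrightarrow> set (power_word i k) \<subseteq> {..<2 * n}"
  by (auto simp: power_word_def)

lemma val_power_word: "i < m \<Longrightarrow> val (power_word i k) = a i [^] k"
proof -
  assume i: "i < m"
  have pos: "val (replicate n (2 * i)) = a i [^] n" for n
    using i by (induction n) (simp_all add: letter_def del: nat_pow_Suc flip: nat_pow_Suc2)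
  have neg: "val (replicate n (2 * i + 1)) = inv (a i) [^] n" for n
    using i by (induction n) (simp_all add: letter_def del: nat_pow_Suc flip: nat_pow_Suc2)
  show ?thesis
  proof (cases "k \<ge> 0")
    case True
    then have "a i [^] k = a i [^] nat k" by (simp flip: int_pow_int)
    then show ?thesis using True pos by (simp add: power_word_def)
  next
    case False
    have "a i [^] k = a i [^] (- int (nat (- k)))" using False by simp
    also have "\<dots> = inv (a i) [^] nat (- k)"
      using i by (simp only: int_pow_neg a_closed int_pow_int nat_pow_inv)
    finally show ?thesis using False neg by (simp add: power_word_def)
  qed
qed

lemma rewrite_preserves_val:
  assumes sound: "\<And>l r. (l, r) \<in> R \<Longrightarrow>
      set l \<subseteq> {..<2 * m} \<and> set r \<subseteq> {..<2 * m} \<and> val l = val r"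
    and "(u, v) \<in> (rewrite_step R)\<^sup>*" "set u \<subseteq> {..<2 * m}"
  shows "val u = val v \<and> set v \<subseteq> {..<2 * m}"
  using assms(2,3)
proof (induction rule: rtrancl_induct)
  case (step v w)
  then obtain p l r s where "v = p @ l @ s" "w = p @ r @ s" "(l, r) \<in> R"
    unfolding rewrite_step_def by blast
  with step sound[of l r] show ?case by auto
qed simp

text \<open>
  The rules move the top generator to the left through the lower ones and cancel it, so that a word
  becomes a power of the top generator followed by a lower word; a power that lies in the lower
  group is replaced block by block.
\<close>

lemma rewriting_system:
  assumes "i \<le> m"
  shows "\<exists>R. finite R \<and> (\<forall>(l, r)\<in>R. set l \<subseteq> {..<2 * m} \<and> set r \<subseteq> {..<2 * m} \<and> val l = val r) \<and>
    (\<forall>w. set w \<subseteq> {..<2 * i} \<longrightarrow> val w = \<one> \<longrightarrow> (w, []) \<in> (rewrite_step R)\<^sup>*)"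
  using assms
proof (induction i)
  case 0
  then show ?case by (intro exI[of _ "{}"]) simp
next
  case (Suc i)
  then have i: "i < m" by simp
  then obtain R where R: "finite R"
    "\<And>l r. (l, r) \<in> R \<Longrightarrow> set l \<subseteq> {..<2 * m} \<and> set r \<subseteq> {..<2 * m} \<and> val l = val r"
    "\<And>w. set w \<subseteq> {..<2 * i} \<Longrightarrow> val w = \<one> \<Longrightarrow> (w, []) \<in> (rewrite_step R)\<^sup>*"
  proof -
    from Suc.IH i obtain R where "finite R"
      "\<forall>(l, r)\<in>R. set l \<subseteq> {..<2 * m} \<and> set r \<subseteq> {..<2 * m} \<and> val l = val r"
      "\<forall>w. set w \<subseteq> {..<2 * i} \<longrightarrow> val w = \<one> \<longrightarrow> (w, []) \<in> (rewrite_step R)\<^sup>*"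
      by (meson less_imp_le)
    then show ?thesis by (intro that[of R]) blast+
  qed
  define T where "T = {2 * i, 2 * i + 1}"
  have T: "t < 2 * m" "letter t \<in> carrier G" if "t \<in> T" for t
    using that i by (auto simp: T_def intro: letter_closed)
  have low: "{..<2 * i} \<subseteq> {..<2 * m}" using i by auto
  have "\<exists>w. set w \<subseteq> {..<2 * i} \<and> val w = inv (letter t) \<otimes> letter x \<otimes> letter t" if "t \<in> T"
    "x < 2 * i" for t x
  proof -
    have "val [x] \<in> N i" using that i by (intro val_in_N) auto
    then have "letter x \<in> N i" using that i by simp
    then have "inv (letter t) \<otimes> letter x \<otimes> letter t \<in> N i"
      using i T that by (intro N_conj) auto
    then show ?thesis using i by (metis N_val less_imp_le)
  qed
  \<comment> \<open>The rule for \<open>x t\<close> moves \<open>t\<close> to the front and replaces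
    \<open>x\<close> by its conjugate, written in lower generators. The top generator and its
    inverse each need such rules.\<close>
  then obtain W where W: "\<And>t x. t \<in> T \<Longrightarrow> x < 2 * i \<Longrightarrow> set (W t x) \<subseteq> {..<2 * i} \<and>
      val (W t x) = inv (letter t) \<otimes> letter x \<otimes> letter t"
    by metis
  let ?q = "int (period i)"
  have "\<exists>w. set w \<subseteq> {..<2 * i} \<and> val w = a i [^] (s * ?q)" for s
    using period[OF i, of "s * ?q"] i by (metis N_val dvd_triv_right less_imp_le)
  then obtain P where P: "\<And>s. set (P s) \<subseteq> {..<2 * i} \<and> val (P s) = a i [^] (s * ?q)"
    by metis
  \<comment> \<open>For period 0 the last rules rewrite the empty word to a word of value one. They
    are sound and do no harm, as only derivability of \<open>[]\<close> matters.\<close>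
  define R' where "R' = R \<union> {([2 * i, 2 * i + 1], []), ([2 * i + 1, 2 * i], [])} \<union>
      (\<lambda>(t, x). ([x, t], t # W t x)) ` (T \<times> {..<2 * i}) \<union>
      (\<lambda>s. (power_word i (s * ?q), P s)) ` {1, - 1}"
  let ?rew = "\<lambda>u v. (u, v) \<in> (rewrite_step R')\<^sup>*"
  have finite: "finite R'" using R(1) by (simp add: R'_def T_def)
  have sound: "set l \<subseteq> {..<2 * m} \<and> set r \<subseteq> {..<2 * m} \<and> val l = val r" if "(l, r) \<in> R'" for l r
  proof -
    from that consider "(l, r) \<in> R" | "l = [2 * i, 2 * i + 1] \<or> l = [2 * i + 1, 2 * i]" "r = []"
      | t x where "t \<in> T" "x < 2 * i" "l = [x, t]" "r = t # W t x"
      | "(l, r) \<in> (\<lambda>s. (power_word i (s * ?q), P s)) ` {1, - 1}"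
      unfolding R'_def by (elim UnE) auto
    then show ?thesis
    proof cases
      case 1
      then show ?thesis by (rule R(2))
    next
      case 2
      then show ?thesis using i by (auto simp: letter_def)
    next
      case 3
      have "x < 2 * m" using 3(2) i by simp
      then show ?thesis using 3 T[OF 3(1)] W[OF 3(1,2)] low by (auto simp: m_assoc)
    next
      case 4
      then obtain s where "l = power_word i (s * ?q)" "r = P s" by blast
      then show ?thesis using P[of s] low i set_power_word[of i m] by (auto simp: val_power_word)
    qed
  qed
  have move: "\<exists>v'. set v' \<subseteq> {..<2 * i} \<and> ?rew (v @ [t]) (t # v')" if t: "t \<in> T" and
    "set v \<subseteq> {..<2 * i}" for t v
    using that(2)
  proof (induction v)
    case Nil
    show ?case by (intro exI[of _ "[]"]) simp
  next
    case (Cons x v)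
    then obtain v' where v': "set v' \<subseteq> {..<2 * i}" "?rew (v @ [t]) (t # v')" by auto
    have "?rew (x # v @ [t]) (x # t # v')"
      using rewrite_context[OF v'(2), of "[x]" "[]"] by simp
    also have "?rew [x, t] (t # W t x)"
      using t Cons.prems by (intro rewrite_rule) (force simp: R'_def)
    from rewrite_context[OF this, of "[]" v'] have "?rew (x # t # v') (t # W t x @ v')" by simp
    finally show ?case using v'(1) W[OF t, of x] Cons.prems
      by (intro exI[of _ "W t x @ v'"]) auto
  qed
  have absorb: "\<exists>k'. ?rew (power_word i k @ [t]) (power_word i k')" if "t \<in> T" for k t
  proof -
    have cancel: "?rew [2 * i, Suc (2 * i)] []" "?rew [Suc (2 * i), 2 * i] []"
      by (intro rewrite_rule; simp add: R'_def)+
    from that consider "t = 2 * i" "k \<ge> 0" | "t = 2 * i" "k < 0" | "t = 2 * i + 1" "k > 0" | "t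
      = 2 * i + 1" "k \<le> 0"
      unfolding T_def by force
    then show ?thesis
    proof cases
      case 1
      then have "power_word i k @ [t] = power_word i (k + 1)"
        by (simp add: power_word_def replicate_append_same nat_add_distrib)
      then show ?thesis by (metis rtrancl.rtrancl_refl)
    next
      case 2
      then obtain n where "nat (- k) = Suc n" by (cases "nat (- k)") auto
      then have "power_word i k @ [t] = replicate n (2 * i + 1) @ [Suc (2 * i), 2 * i] @ []"
        "power_word i (- int n) = replicate n (2 * i + 1)"
        using 2 by (auto simp: power_word_def replicate_append_same simp flip: replicate_Suc)
      then show ?thesis using rewrite_context[OF cancel(2), of "replicate n (2 * i + 1)" "[]"]
        by (metis append.right_neutral)
    next
      case 3
      then obtain n where "nat k = Suc n" by (cases "nat k") auto
      then have "power_word i k @ [t] = replicate n (2 * i) @ [2 * i, Suc (2 * i)] @ []"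
        "power_word i (int n) = replicate n (2 * i)"
        using 3 by (auto simp: power_word_def replicate_append_same)
      then show ?thesis using rewrite_context[OF cancel(1), of "replicate n (2 * i)" "[]"]
        by (metis append.right_neutral)
    next
      case 4
      then have "nat (1 - k) = Suc (nat (- k))" by simp
      with 4 have "power_word i k @ [t] = power_word i (k - 1)"
        by (auto simp: power_word_def replicate_append_same )
      then show ?thesis by (metis rtrancl.rtrancl_refl)
    qed
  qed
  \<comment> \<open>Letters enter from the right: a lower letter joins \<open>v\<close>, and a top
    letter travels left through \<open>v\<close> and merges with the power.\<close>
  have normal_form: "\<exists>k v. set v \<subseteq> {..<2 * i} \<and> ?rew u (power_word i k @ v)" if
    "set u \<subseteq> {..<2 * Suc i}" for u
    using that
  proof (induction u rule: rev_induct)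
    case Nil
    show ?case by (intro exI[of _ 0] exI[of _ "[]"]) (simp add: power_word_def)
  next
    case (snoc t u)
    then obtain k v where kv: "set v \<subseteq> {..<2 * i}" "?rew u (power_word i k @ v)" by auto
    from rewrite_context[OF kv(2), of "[]" "[t]"] have rew:
      "?rew (u @ [t]) (power_word i k @ (v @ [t]))" by simp
    show ?case
    proof (cases "t < 2 * i")
      case True
      with kv(1) rew show ?thesis by (intro exI[of _ k] exI[of _ "v @ [t]"]) simp
    next
      case False
      with snoc.prems have t: "t \<in> T" by (auto simp: T_def)
      obtain v' where v': "set v' \<subseteq> {..<2 * i}" "?rew (v @ [t]) (t # v')" using move[OF t kv(1)]
        by blast
      obtain k' where k': "?rew (power_word i k @ [t]) (power_word i k')" using absorb[OF t]
        by blast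
      note rew
      also have "?rew (power_word i k @ (v @ [t])) (power_word i k @ t # v')"
        using rewrite_context[OF v'(2), of "power_word i k" "[]"] by simp
      also have "?rew (power_word i k @ t # v') (power_word i k' @ v')"
        using rewrite_context[OF k', of "[]" v'] by simp
      finally show ?thesis using v'(1) by blast
    qed
  qed
  have preserve: "val u = val v \<and> set v \<subseteq> {..<2 * m}"
    if "?rew u v" "set u \<subseteq> {..<2 * m}" for u v
    by (rule rewrite_preserves_val[OF _ that]) (rule sound)
  have blocks: "\<exists>v. set v \<subseteq> {..<2 * i} \<and> ?rew (power_word i k) v" if k: "?q dvd k" for k
  proof -
    have rep: "\<exists>v. set v \<subseteq> {..<2 * i} \<and> ?rew (concat (replicate n (power_word i (s * ?q)))) v"
      if s: "s \<in> {1, - 1}" for n s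
    proof (intro exI conjI)
      show "set (concat (replicate n (P s))) \<subseteq> {..<2 * i}" using P[of s] by auto
      have "?rew (power_word i (s * ?q)) (P s)" using s by (intro rewrite_rule) (auto simp: R'_def)
      then show "?rew (concat (replicate n (power_word i (s * ?q)))) (concat (replicate n (P s)))"
        by (induction n) (auto intro: rewrite_append)
    qed
    have concat_rep: "concat (replicate n (replicate l y)) = replicate (n * l) y"
      for n l and y :: nat
      by (induction n) (simp_all add: replicate_add)
    obtain j where j: "k = ?q * j" using k by blast
    show ?thesis
    proof (cases "j \<ge> 0")
      case True
      then have "power_word i k = concat (replicate (nat j) (power_word i (1 * ?q)))"
        using j by (simp add: power_word_def concat_rep nat_mult_distrib mult.commute)
      then show ?thesis using rep[of 1 "nat j"] by simp
    next
      case False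
      show ?thesis
      proof (cases "period i = 0")
        case True
        then have "power_word i k = concat (replicate 0 (power_word i (1 * ?q)))"
          using j by (simp add: power_word_def)
        then show ?thesis using rep[of 1 0] by simp
      next
        case q: False
        with False j have "k < 0" by (simp add: mult_pos_neg)
        moreover have "nat (- k) = nat (- j) * period i"
        proof -
          have "- k = - j * int (period i)" "0 \<le> - j" using j False by simp_all
          then show ?thesis by (metis nat_int nat_mult_distrib)
        qed
        ultimately have "power_word i k = concat (replicate (nat (- j)) (power_word i ((- 1) *
          ?q)))"
          using q by (simp add: power_word_def concat_rep)
        then show ?thesis using rep[of "- 1" "nat (- j)"] by simp
      qed
    qed
  qed
  have complete: "?rew w []" if w: "set w \<subseteq> {..<2 * Suc i}" "val w = \<one>" for w
  proof -
    have "set w \<subseteq> {..<2 * m}"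
    proof -
      have "{..<2 * Suc i} \<subseteq> {..<2 * m}" using i by auto
      with w(1) show ?thesis by (rule order_trans)
    qed
    obtain k v where kv: "set v \<subseteq> {..<2 * i}" "?rew w (power_word i k @ v)"
      using normal_form[OF w(1)] by blast
    have v: "set v \<subseteq> {..<2 * m}" using kv(1) low by (rule order_trans)
    \<comment> \<open>The power is the inverse of the value of the lower word \<open>v\<close>, so
      it lies in \<open>N i\<close> and its exponent is a multiple of the period. Replacing it block
      by block leaves a lower word of value one, which the rules in \<open>R\<close> erase.\<close>
    have "a i [^] k \<otimes> val v = \<one>"
      using preserve[OF kv(2) \<open>set w \<subseteq> {..<2 * m}\<close>] w(2) v i set_power_word[OF i, of k]
      by (simp add: val_power_word)
    then have "a i [^] k = inv (val v)"
      using v i by (metis a_closed int_pow_closed inv_equality inv_inv inv_closed val_closed)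
    then have "a i [^] k \<in> N i"
      using val_in_N[of i v] kv(1) i subgroup.m_inv_closed[OF subgroup_N[of i]] by simp
    then obtain u where u: "set u \<subseteq> {..<2 * i}" "?rew (power_word i k) u"
      using blocks period[OF i] by blast
    have uv: "?rew w (u @ v)"
      using kv(2) rewrite_context[OF u(2), of "[]" v] by (simp add: rtrancl_trans)
    then have "val (u @ v) = \<one>" using preserve[OF uv \<open>set w \<subseteq> {..<2 * m}\<close>] w(2) by simp
    then have "(u @ v, []) \<in> (rewrite_step R)\<^sup>*"
      using u(1) kv(1) by (intro R(3)) auto
    then have "?rew (u @ v) []" by (rule rewrite_mono[rotated]) (auto simp: R'_def)
    with uv show ?thesis by (rule rtrancl_trans)
  qed
  show ?case
    by (rule exI[of _ R']) (use finite sound complete in blast)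
qed

text \<open>A derivation of the empty word by the finitely many rules, fixed for the group,
  certifies the value one. Only this half of the word problem is used below.\<close>

lemma re_val_one:
  assumes "computable f"
  shows "re (\<lambda>x. set (f x) \<subseteq> {..<2 * m} \<and> val (f x) = \<one>)"
proof -
  from rewriting_system[OF order_refl] obtain R where sys: "finite R \<and>
      (\<forall>(l, r)\<in>R. set l \<subseteq> {..<2 * m} \<and> set r \<subseteq> {..<2 * m} \<and> val l = val r) \<and>
      (\<forall>w. set w \<subseteq> {..<2 * m} \<longrightarrow> val w = \<one> \<longrightarrow> (w, []) \<in> (rewrite_step R)\<^sup>*)" ..
  from sys have "finite R" by (rule conjunct1)
  from sys have R: "set l \<subseteq> {..<2 * m} \<and> set r \<subseteq> {..<2 * m} \<and> val l = val r" if "(l, r) \<in> R" for l r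
    using that by fast
  have complete: "(w, []) \<in> (rewrite_step R)\<^sup>*" if "set w \<subseteq> {..<2 * m}" "val w = \<one>" for w
  proof -
    from sys have "\<forall>w. set w \<subseteq> {..<2 * m} \<longrightarrow> val w = \<one> \<longrightarrow> (w, []) \<in> (rewrite_step R)\<^sup>*"
      by (elim conjE)
    with that show ?thesis by blast
  qed
  from \<open>finite R\<close> obtain rs where rs: "set rs = R" using finite_list by blast
  have "re (\<lambda>x. set (f x) \<subseteq> {..<2 * m} \<and> (f x, []) \<in> (rewrite_step (set rs))\<^sup>*)"
    by (intro re_conj re_dec re_rewrite computable_intros assms)
  moreover have "set w \<subseteq> {..<2 * m} \<and> (w, []) \<in> (rewrite_step R)\<^sup>* \<longleftrightarrow> set w \<subseteq> {..<2 * m} \<and> val w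
    = \<one>" for w
  proof -
    have "val w = val []" if "(w, []) \<in> (rewrite_step R)\<^sup>*" "set w \<subseteq> {..<2 * m}"
      using rewrite_preserves_val[OF _ that] R by blast
    with complete[of w] show ?thesis by auto
  qed
  ultimately show ?thesis by (simp only: rs)
qed

section \<open>Subgroups spanned by words\<close>

definition span :: "nat list list \<Rightarrow> 'a set" where
  "span Y = generate G (val ` set Y)"

lemma val_image_closed: "\<forall>y\<in>set Y. set y \<subseteq> {..<2 * m} \<Longrightarrow> val ` set Y \<subseteq> carrier G"
  by auto

lemma subgroup_span: "\<forall>y\<in>set Y. set y \<subseteq> {..<2 * m} \<Longrightarrow> subgroup (span Y) G"
  unfolding span_def by (intro generate_is_subgroup val_image_closed)

lemma span_subset_N:
  assumes "i \<le> m" "\<forall>y\<in>set Y. set y \<subseteq> {..<2 * i}"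
  shows "span Y \<subseteq> N i"
proof -
  have "val ` set Y \<subseteq> N i" using val_in_N[OF assms(1)] assms(2) by blast
  then show ?thesis unfolding span_def by (rule generate_subgroup_incl[OF _ subgroup_N[OF
    assms(1)]])
qed

lemma span_iff_word:
  assumes Y: "\<forall>y\<in>set Y. set y \<subseteq> {..<2 * m}"
  shows "x \<in> span Y \<longleftrightarrow>
    (\<exists>L. (\<forall>l\<in>set L. l \<in> set Y \<or> inverse_word l \<in> set Y) \<and> val (concat L) = x)"
proof
  assume "x \<in> span Y"
  then show "\<exists>L. (\<forall>l\<in>set L. l \<in> set Y \<or> inverse_word l \<in> set Y) \<and> val (concat L) = x"
    unfolding span_def
  proof induction
    case one
    then show ?case by (intro exI[of _ "[]"]) simp
  next
    case (incl h)
    then obtain y where "y \<in> set Y" "h = val y" by blast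
    then show ?case by (intro exI[of _ "[y]"]) simp
  next
    case (inv h)
    then obtain y where "y \<in> set Y" "h = val y" by blast
    then show ?case using Y by (intro exI[of _ "[inverse_word y]"]) simp
  next
    case (eng g h)
    then obtain L K where LK: "\<forall>l\<in>set L. l \<in> set Y \<or> inverse_word l \<in> set Y" "val (concat L) = g"
      "\<forall>l\<in>set K. l \<in> set Y \<or> inverse_word l \<in> set Y" "val (concat K) = h" by blast
    have "set (concat J) \<subseteq> {..<2 * m}" if "\<forall>l\<in>set J. l \<in> set Y \<or> inverse_word l \<in> set Y" for J
    proof -
      have "set l \<subseteq> {..<2 * m}" if "l \<in> set J" for l
        using that \<open>\<forall>l\<in>set J. _\<close> Y set_inverse_word[of l m] by blast
      then show ?thesis by auto
    qed
    with LK show ?case by (intro exI[of _ "L @ K"]) auto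
  qed
next
  assume "\<exists>L. (\<forall>l\<in>set L. l \<in> set Y \<or> inverse_word l \<in> set Y) \<and> val (concat L) = x"
  then obtain L where "\<forall>l\<in>set L. l \<in> set Y \<or> inverse_word l \<in> set Y" "val (concat L) = x" by blast
  moreover from this(1) have "val (concat L) \<in> span Y \<and> set (concat L) \<subseteq> {..<2 * m}"
  proof (induction L)
    case Nil
    then show ?case by (simp add: span_def generate.one)
  next
    case (Cons l L)
    then have l: "l \<in> set Y \<or> inverse_word l \<in> set Y" by simp
    then have range: "set l \<subseteq> {..<2 * m}" using Y set_inverse_word[of l m] by blast
    have "val l \<in> span Y"
    proof (cases "l \<in> set Y")
      case True
      then show ?thesis unfolding span_def by (intro generate.incl) simp
    next
      case False
      with l have "inv (val (inverse_word l)) \<in> span Y" unfolding span_def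
        by (intro generate.inv) simp
      then show ?thesis using range by simp
    qed
    with Cons range show ?case unfolding span_def by (auto intro: generate.eng)
  qed
  ultimately show "x \<in> span Y" by simp
qed

definition in_span :: "nat list \<Rightarrow> nat list list \<Rightarrow> bool" where
  "in_span w Y \<longleftrightarrow> set w \<subseteq> {..<2 * m} \<and> (\<forall>y\<in>set Y. set y \<subseteq> {..<2 * m}) \<and> val w \<in> span Y"

text \<open>A certificate is a product of spanning words and their inverses, together with a
  derivation that this product times the inverse of \<open>w\<close> has value one.\<close>

lemma re_in_span [re_intros]:
  assumes f: "computable f" and g: "computable g"
  shows "re (\<lambda>x. in_span (f x) (g x))"
proof -
  have "re (\<lambda>x. set (f x) \<subseteq> {..<2 * m} \<and> (\<forall>y\<in>set (g x). set y \<subseteq> {..<2 * m}) \<and>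
      (\<exists>L. (\<forall>l\<in>set L. l \<in> set (g x) \<or> inverse_word l \<in> set (g x)) \<and>
        set (concat L @ inverse_word (f x)) \<subseteq> {..<2 * m} \<and> val (concat L @ inverse_word (f x))
          = \<one>))"
    by (intro re_conj re_ex re_val_one re_dec computable_intros f g
        computable_compose[OF f] computable_compose[OF g])
  moreover have "set w \<subseteq> {..<2 * m} \<and> (\<forall>y\<in>set Y. set y \<subseteq> {..<2 * m}) \<and>
      (\<exists>L. (\<forall>l\<in>set L. l \<in> set Y \<or> inverse_word l \<in> set Y) \<and>
        set (concat L @ inverse_word w) \<subseteq> {..<2 * m} \<and> val (concat L @ inverse_word w) = \<one>)
      \<longleftrightarrow> in_span w Y" for w Y
  proof -
    have "set (concat L @ inverse_word w) \<subseteq> {..<2 * m} \<and> val (concat L @ inverse_word w) = \<one>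
        \<longleftrightarrow> val (concat L) = val w"
      if w: "set w \<subseteq> {..<2 * m}" and Y: "\<forall>y\<in>set Y. set y \<subseteq> {..<2 * m}"
        and L: "\<forall>l\<in>set L. l \<in> set Y \<or> inverse_word l \<in> set Y" for L
    proof -
      have "set l \<subseteq> {..<2 * m}" if "l \<in> set L" for l
        using that L Y set_inverse_word[of l m] by blast
      then have "set (concat L) \<subseteq> {..<2 * m}" by auto
      moreover have "set (inverse_word w) \<subseteq> {..<2 * m}" using w by (simp only: set_inverse_word)
      ultimately have "val (concat L @ inverse_word w) = val (concat L) \<otimes> inv (val w)"
        "set (concat L @ inverse_word w) \<subseteq> {..<2 * m}" "val (concat L) \<in> carrier G"
          "val w \<in> carrier G"
        using w by simp_all
      then show ?thesis using inv_solve_right'[of "\<one>" "val (concat L)" "val w"] by auto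
    qed
    then show ?thesis unfolding in_span_def using span_iff_word[of Y "val w"] by blast
  qed
  ultimately show ?thesis by simp
qed

text \<open>The exponents of \<open>a i\<close> that occur in \<open>B\<close> modulo
  \<open>N i\<close> form a subgroup of the integers. Its generator \<open>e\<close> is attained by
  \<open>u = a i [^] e \<otimes> h\<close> in \<open>B\<close>, and dividing \<open>y\<close> by a
  suitable power of \<open>u\<close> leaves an element of \<open>N i\<close>. The number
  \<open>n\<close> is the order of \<open>u\<close> modulo \<open>N i\<close>, with 0 for infinite
  order; for \<open>e = 0\<close> the element \<open>u\<close> itself lies in \<open>N i\<close>,
  hence \<open>n = 1\<close>.\<close>

lemma subgroup_decomposition:
  assumes i: "i < m" and B: "subgroup B G" "B \<subseteq> N (Suc i)"
  obtains e n :: nat and h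
  where "h \<in> N i" "a i [^] int e \<otimes> h \<in> B" "n * e = period i" "e = 0 \<longrightarrow> n = 1"
    "\<forall>y\<in>B. \<exists>k::int. \<exists>b\<in>B \<inter> N i. y = (a i [^] int e \<otimes> h) [^] k \<otimes> b"
proof -
  interpret B: subgroup B G by (rule B(1))
  have Ni: "N i \<lhd> G" using i by (intro N_normal) simp
  interpret N: normal "N i" G by (rule Ni)
  define E where "E = {k::int. \<exists>h\<in>N i. a i [^] k \<otimes> h \<in> B}"
  have "\<exists>e::nat. \<forall>k. k \<in> E \<longleftrightarrow> int e dvd k"
  proof (rule int_subgroup_principal)
    show "0 \<in> E" unfolding E_def by (auto intro!: bexI[of _ \<one>])
    fix k l assume "k \<in> E" "l \<in> E"
    then obtain h h' where h: "h \<in> N i" "a i [^] k \<otimes> h \<in> B" "h' \<in> N i" "a i [^] l \<otimes> h' \<in> B"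
      unfolding E_def by blast
    have "a i [^] k \<otimes> h \<otimes> inv (a i [^] l \<otimes> h') \<in> B" using h by simp
    moreover have "a i [^] (k - l) = a i [^] k \<otimes> inv (a i [^] l)"
      using i int_pow_mult[of "a i" k "- l"] by (simp add: int_pow_neg)
    then have "a i [^] k \<otimes> h \<otimes> inv (a i [^] l \<otimes> h')
        = a i [^] (k - l) \<otimes> (a i [^] l \<otimes> (h \<otimes> inv h') \<otimes> inv (a i [^] l))"
      using h i by (simp add: inv_mult_group m_assoc)
    moreover have "a i [^] l \<otimes> (h \<otimes> inv h') \<otimes> inv (a i [^] l) \<in> N i"
      using h i N.inv_op_closed2 by simp
    ultimately show "k - l \<in> E" unfolding E_def by auto
  qed
  then obtain e :: nat where e: "\<And>k. k \<in> E \<longleftrightarrow> int e dvd k" by blast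
  then have "int e \<in> E" by simp
  then obtain h where h: "h \<in> N i" "a i [^] int e \<otimes> h \<in> B" unfolding E_def by blast
  have "a i [^] int (period i) \<in> N i" using period[OF i] by simp
  then have "int (period i) \<in> E"
    unfolding E_def using i by (auto intro!: bexI[of _ "inv (a i [^] int (period i))"])
  then have "e dvd period i" using e by simp
  then obtain n' where n': "period i = e * n'" by blast
  show thesis
  proof (rule that[of h e "if e = 0 then 1 else n'"])
    show "\<forall>y\<in>B. \<exists>k::int. \<exists>b\<in>B \<inter> N i. y = (a i [^] int e \<otimes> h) [^] k \<otimes> b"
    proof
      fix y assume y: "y \<in> B"
      then obtain k :: int and h' where kh: "y = a i [^] k \<otimes> h'" "h' \<in> N i"
        using B(2) N_Suc[OF i] by blast
      then have "k \<in> E" using y by (auto simp: E_def)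
      then obtain j where j: "k = int e * j" using e by blast
      define u where "u = a i [^] int e \<otimes> h"
      have u: "u \<in> carrier G" using h i by (simp add: u_def)
      have "inv ((a i [^] int e) [^] j) \<otimes> u [^] j \<in> N i"
        unfolding u_def using i h by (intro pow_mult_normal Ni) simp_all
      then have "inv (inv (a i [^] k) \<otimes> u [^] j) \<otimes> h' \<in> N i"
        using i kh(2) by (simp add: j int_pow_pow)
      moreover have "inv (inv (a i [^] k) \<otimes> u [^] j) \<otimes> h' = inv (u [^] j) \<otimes> y"
        using i u kh by (simp add: inv_mult_group m_assoc)
      moreover have "u [^] j \<in> B"
        using h(2) by (intro subgroup_int_pow_closed B(1)) (simp add: u_def)
      then have "inv (u [^] j) \<otimes> y \<in> B" using y by simp
      moreover have "y = u [^] j \<otimes> (inv (u [^] j) \<otimes> y)" using u y by simp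
      ultimately show "\<exists>k::int. \<exists>b\<in>B \<inter> N i. y = (a i [^] int e \<otimes> h) [^] k \<otimes> b"
        unfolding u_def by (intro exI[of _ j] bexI[of _ "inv (u [^] j) \<otimes> y"]) (simp_all add: u_def)
    qed
  qed (use h n' in auto)
qed

lemma val_coset_word:
  assumes "i < m" "set v \<subseteq> {..<2 * i}"
  shows "val (coset_word i e v) = a i [^] int e \<otimes> val v"
    "set (coset_word i e v) \<subseteq> {..<2 * Suc i}" "set (coset_word i e v) \<subseteq> {..<2 * m}"
proof -
  have e: "coset_word i e v = power_word i (int e) @ v"
    by (simp add: coset_word_def power_word_def)
  have "set v \<subseteq> {..<2 * m}" using assms by auto
  then show "val (coset_word i e v) = a i [^] int e \<otimes> val v"
    using assms(1) set_power_word[of i m] by (simp add: e val_power_word)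
qed (use assms in \<open>auto simp: coset_word_def\<close>)

text \<open>Polycyclic groups have finitely generated subgroups: a word for \<open>u\<close> is
  added to the words for \<open>B \<inter> N i\<close>. This guarantees that the certificates of
  \<open>meets_trivially_Suc\<close> exist.\<close>

lemma finitely_generated_subgroup:
  assumes "i \<le> m" "subgroup B G" "B \<subseteq> N i"
  shows "\<exists>Y. (\<forall>y\<in>set Y. set y \<subseteq> {..<2 * i}) \<and> span Y = B"
  using assms
proof (induction i arbitrary: B)
  case 0
  then have "B = {\<one>}"
    using subgroup.one_closed by (force simp: N_def generate_empty)
  then show ?case by (intro exI[of _ "[]"]) (simp add: span_def generate_empty)
next
  case (Suc i)
  then have i: "i < m" by simp
  interpret B: subgroup B G by (rule Suc.prems(2))
  obtain e n :: nat and h where h: "h \<in> N i" and u: "a i [^] int e \<otimes> h \<in> B"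
    and dec: "\<forall>y\<in>B. \<exists>k::int. \<exists>b\<in>B \<inter> N i. y = (a i [^] int e \<otimes> h) [^] k \<otimes> b"
    by (rule subgroup_decomposition[OF i Suc.prems(2,3)])
  obtain Y where Y: "\<forall>y\<in>set Y. set y \<subseteq> {..<2 * i}" "span Y = B \<inter> N i"
    using Suc.IH[of "B \<inter> N i"] i subgroups_Inter_pair[OF Suc.prems(2) subgroup_N[of i]] by auto
  obtain v where v: "set v \<subseteq> {..<2 * i}" "val v = h" using N_val[of i h] i h by auto
  let ?Y = "(coset_word i e v) # Y"
  note val_u = val_coset_word[OF i v(1), of e, unfolded v(2)]
  have "{..<2 * i} \<subseteq> {..<2 * Suc i}" by auto
  then have range: "\<forall>y\<in>set ?Y. set y \<subseteq> {..<2 * Suc i}"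
    using Y(1) val_u(2) by (metis order_trans set_ConsD)
  moreover have "{..<2 * Suc i} \<subseteq> {..<2 * m}" using Suc.prems(1) by auto
  ultimately have range': "\<forall>y\<in>set ?Y. set y \<subseteq> {..<2 * m}"
    by (meson order_trans)
  have sub: "subgroup (span ?Y) G" by (rule subgroup_span[OF range'])
  have mono: "span Y \<subseteq> span ?Y" unfolding span_def by (intro mono_generate) auto
  have "span ?Y = B"
  proof
    have "val y \<in> B" if "y \<in> set Y" for y
      using that Y(2) unfolding span_def by (auto intro: generate.incl)
    then show "span ?Y \<subseteq> B"
      unfolding span_def using u val_u(1) by (intro generate_subgroup_incl Suc.prems(2)) auto
    show "B \<subseteq> span ?Y"
    proof
      fix y assume "y \<in> B"
      then obtain k :: int and b where b: "b \<in> B \<inter> N i" "y = (a i [^] int e \<otimes> h) [^] k \<otimes> b"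
        using dec by blast
      have "a i [^] int e \<otimes> h \<in> span ?Y"
        unfolding span_def val_u(1)[symmetric] by (intro generate.incl) simp
      then have "(a i [^] int e \<otimes> h) [^] k \<in> span ?Y" by (rule subgroup_int_pow_closed[OF sub])
      moreover have "b \<in> span ?Y" using b(1) Y(2) mono by auto
      ultimately show "y \<in> span ?Y" unfolding b(2) by (rule subgroup.m_closed[OF sub])
    qed
  qed
  with range show ?case by blast
qed

text \<open>\<open>N 1\<close> is the bottom cyclic term, in the application the factor
  \<open>\<int>\<close>. The index \<open>i\<close> bounds the letters, so that the condition can be
  lowered from \<open>i + 1\<close> to \<open>i\<close>.\<close>

definition meets_trivially :: "nat \<Rightarrow> nat list list \<Rightarrow> bool" where
  "meets_trivially i Y \<longleftrightarrow> (\<forall>y\<in>set Y. set y \<subseteq> {..<2 * i}) \<and> span Y \<inter> N 1 = {\<one>}"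

text \<open>
  The group spanned by \<open>Y\<close> is \<open>\<langle>u\<rangle> C\<close> with \<open>C\<close> its intersection with the next lower term of the
  series, spanned by \<open>Z\<close>. The conditions on the right are implied by this and can be verified by
  word problems; conversely they suffice for \<open>span Y \<inter> N i \<subseteq> C\<close>.
\<close>

lemma meets_trivially_Suc:
  assumes i: "1 \<le> i" "i < m"
  shows "meets_trivially (Suc i) Y \<longleftrightarrow> (\<forall>y\<in>set Y. set y \<subseteq> {..<2 * Suc i}) \<and>
    (\<exists>e n v Z. n * e = period i \<and> (e = 0 \<longrightarrow> n = 1) \<and> set v \<subseteq> {..<2 * i} \<and>
      in_span (concat (replicate n (coset_word i e v))) Z \<and>
      (\<forall>z\<in>set Z. in_span (coset_word i e v @ z @ inverse_word (coset_word i e v)) Z \<and>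
                 in_span (inverse_word (coset_word i e v) @ z @ coset_word i e v) Z) \<and>
      (\<forall>y\<in>set Y. in_span y (coset_word i e v # Z)) \<and> meets_trivially i Z)"
    (is "_ \<longleftrightarrow> ?range \<and> ?cert")
proof (cases ?range)
  case range: True
  then have range': "\<forall>y\<in>set Y. set y \<subseteq> {..<2 * m}" using i by fastforce
  have Ni: "N i \<lhd> G" using i by (intro N_normal) simp
  interpret N: normal "N i" G by (rule Ni)
  have pow_u: "val (concat (replicate n u)) = val u [^] n
    \<and> set (concat (replicate n u)) \<subseteq> {..<2 * m}"
    if "set u \<subseteq> {..<2 * m}" for n u
    using that by (induction n) (auto simp del: nat_pow_Suc simp flip: nat_pow_Suc2)
  have "meets_trivially (Suc i) Y \<longleftrightarrow> ?cert"
  proof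
    assume meet: "meets_trivially (Suc i) Y"
    have B: "subgroup (span Y) G" by (rule subgroup_span[OF range'])
    interpret B: subgroup "span Y" G by (rule B)
    have BN: "span Y \<subseteq> N (Suc i)"
      using range i by (intro span_subset_N) auto
    obtain e n :: nat and h where h: "h \<in> N i" and u: "a i [^] int e \<otimes> h \<in> span Y"
      and n: "n * e = period i" "e = 0 \<longrightarrow> n = 1"
      and dec: "\<forall>y\<in>span Y. \<exists>k::int. \<exists>b\<in>span Y \<inter> N i. y = (a i [^] int e \<otimes> h) [^] k \<otimes> b"
      by (rule subgroup_decomposition[OF i(2) B BN])
    obtain v where v: "set v \<subseteq> {..<2 * i}" "val v = h" using N_val[of i h] i h by auto
    define uw where "uw = coset_word i e v"
    note val_u = val_coset_word[OF i(2) v(1), of e, unfolded v(2), folded uw_def]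
    have uc: "val uw \<in> carrier G" using val_u(3) by simp
    have u: "val uw \<in> span Y" using u by (simp only: val_u(1))
    obtain Z where Z: "\<forall>z\<in>set Z. set z \<subseteq> {..<2 * i}" "span Z = span Y \<inter> N i"
      using finitely_generated_subgroup[of i "span Y \<inter> N i"] i subgroups_Inter_pair[OF B
        subgroup_N[of i]] by auto
    have Z': "\<forall>z\<in>set Z. set z \<subseteq> {..<2 * m}" using Z(1) i by fastforce
    have Zval: "val z \<in> span Y \<inter> N i" if "z \<in> set Z" for z
      using that Z(2) unfolding span_def by (auto intro: generate.incl)
    have inv_u: "set (inverse_word uw) \<subseteq> {..<2 * m}" using val_u(3) by (simp only: set_inverse_word)
    \<comment> \<open>\<open>uw\<close> agrees with \<open>a i [^] e\<close> modulo
      \<open>N i\<close>, and \<open>e * n\<close> is the period.\<close>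
    have pow: "in_span (concat (replicate n uw)) Z"
    proof -
      have "a i [^] (int e * int n) \<in> N i" using period[OF i(2)] n(1)
        by (simp add: mult.commute flip: of_nat_mult)
      moreover have "inv ((a i [^] int e) [^] int n) \<otimes> (a i [^] int e \<otimes> h) [^] int n \<in> N i"
        using i h by (intro pow_mult_normal Ni) simp_all
      ultimately have "a i [^] (int e * int n) \<otimes> (inv (a i [^] (int e * int n)) \<otimes> val uw [^] int
        n) \<in> N i"
        using i by (simp add: int_pow_pow val_u(1))
      then have "val uw [^] n \<in> N i" using i uc by (simp add: int_pow_int)
      moreover have "val uw [^] n \<in> span Y"
        using subgroup_int_pow_closed[OF B u, of "int n"] by (simp add: int_pow_int)
      ultimately show ?thesis
        unfolding in_span_def using pow_u[OF val_u(3), of n] Z' Z(2) by simp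
    qed
    have conj: "in_span (uw @ z @ inverse_word uw) Z \<and> in_span (inverse_word uw @ z @ uw) Z" if
      "z \<in> set Z" for z
    proof -
      have "val uw \<otimes> val z \<otimes> inv (val uw) \<in> span Z" "inv (val uw) \<otimes> val z \<otimes> val uw \<in> span Z"
        unfolding Z(2) using Zval[OF that] u uc N.inv_op_closed1 N.inv_op_closed2 by auto
      then show ?thesis unfolding in_span_def
        using Z' that val_u(3) inv_u by (auto simp: m_assoc)
    qed
    have gens: "in_span y (uw # Z)" if "y \<in> set Y" for y
    proof -
      have range_uZ: "\<forall>y\<in>set (uw # Z). set y \<subseteq> {..<2 * m}" using Z' val_u(3) by auto
      have "val y \<in> span Y" unfolding span_def using that by (intro generate.incl) simp
      then obtain k :: int and b where b: "b \<in> span Z" "val y = val uw [^] k \<otimes> b"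
        using dec unfolding Z(2) val_u(1) by blast
      have "val uw \<in> span (uw # Z)" unfolding span_def by (intro generate.incl) simp
      then have "val uw [^] k \<in> span (uw # Z)" by (rule subgroup_int_pow_closed[OF
        subgroup_span[OF range_uZ]])
      moreover have "span Z \<subseteq> span (uw # Z)" unfolding span_def by (intro mono_generate) auto
      then have "b \<in> span (uw # Z)" using b(1) by blast
      ultimately have "val y \<in> span (uw # Z)"
        unfolding b(2) by (rule subgroup.m_closed[OF subgroup_span[OF range_uZ]])
      then show ?thesis unfolding in_span_def using range_uZ range' that by simp
    qed
    have "N 1 \<subseteq> N i" by (rule N_mono[OF i(1)])
    then have "meets_trivially i Z"
      using meet Z unfolding meets_trivially_def by blast
    then show ?cert
      using n v(1) pow conj gens
      by (intro exI[of _ e] exI[of _ n] exI[of _ v] exI[of _ Z]) (simp only: uw_def, blast)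
  next
    assume ?cert
    then obtain e n v Z where n: "n * e = period i" "e = 0 \<longrightarrow> n = 1" and v: "set v \<subseteq> {..<2 * i}"
      and c1: "in_span (concat (replicate n (coset_word i e v))) Z"
      and c2: "\<forall>z\<in>set Z. in_span (coset_word i e v @ z @ inverse_word (coset_word i e v)) Z \<and>
                 in_span (inverse_word (coset_word i e v) @ z @ coset_word i e v) Z"
      and c3: "\<forall>y\<in>set Y. in_span y (coset_word i e v # Z)"
      and c4: "meets_trivially i Z" by blast
    define uw where "uw = coset_word i e v"
    note c = c1[folded uw_def] c2[folded uw_def] c3[folded uw_def] c4
    note val_u = val_coset_word[OF i(2) v, of e, folded uw_def]
    have uc: "val uw \<in> carrier G" using val_u(3) by simp
    have inv_u: "set (inverse_word uw) \<subseteq> {..<2 * m}" using val_u(3) by (simp only: set_inverse_word)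
    have Z: "\<forall>z\<in>set Z. set z \<subseteq> {..<2 * i}" "span Z \<inter> N 1 = {\<one>}"
      using c(4) unfolding meets_trivially_def by auto
    then have Z': "\<forall>z\<in>set Z. set z \<subseteq> {..<2 * m}" using i by fastforce
    have C: "subgroup (span Z) G" by (rule subgroup_span[OF Z'])
    have CN: "span Z \<subseteq> N i"
      using Z(1) i by (intro span_subset_N) auto
    have conj1: "val uw \<otimes> x \<otimes> inv (val uw) \<in> span Z" if "x \<in> span Z" for x
    proof (rule generate_conj[OF val_image_closed[OF Z'] C uc _ that[unfolded span_def]])
      fix h assume "h \<in> val ` set Z"
      then obtain z where z: "z \<in> set Z" "h = val z" by blast
      then have "val (uw @ z @ inverse_word uw) \<in> span Z" using c(2) unfolding in_span_def by blast
      then show "val uw \<otimes> h \<otimes> inv (val uw) \<in> span Z"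
        using z Z' val_u(3) inv_u by (simp add: m_assoc)
    qed
    have conj2: "inv (val uw) \<otimes> x \<otimes> val uw \<in> span Z" if "x \<in> span Z" for x
    proof -
      have "inv (val uw) \<otimes> x \<otimes> inv (inv (val uw)) \<in> span Z"
      proof (rule generate_conj[OF val_image_closed[OF Z'] C _ _ that[unfolded span_def]])
        fix h assume "h \<in> val ` set Z"
        then obtain z where z: "z \<in> set Z" "h = val z" by blast
        then have "val (inverse_word uw @ z @ uw) \<in> span Z" using c(2) unfolding in_span_def
          by blast
        then show "inv (val uw) \<otimes> h \<otimes> inv (inv (val uw)) \<in> span Z"
          using z Z' val_u(3) inv_u by (simp add: m_assoc)
      qed (use uc in simp)
      then show ?thesis using uc by simp
    qed
    have "val ` set (uw # Z) = insert (val uw) (val ` set Z)" by simp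
    \<comment> \<open>The two conjugation conditions make the span of \<open>Z\<close> invariant
      under \<open>uw\<close>, so powers of \<open>uw\<close> can be collected on the left.\<close>
    then have span_uZ: "span (uw # Z) = {val uw [^] k \<otimes> x |(k::int) x. x \<in> span Z}"
      using generate_insert_eq[OF uc span_def[symmetric] val_image_closed[OF Z'] conj1 conj2]
      by (simp only: span_def)
    \<comment> \<open>Since \<open>n * e\<close> is the period, a power of \<open>uw\<close> in
      \<open>N i\<close> has an exponent divisible by \<open>n\<close> and so is a power of the
      certified element \<open>uw [^] n\<close>. For \<open>e = 0\<close> the equation says nothing
      about \<open>n\<close>, and the clause \<open>n = 1\<close> is what settles the case.\<close>
    have power_in: "val uw [^] k \<in> span Z" if "val uw [^] k \<in> N i" for k :: int
    proof -
      have "inv ((a i [^] int e) [^] k) \<otimes> val uw [^] k \<in> N i"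
        unfolding val_u(1) using i v by (intro pow_mult_normal Ni val_in_N) simp_all
      then have "val uw [^] k \<otimes> inv (inv (a i [^] (int e * k)) \<otimes> val uw [^] k) \<in> N i"
        using that i by (simp add: int_pow_pow)
      then have "a i [^] (int e * k) \<in> N i" using i uc by (simp add: inv_mult_group)
      then have "int n * int e dvd int e * k"
        using period[OF i(2)] n(1) by (metis of_nat_mult)
      then have "int n dvd k"
      proof (cases "e = 0")
        case True
        with n(2) show ?thesis by simp
      next
        case False
        then show ?thesis using \<open>int n * int e dvd int e * k\<close>
          by (simp add: mult.commute[of "int n"])
      qed
      then obtain j where j: "k = int n * j" by blast
      have "val uw [^] n \<in> span Z"
        using c(1) pow_u[OF val_u(3), of n] unfolding in_span_def by simp
      from subgroup_int_pow_closed[OF C this, of j] show ?thesis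
        using uc by (simp add: j int_pow_pow flip: int_pow_int)
    qed
    have range_uZ: "\<forall>y\<in>set (uw # Z). set y \<subseteq> {..<2 * m}" using Z' val_u(3) by auto
    have "span Y \<subseteq> span (uw # Z)"
      using c(3) unfolding span_def[of Y] in_span_def
      by (intro generate_subgroup_incl subgroup_span range_uZ) auto
    \<comment> \<open>Writing \<open>x\<close> as \<open>uw [^] k \<otimes> y\<close> with
      \<open>y\<close> in the span of \<open>Z\<close>, the power of \<open>uw\<close> lies in
      \<open>N i\<close>, because \<open>x\<close> and \<open>y\<close> do.\<close>
    have "x = \<one>" if "x \<in> span Y" "x \<in> N 1" for x
    proof -
      from that(1) obtain k :: int and y where y: "x = val uw [^] k \<otimes> y" "y \<in> span Z"
        using \<open>span Y \<subseteq> span (uw # Z)\<close> span_uZ by blast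
      have "x \<otimes> inv y \<in> N i" using that(2) y(2) CN N_mono[OF i(1)] by auto
      moreover have "y \<in> carrier G" using y(2) CN N.subset by blast
      ultimately have "val uw [^] k \<in> N i" using uc y(1) by (simp add: m_assoc)
      then have "x \<in> span Z" unfolding y(1)
        by (intro subgroup.m_closed[OF C] power_in y(2))
      then show ?thesis using that(2) Z(2) by blast
    qed
    moreover have "\<one> \<in> span Y \<inter> N 1"
      using subgroup.one_closed[OF subgroup_span[OF range']] subgroup.one_closed[OF subgroup_N[of
        1]] i by simp
    ultimately show "meets_trivially (Suc i) Y"
      unfolding meets_trivially_def using range by blast
  qed
  with range show ?thesis by blast
qed (unfold meets_trivially_def, blast)

text \<open>The number of levels is at most the fixed \<open>m\<close>, so unfolding the equivalence
  level by level leaves a fixed combination of enumerable conditions. At the bottom the span lies in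
  \<open>N 1\<close>, and meeting it trivially means that all spanning words have value one.\<close>

lemma re_meets_trivially:
  assumes "1 \<le> i" "i \<le> m"
  shows "re (meets_trivially i)"
  using assms
proof (induction i rule: nat_induct_at_least)
  case base
  have re: "re (\<lambda>Y. (\<forall>y\<in>set Y. set y \<subseteq> {..<2 * 1}) \<and> (\<forall>y\<in>set Y. set y \<subseteq> {..<2 * m} \<and> val y = \<one>))"
    by (intro re_conj re_ball_set re_val_one re_dec computable_intros)
  have iff: "meets_trivially 1 Y \<longleftrightarrow>
      (\<forall>y\<in>set Y. set y \<subseteq> {..<2 * 1}) \<and> (\<forall>y\<in>set Y. set y \<subseteq> {..<2 * m} \<and> val y = \<one>)" for Y
  proof (cases "\<forall>y\<in>set Y. set y \<subseteq> {..<2 * 1}")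
    case True
    then have range: "\<forall>y\<in>set Y. set y \<subseteq> {..<2 * m}" using base by fastforce
    have "span Y \<subseteq> N 1"
      using True base by (intro span_subset_N)
    moreover have "\<one> \<in> span Y" by (simp add: span_def generate.one)
    moreover have "span Y = {\<one>} \<longleftrightarrow> (\<forall>y\<in>set Y. val y = \<one>)"
    proof
      assume "span Y = {\<one>}"
      then show "\<forall>y\<in>set Y. val y = \<one>" unfolding span_def by (metis generate.incl imageI singletonD)
    next
      assume "\<forall>y\<in>set Y. val y = \<one>"
      then have "val ` set Y \<subseteq> {\<one>}" by auto
      then have "span Y \<subseteq> {\<one>}" unfolding span_def by (rule generate_subgroup_incl[OF _
        triv_subgroup])
      with \<open>\<one> \<in> span Y\<close> show "span Y = {\<one>}" by blast
    qed
    ultimately show ?thesis using True range unfolding meets_trivially_def by blast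
  qed (unfold meets_trivially_def, blast)
  have "re (\<lambda>Y. meets_trivially 1 Y)" unfolding iff by (rule re)
  then show ?case .
next
  case (Suc i)
  then have IH: "re (meets_trivially i)" and i: "1 \<le> i" "i < m" by simp_all
  have "re (\<lambda>Y. meets_trivially (Suc i) Y)"
    unfolding meets_trivially_Suc[OF i]
    by (intro re_conj re_ex re_ball_set re_in_span re_compose[OF IH] re_dec computable_intros)
  then show ?case .
qed

end

section \<open>Deciding the two problems\<close>

lemma ex_list_in_image:
  assumes "set ys \<subseteq> f ` A"
  shows "\<exists>xs. set xs \<subseteq> A \<and> ys = map f xs"
proof -
  have "ys \<in> map f ` lists A" using assms by (auto simp flip: lists_image)
  then show ?thesis by auto
qed

section \<open>Subsemigroups that are groups\<close>

context group
begin

lemma foldr_mult_concat_one: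
  assumes "\<And>L. L \<in> set Ls \<Longrightarrow> set L \<subseteq> carrier G \<and> foldr (\<otimes>) L \<one> = \<one>"
  shows "foldr (\<otimes>) (concat Ls) \<one> = \<one>"
  using assms
proof (induction Ls)
  case (Cons L Ls)
  then have "set L \<subseteq> carrier G" "foldr (\<otimes>) L \<one> = \<one>" "set (concat Ls) \<subseteq> carrier G" by auto
  with Cons show ?case by (simp only: concat.simps foldr_mult_append) simp
qed simp

text \<open>If inverses are products, each \<open>x\<close> occurs in a product equal to the
  identity, and the concatenation of these products uses all of \<open>F\<close>. Conversely, a
  product \<open>u x v\<close> equal to the identity shows that \<open>v u\<close> is the inverse of
  \<open>x\<close>. The map \<open>f\<close> is there because inputs are words, several of which may
  have the same value.\<close>

lemma subsemigroup_subgroup_iff: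
  assumes "finite F" "f ` F \<subseteq> carrier G"
  shows "subgroup (subsemigroup_generated G (f ` F)) G \<longleftrightarrow>
    F \<noteq> {} \<and> (\<exists>L. set L = F \<and> foldr (\<otimes>) (map f L) \<one> = \<one>)"
proof
  assume sub: "subgroup (subsemigroup_generated G (f ` F)) G"
  have one: "\<one> \<in> subsemigroup_generated G (f ` F)" by (rule subgroup.one_closed[OF sub])
  have F: "F \<noteq> {}" using one unfolding subsemigroup_generated_def by auto
  have "\<exists>L. x \<in> set L \<and> set L \<subseteq> F \<and> foldr (\<otimes>) (map f L) \<one> = \<one>" if x: "x \<in> F" for x
  proof -
    have fx: "f x \<in> carrier G" using x assms(2) by auto
    have "foldr (\<otimes>) [f x] \<one> \<in> subsemigroup_generated G (f ` F)"
      unfolding subsemigroup_generated_def using x by (intro CollectI exI[of _ "[f x]"]) auto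
    then have "inv (f x) \<in> subsemigroup_generated G (f ` F)"
      using fx subgroup.m_inv_closed[OF sub] by simp
    then obtain ss where ss: "set ss \<subseteq> f ` F" "inv (f x) = foldr (\<otimes>) ss \<one>"
      unfolding subsemigroup_generated_def by blast
    then obtain L where L: "set L \<subseteq> F" "ss = map f L"
      using ex_list_in_image by meson
    then show ?thesis using x fx ss(2)[symmetric] by (intro exI[of _ "x # L"]) auto
  qed
  then obtain K where K: "\<And>x. x \<in> F \<Longrightarrow> x \<in> set (K x) \<and> set (K x) \<subseteq> F \<and> foldr (\<otimes>) (map f (K x)) \<one> = \<one>"
    by metis
  obtain xs where xs: "set xs = F" using finite_list[OF assms(1)] by blast
  have prod: "foldr (\<otimes>) (map f (concat (map K xs))) \<one> = \<one>"
    unfolding map_concat map_map o_def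
  proof (rule foldr_mult_concat_one)
    fix M assume "M \<in> set (map (\<lambda>x. map f (K x)) xs)"
    then obtain x where "x \<in> F" "M = map f (K x)" using xs by auto
    then show "set M \<subseteq> carrier G \<and> foldr (\<otimes>) M \<one> = \<one>" using K[of x] assms(2) by auto
  qed
  have set: "set (concat (map K xs)) = F"
  proof
    show "set (concat (map K xs)) \<subseteq> F" using K xs by auto
    show "F \<subseteq> set (concat (map K xs))" using K xs by auto
  qed
  show "F \<noteq> {} \<and> (\<exists>L. set L = F \<and> foldr (\<otimes>) (map f L) \<one> = \<one>)"
    by (intro conjI exI[of _ "concat (map K xs)"] F set prod)
next
  assume rhs: "F \<noteq> {} \<and> (\<exists>L. set L = F \<and> foldr (\<otimes>) (map f L) \<one> = \<one>)"
  then have "F \<noteq> {}" by (rule conjunct1)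
  from rhs[THEN conjunct2] obtain L where "set L = F \<and> foldr (\<otimes>) (map f L) \<one> = \<one>" ..
  note L = this[THEN conjunct1] this[THEN conjunct2]
  let ?P = "subsemigroup_generated G (f ` F)"
  have P: "?P = insert \<one> ?P"
  proof -
    have "foldr (\<otimes>) (map f L) \<one> \<in> ?P"
      unfolding subsemigroup_generated_def using L(1) \<open>F \<noteq> {}\<close> by (intro CollectI exI[of _
        "map f L"]) auto
    then show ?thesis unfolding L(2) by blast
  qed
  have M: "submonoid ?P G" by (subst P) (rule submonoid_subsemigroup_generated[OF assms(2)])
  have inv: "inv (f x) \<in> ?P" if x: "x \<in> F" for x
  proof -
    obtain us vs where uv: "L = us @ x # vs" using x L(1) by (metis split_list)
    let ?u = "foldr (\<otimes>) (map f us) \<one>" and ?v = "foldr (\<otimes>) (map f vs) \<one>"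
    have sub: "set (map f us) \<subseteq> carrier G" "set (map f vs) \<subseteq> carrier G" and fx: "f x \<in> carrier G"
      using uv L(1) assms(2) by auto
    then have c: "?u \<in> carrier G" "?v \<in> carrier G" by (auto intro!: foldr_mult_closed)
    have "?u \<otimes> (f x \<otimes> ?v) = \<one>"
      using L(2) foldr_mult_append[of "map f us" "f x # map f vs"] sub fx unfolding uv by simp
    then have "(f x \<otimes> ?v) \<otimes> ?u = \<one>" by (rule inv_comm) (use c fx in simp_all)
    then have "f x \<otimes> (?v \<otimes> ?u) = \<one>" using c fx by (simp add: m_assoc)
    then have "(?v \<otimes> ?u) \<otimes> f x = \<one>" by (rule inv_comm) (use c fx in simp_all)
    then have "inv (f x) = ?v \<otimes> ?u" by (rule inv_equality) (use c fx in simp_all)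
    also have "\<dots> = foldr (\<otimes>) (map f (vs @ us)) \<one>"
      using foldr_mult_append[OF sub(2,1)] by simp
    also have "\<dots> \<in> insert \<one> ?P"
      unfolding insert_one_subsemigroup_generated using uv L(1) by (intro CollectI exI[of _
        "map f (vs @ us)"]) auto
    finally show ?thesis using P by simp
  qed
  show "subgroup ?P G"
  proof (rule subgroup.intro)
    show "?P \<subseteq> carrier G" using submonoid.subset[OF M] .
    show "\<one> \<in> ?P" using submonoid.one_closed[OF M] .
    show "x \<otimes> y \<in> ?P" if "x \<in> ?P" "y \<in> ?P" for x y using submonoid.m_closed[OF M that] .
    show "inv x \<in> ?P" if x: "x \<in> ?P" for x
    proof -
      obtain ss where ss: "x = foldr (\<otimes>) ss \<one>" "set ss \<subseteq> f ` F"
        using x unfolding subsemigroup_generated_def by blast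
      from ss(2) have "inv (foldr (\<otimes>) ss \<one>) \<in> ?P"
      proof (induction ss)
        case Nil
        then show ?case using submonoid.one_closed[OF M] by simp
      next
        case (Cons s ss)
        then have "inv (foldr (\<otimes>) (s # ss) \<one>) = inv (foldr (\<otimes>) ss \<one>) \<otimes> inv s"
          using assms(2) foldr_mult_closed[of ss] by (simp add: inv_mult_group subset_iff image_iff)
        then show ?case using Cons inv submonoid.m_closed[OF M] by auto
      qed
      then show ?thesis using ss(1) by simp
    qed
  qed
qed

end

text \<open>\<open>\<Gamma>\<close> is \<open>G \<times> \<int>\<close> with the generator of
  \<open>\<int>\<close> at the bottom of its series. The table translates input letters to words
  over that series with integer component 0. As it is total and almost everywhere \<open>[]\<close>,
  every list of numbers is a meaningful input.\<close>

locale coded_group = group G + \<Gamma>: central_series_group "G \<times>\<times> integer_group" a m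
  for G (structure) and a :: "nat \<Rightarrow> 'a \<times> int" and m +
  fixes table :: "nat \<Rightarrow> nat list" and n :: nat
  assumes nilpotent: "lower_central G n = {\<one>}"
    and m_pos: "m \<ge> 1" and a_0: "a 0 = (\<one>, 1)"
    and finite_table: "finite {l. table l \<noteq> []}"
    and table_range: "set (table l) \<subseteq> {..<2 * m}"
    and table_snd: "snd (\<Gamma>.val (table l)) = 0"
begin

definition transl :: "nat list \<Rightarrow> nat list" where
  "transl w = concat (map table w)"

definition elt :: "nat list \<Rightarrow> 'a" where
  "elt w = fst (\<Gamma>.val (transl w))"

lemma computable_transl [computable_intros]: "computable f \<Longrightarrow> computable (\<lambda>x. transl (f x))"
  unfolding transl_def
  by (intro computable_intros computable_compose[OF computable_finite_support[OF finite_table]])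

lemma transl_range: "set (transl w) \<subseteq> {..<2 * m}"
  using table_range by (auto simp: transl_def)

lemma val_transl: "\<Gamma>.val (transl w) = (elt w, 0)"
proof -
  have "snd (\<Gamma>.val (transl w)) = 0"
  proof (induction w)
    case Nil
    then show ?case by (simp add: transl_def)
  next
    case (Cons l w)
    have "\<Gamma>.val (transl (l # w)) = \<Gamma>.val (table l) \<otimes>\<^bsub>G \<times>\<times> integer_group\<^esub> \<Gamma>.val (transl w)"
      using \<Gamma>.val_append[OF table_range transl_range] by (simp add: transl_def)
    then show ?case using Cons table_snd[of l] by (simp add: mult_DirProd')
  qed
  then show ?thesis by (simp add: elt_def prod_eq_iff)
qed

lemma elt_closed [simp]: "elt w \<in> carrier G"
  using \<Gamma>.val_closed[OF transl_range, of w] by (simp add: val_transl)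

lemma elt_Cons: "elt (l # w) = fst (\<Gamma>.val (table l)) \<otimes> elt w"
proof -
  have "\<Gamma>.val (transl (l # w)) = \<Gamma>.val (table l) \<otimes>\<^bsub>G \<times>\<times> integer_group\<^esub> \<Gamma>.val (transl w)"
    using \<Gamma>.val_append[OF table_range transl_range] by (simp add: transl_def)
  then show ?thesis by (simp add: elt_def mult_DirProd')
qed

lemma val_replicate_0: "\<Gamma>.val (replicate k 0) = (\<one>, int k)"
  by (induction k) (simp_all add: \<Gamma>.letter_def a_0)

lemma val_weighted: "\<Gamma>.val (transl w @ replicate k 0) = (elt w, int k)"
proof -
  have "set (replicate k 0) \<subseteq> {..<2 * m}" using m_pos by auto
  then show ?thesis
    using \<Gamma>.val_append[OF transl_range, of "replicate k 0" w]
      by (simp add: val_transl val_replicate_0)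
qed

lemma val_weighted_concat:
  "\<Gamma>.val (concat (map (\<lambda>w. transl w @ replicate (\<rho> w) 0) L)) =
     (foldr (\<otimes>) (map elt L) \<one>, (\<Sum>w\<leftarrow>L. int (\<rho> w)))
   \<and> set (concat (map (\<lambda>w. transl w @ replicate (\<rho> w) 0) L)) \<subseteq> {..<2 * m}"
proof (induction L)
  case (Cons w L)
  have range: "set (transl w @ replicate (\<rho> w) 0) \<subseteq> {..<2 * m}"
    using transl_range[of w] m_pos by auto
  have "\<Gamma>.val ((transl w @ replicate (\<rho> w) 0) @ concat (map (\<lambda>w. transl w @ replicate (\<rho> w) 0) L))
      = (elt w, int (\<rho> w)) \<otimes>\<^bsub>G \<times>\<times> integer_group\<^esub>
        \<Gamma>.val (concat (map (\<lambda>w. transl w @ replicate (\<rho> w) 0) L))"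
    using \<Gamma>.val_append[OF range] Cons by (simp only: val_weighted)
  with Cons range show ?case by simp
qed simp

definition identity_in :: "nat list list \<Rightarrow> bool" where
  "identity_in S \<longleftrightarrow> \<one> \<in> subsemigroup_generated G (elt ` set S)"

definition subgroup_of :: "nat list list \<Rightarrow> bool" where
  "subgroup_of S \<longleftrightarrow> subgroup (subsemigroup_generated G (elt ` set S)) G"

lemma val_concat_transl:
  "\<Gamma>.val (concat (map transl L)) = (foldr (\<otimes>) (map elt L) \<one>, 0)
   \<and> set (concat (map transl L)) \<subseteq> {..<2 * m}"
  using val_weighted_concat[of "\<lambda>w. 0" L] by (simp add: sum_list_triv)

lemma identity_in_iff:
  "identity_in S \<longleftrightarrow> (\<exists>L. L \<noteq> [] \<and> set L \<subseteq> set S \<and> foldr (\<otimes>) (map elt L) \<one> = \<one>)"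
proof
  assume "identity_in S"
  then obtain ss where ss: "ss \<noteq> []" "set ss \<subseteq> elt ` set S" "\<one> = foldr (\<otimes>) ss \<one>"
    unfolding identity_in_def subsemigroup_generated_def by blast
  then obtain L where "set L \<subseteq> set S" "ss = map elt L"
    using ex_list_in_image by meson
  with ss show "\<exists>L. L \<noteq> [] \<and> set L \<subseteq> set S \<and> foldr (\<otimes>) (map elt L) \<one> = \<one>" by auto
next
  assume "\<exists>L. L \<noteq> [] \<and> set L \<subseteq> set S \<and> foldr (\<otimes>) (map elt L) \<one> = \<one>"
  then obtain L where "L \<noteq> []" "set L \<subseteq> set S" "foldr (\<otimes>) (map elt L) \<one> = \<one>" by blast
  then show "identity_in S"
    unfolding identity_in_def subsemigroup_generated_def
    by (intro CollectI exI[of _ "map elt L"]) auto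
qed

lemma subgroup_of_iff:
  "subgroup_of S \<longleftrightarrow> S \<noteq> [] \<and> (\<exists>L. set L = set S \<and> foldr (\<otimes>) (map elt L) \<one> = \<one>)"
  unfolding subgroup_of_def by (subst subsemigroup_subgroup_iff) auto

lemma re_word_one:
  assumes "computable f"
  shows "re (\<lambda>x. foldr (\<otimes>) (map elt (f x)) \<one> = \<one>)"
proof -
  have "re (\<lambda>x. set (concat (map transl (f x))) \<subseteq> {..<2 * m} \<and>
      \<Gamma>.val (concat (map transl (f x))) = \<one>\<^bsub>G \<times>\<times> integer_group\<^esub>)"
    by (intro \<Gamma>.re_val_one computable_intros assms)
  then show ?thesis using val_concat_transl by simp
qed

lemma re_subgroup_of: "re subgroup_of"
proof -
  have "re (\<lambda>S. S \<noteq> [] \<and> (\<exists>L. (set L \<subseteq> set S \<and> set S \<subseteq> set L) \<and> foldr (\<otimes>) (map elt L) \<one> = \<one>))"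
    by (intro re_ex re_conj re_word_one re_dec computable_intros)
  then have "re (\<lambda>S. subgroup_of S)" unfolding subgroup_of_iff set_eq_subset .
  then show ?thesis .
qed

text \<open>
  The last condition says that the pairs \<open>(s, r)\<close> in \<open>Z\<close> generate the graph of a homomorphism, with
  the generator of \<open>\<int>\<close> written as the letter \<open>0\<close>.
\<close>

definition weight_certificate :: "nat list list \<Rightarrow> (nat list \<times> nat) list \<Rightarrow> bool" where
  "weight_certificate S Z \<longleftrightarrow> (\<forall>s\<in>set S. \<exists>p\<in>set Z. s = fst p) \<and>
     (\<exists>p\<in>set Z. fst p \<in> set S \<and> 0 < snd p) \<and>
     \<Gamma>.meets_trivially m (map (\<lambda>p. transl (fst p) @ replicate (snd p) 0) Z)"

lemma re_weight_certificate:
  assumes "computable f" "computable g"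
  shows "re (\<lambda>x. weight_certificate (f x) (g x))"
  unfolding weight_certificate_def
  by (intro re_conj re_dec re_compose[OF \<Gamma>.re_meets_trivially[OF m_pos order_refl]] assms
      computable_intros computable_compose[OF assms(1)] computable_compose[OF assms(2)])

lemma N_1: "x \<in> \<Gamma>.N 1 \<longleftrightarrow> fst x = \<one>"
proof -
  have eq: "\<Gamma>.N 1 = generate (G \<times>\<times> integer_group) {(\<one>, 1)}"
  proof -
    have "{..<1::nat} = {0}" by auto
    then show ?thesis by (simp only: \<Gamma>.N_def image_insert image_empty a_0)
  qed
  have "fst y = \<one>" if "y \<in> generate (G \<times>\<times> integer_group) {(\<one>, 1)}" for y
    using that by induction (auto simp: inv_DirProd group_integer_group is_group)
  moreover have "(\<one>, k) \<in> \<Gamma>.N 1" for k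
  proof (cases k rule: int_cases2)
    case (nonneg l)
    have "\<Gamma>.val (replicate l 0) \<in> \<Gamma>.N 1"
      using m_pos by (intro \<Gamma>.val_in_N) auto
    then show ?thesis using nonneg by (simp only: val_replicate_0)
  next
    case (nonpos l)
    have "\<Gamma>.val (replicate l 0) \<in> \<Gamma>.N 1"
      using m_pos by (intro \<Gamma>.val_in_N) auto
    from subgroup.m_inv_closed[OF \<Gamma>.subgroup_N[OF m_pos] this] nonpos show ?thesis
      by (simp add: val_replicate_0 inv_DirProd group_integer_group is_group)
  qed
  ultimately show ?thesis using eq by (metis prod.collapse)
qed

lemma not_subgroup_of_iff:
  assumes "S \<noteq> []"
  shows "\<not> subgroup_of S \<longleftrightarrow> (\<exists>Z. weight_certificate S Z)"
proof
  assume "\<not> subgroup_of S"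
  have "elt ` set S \<subseteq> carrier G" by auto
  with \<open>\<not> subgroup_of S\<close> obtain f where f: "f \<in> hom (G\<lparr>carrier := generate G (elt ` set S)\<rparr>)
    integer_group"
    "\<forall>s\<in>elt ` set S. f s \<ge> 0" "\<exists>s\<in>elt ` set S. f s > 0"
    using subsemigroup_dichotomy[OF nilpotent, of "elt ` set S"] assms
    unfolding subgroup_of_def by auto
  let ?H = "generate G (elt ` set S)"
  have H: "subgroup ?H G" by (rule generate_is_subgroup) auto
  interpret H: subgroup ?H G by (rule H)
  interpret f: group_hom "G\<lparr>carrier := ?H\<rparr>" integer_group f
    unfolding group_hom_def group_hom_axioms_def
    using f(1) subgroup_imp_group[OF H] by simp
  \<comment> \<open>The weights are values of \<open>f\<close>, which are nonnegative on
    \<open>S\<close>; hence natural numbers suffice in certificates.\<close>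
  define Z where "Z = map (\<lambda>s. (s, nat (f (elt s)))) S"
  let ?Y = "map (\<lambda>p. transl (fst p) @ replicate (snd p) 0) Z"
  have val_Y: "\<Gamma>.val ` set ?Y = (\<lambda>s. (elt s, f (elt s))) ` set S"
  proof -
    have "\<Gamma>.val (transl s @ replicate (nat (f (elt s))) 0) = (elt s, f (elt s))" if "s \<in> set S"
      for s
      using f(2) that by (simp add: val_weighted)
    then show ?thesis unfolding Z_def by (auto simp: image_image)
  qed
  \<comment> \<open>The span lies in the graph of \<open>f\<close>, and the graph meets the factor
    \<open>\<int>\<close> only in the identity.\<close>
  have graph: "fst x \<in> ?H \<and> snd x = f (fst x)" if "x \<in> \<Gamma>.span ?Y" for x
    using that unfolding \<Gamma>.span_def val_Y
  proof induction
    case one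
    show ?case using f.hom_one by simp
  next
    case (incl x)
    then show ?case by (auto intro: generate.incl)
  next
    case (inv x)
    then obtain s where s: "s \<in> set S" "x = (elt s, f (elt s))" by blast
    then have "elt s \<in> ?H" by (auto intro: generate.incl)
    then show ?case using s f.hom_inv[of "elt s"] m_inv_consistent[OF H, of "elt s"]
      by (simp add: inv_DirProd group_integer_group is_group)
  next
    case (eng x y)
    then show ?case using f.hom_mult[of "fst x" "fst y"] by (simp add: mult_DirProd')
  qed
  have "\<Gamma>.span ?Y \<inter> \<Gamma>.N 1 = {\<one>\<^bsub>G \<times>\<times> integer_group\<^esub>}"
  proof
    show "\<Gamma>.span ?Y \<inter> \<Gamma>.N 1 \<subseteq> {\<one>\<^bsub>G \<times>\<times> integer_group\<^esub>}"
    proof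
      fix x assume "x \<in> \<Gamma>.span ?Y \<inter> \<Gamma>.N 1"
      then have "fst x = \<one>" "snd x = f \<one>" using N_1 graph by auto
      then show "x \<in> {\<one>\<^bsub>G \<times>\<times> integer_group\<^esub>}" using f.hom_one by (simp add: prod_eq_iff)
    qed
    show "{\<one>\<^bsub>G \<times>\<times> integer_group\<^esub>} \<subseteq> \<Gamma>.span ?Y \<inter> \<Gamma>.N 1"
    proof -
      have "\<one>\<^bsub>G \<times>\<times> integer_group\<^esub> \<in> \<Gamma>.span ?Y" unfolding \<Gamma>.span_def by (rule generate.one)
      then show ?thesis using N_1[of "\<one>\<^bsub>G \<times>\<times> integer_group\<^esub>"] by simp
    qed
  qed
  moreover have "\<forall>y\<in>set ?Y. set y \<subseteq> {..<2 * m}"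
    using transl_range m_pos by auto
  ultimately have "weight_certificate S Z"
    unfolding weight_certificate_def \<Gamma>.meets_trivially_def
    using f(3) by (auto simp: Z_def)
  then show "\<exists>Z. weight_certificate S Z" ..
next
  assume "\<exists>Z. weight_certificate S Z"
  then obtain Z where Z: "\<forall>s\<in>set S. \<exists>p\<in>set Z. s = fst p" "\<exists>p\<in>set Z. fst p \<in> set S \<and> 0 < snd p"
    "\<Gamma>.meets_trivially m (map (\<lambda>p. transl (fst p) @ replicate (snd p) 0) Z)"
    unfolding weight_certificate_def by blast
  let ?Y = "map (\<lambda>p. transl (fst p) @ replicate (snd p) 0) Z"
  obtain s0 k0 where s0: "(s0, k0) \<in> set Z" "s0 \<in> set S" "0 < k0" using Z(2) by force
  have "\<forall>s. \<exists>k. s \<in> set S \<longrightarrow> (s, k) \<in> set Z" using Z(1) by force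
  then obtain \<rho>' where \<rho>': "\<And>s. s \<in> set S \<Longrightarrow> (s, \<rho>' s) \<in> set Z" by metis
  \<comment> \<open>\<open>Z\<close> may list several weights for one word; the choice is adjusted
    so that \<open>s0\<close> gets its positive weight.\<close>
  define \<rho> where "\<rho> = \<rho>'(s0 := k0)"
  have \<rho>: "(s, \<rho> s) \<in> set Z" if "s \<in> set S" for s
    using \<rho>'[OF that] s0(1) by (simp add: \<rho>_def)
  have range: "\<forall>y\<in>set ?Y. set y \<subseteq> {..<2 * m}" using Z(3) unfolding \<Gamma>.meets_trivially_def by blast
  show "\<not> subgroup_of S"
  proof
    assume "subgroup_of S"
    from this[unfolded subgroup_of_iff, THEN conjunct2]
    obtain L where "set L = set S \<and> foldr (\<otimes>) (map elt L) \<one> = \<one>" ..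
    note L = this[THEN conjunct1] this[THEN conjunct2]
    let ?w = "concat (map (\<lambda>w. transl w @ replicate (\<rho> w) 0) L)"
    have "\<forall>l\<in>set (map (\<lambda>w. transl w @ replicate (\<rho> w) 0) L). l \<in> set ?Y"
    proof
      fix l assume "l \<in> set (map (\<lambda>w. transl w @ replicate (\<rho> w) 0) L)"
      then obtain s where "s \<in> set S" "l = transl s @ replicate (\<rho> s) 0" using L(1) by auto
      then show "l \<in> set ?Y" using \<rho>[of s] by force
    qed
    then have "\<Gamma>.val ?w \<in> \<Gamma>.span ?Y"
      unfolding \<Gamma>.span_iff_word[OF range] by blast
    moreover have val: "\<Gamma>.val ?w = (\<one>, (\<Sum>w\<leftarrow>L. int (\<rho> w)))"
      using val_weighted_concat[of \<rho> L] L(2) by simp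
    then have "\<Gamma>.val ?w \<in> \<Gamma>.N 1" unfolding N_1 by (simp only: fst_conv)
    moreover have "\<Gamma>.span ?Y \<inter> \<Gamma>.N 1 = {\<one>\<^bsub>G \<times>\<times> integer_group\<^esub>}"
      using Z(3) unfolding \<Gamma>.meets_trivially_def by (rule conjunct2)
    ultimately have "\<Gamma>.val ?w = \<one>\<^bsub>G \<times>\<times> integer_group\<^esub>" by blast
    then have "(\<Sum>w\<leftarrow>L. int (\<rho> w)) = 0" using val by simp
    \<comment> \<open>\<open>s0\<close> occurs in \<open>L\<close> and no weight is negative, so a
      product equal to the identity would have positive total weight.\<close>
    moreover have "int (\<rho> s0) \<le> (\<Sum>w\<leftarrow>L. int (\<rho> w))"
      using s0(2) L(1) by (intro member_le_sum_list) auto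
    ultimately show False using s0(3) by (simp add: \<rho>_def)
  qed
qed

lemma dec_subgroup_of: "dec subgroup_of"
proof (rule dec_if_re[OF re_subgroup_of])
  \<comment> \<open>The empty set generates the empty semigroup, which is no subgroup; certificates
    cover nonempty \<open>S\<close> only.\<close>
  have "re (\<lambda>S. S = [] \<or> (\<exists>Z. weight_certificate S Z))"
    by (intro re_disj re_dec re_ex re_weight_certificate computable_intros)
  moreover have "\<not> subgroup_of S \<longleftrightarrow> S = [] \<or> (\<exists>Z. weight_certificate S Z)" for S
    using not_subgroup_of_iff[of S] subgroup_of_iff[of "[]"] by blast
  ultimately show "re (\<lambda>S. \<not> subgroup_of S)" by simp
qed

text \<open>
  The elements that occur in a product equal to the identity generate a subgroup, since rotating the
  product exhibits the inverses.
\<close>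

lemma identity_in_iff_subseq:
  "identity_in S \<longleftrightarrow> (\<exists>S'\<in>set (subseqs S). subgroup_of S')"
proof
  assume "identity_in S"
  then obtain L where L: "L \<noteq> []" "set L \<subseteq> set S" "foldr (\<otimes>) (map elt L) \<one> = \<one>"
    unfolding identity_in_iff by blast
  then obtain S' where "S' \<in> set (subseqs S)" "set S' = set L"
    using subseqs_powset[of S] by (metis (no_types, lifting) Pow_iff imageE)
  then show "\<exists>S'\<in>set (subseqs S). subgroup_of S'"
    by (intro bexI[of _ S'] subgroup_of_iff[THEN iffD2] conjI exI[of _ L])
      (use L in auto)
next
  assume "\<exists>S'\<in>set (subseqs S). subgroup_of S'"
  then obtain S' where S': "S' \<in> set (subseqs S)" "subgroup_of S'" by blast
  from S'(2)[unfolded subgroup_of_iff, THEN conjunct2]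
  obtain L where "set L = set S' \<and> foldr (\<otimes>) (map elt L) \<one> = \<one>" ..
  note L = this[THEN conjunct1] this[THEN conjunct2]
  have "S' \<noteq> []" using S'(2)[unfolded subgroup_of_iff] by (rule conjunct1)
  then have "L \<noteq> []" using L(1) by auto
  moreover have "set L \<subseteq> set S" unfolding L(1) using S'(1) subseqs_powset[of S] by blast
  ultimately show "identity_in S" unfolding identity_in_iff using L(2) by blast
qed

lemma dec_identity_in: "dec identity_in"
proof -
  have "dec (\<lambda>S. \<exists>S'\<in>set (subseqs S). subgroup_of S')"
    by (intro computable_intros dec_compose[OF dec_subgroup_of])
  then have "dec (\<lambda>S. identity_in S)" unfolding identity_in_iff_subseq .
  then show ?thesis .
qed

end

section \<open>A central series of \<open>G \<times> \<int>\<close> and the passage to words over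
  \<open>X\<close>\<close>

lemma (in group) central_series_nth:
  assumes "central_series G cs" "i < length cs" "g \<in> carrier G"
  shows "rev cs ! i \<otimes> g \<otimes> inv (rev cs ! i) \<otimes> inv g \<in> generate G ((!) (rev cs) ` {..<i})"
  using assms
proof (induction cs)
  case (Cons c cs)
  have image: "(!) (rev (c # cs)) ` {..<k} = (!) (rev cs) ` {..<k}" if "k \<le> length cs" for k
    using that by (intro image_cong) (auto simp: nth_append)
  show ?case
  proof (cases "i < length cs")
    case True
    then show ?thesis using Cons image[of i] by (simp add: nth_append)
  next
    case False
    then have i: "i = length cs" using Cons.prems(2) by simp
    have "(!) (rev cs) ` {..<length cs} = set (rev cs)"
      by (metis length_rev lessThan_atLeast0 nth_image order_refl take_all)
    then show ?thesis using Cons.prems image[of i] by (simp add: i nth_append)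
  qed
qed simp

lemma (in group) generate_DirProd_left:
  assumes "S \<subseteq> carrier G" "h \<in> generate G S" "\<And>s. s \<in> S \<Longrightarrow> (s, 0) \<in> T"
  shows "(h, 0) \<in> generate (G \<times>\<times> integer_group) T"
  using assms(2)
proof induction
  case one
  show ?case using generate.one[of "G \<times>\<times> integer_group" T] by simp
next
  case (incl h)
  then show ?case by (intro generate.incl assms(3))
next
  case (inv h)
  then have "inv\<^bsub>G \<times>\<times> integer_group\<^esub> (h, 0) \<in> generate (G \<times>\<times> integer_group) T"
    by (intro generate.inv assms(3))
  then show ?case using inv assms(1) by (simp add: subset_iff inv_DirProd group_integer_group
    is_group)
next
  case (eng g h)
  from generate.eng[OF eng.IH] show ?case by simp
qed

text \<open>The generator of \<open>\<int>\<close> is central; it is put at index 0 so that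
  \<open>N 1\<close> becomes the factor \<open>\<int>\<close>. The entries of \<open>cs\<close>
  follow, reversed and shifted by one.\<close>

lemma (in group) central_series_group_times_integer:
  assumes cs: "central_series G cs" and gen: "generate G (set cs) = carrier G"
  shows "central_series_group (G \<times>\<times> integer_group)
    (case_nat (\<one>, 1) (\<lambda>i. (rev cs ! i, 0))) (Suc (length cs))"
proof -
  let ?G = "G \<times>\<times> integer_group" and ?a = "case_nat (\<one>, 1) (\<lambda>i. (rev cs ! i, 0))"
  interpret P: group ?G by (rule DirProd_group[OF is_group group_integer_group])
  have nth: "rev cs ! i \<in> carrier G" if "i < length cs" for i
    using central_series_subset[OF cs] that by (metis length_rev nth_mem set_rev subsetD)
  have closed: "?a i \<in> carrier ?G" if "i < Suc (length cs)" for i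
    using that nth by (auto split: nat.split)
  have gens: "?a ` {..<Suc (length cs)} \<subseteq> carrier ?G" using closed by blast
  have lift: "(h, 0) \<in> generate ?G (?a ` {..<Suc i})"
    if "h \<in> generate G ((!) (rev cs) ` {..<i})" "i \<le> length cs" for h i
  proof (rule generate_DirProd_left[OF _ that(1)])
    show "(!) (rev cs) ` {..<i} \<subseteq> carrier G" using nth that(2) by auto
    fix s assume "s \<in> (!) (rev cs) ` {..<i}"
    then obtain j where "j < i" "s = rev cs ! j" by blast
    then show "(s, 0) \<in> ?a ` {..<Suc i}" by (intro image_eqI[of _ _ "Suc j"]) auto
  qed
  show ?thesis
  proof (unfold_locales)
    show "?a i \<in> carrier ?G" if "i < Suc (length cs)" for i by (rule closed[OF that])
    show "?a i \<otimes>\<^bsub>?G\<^esub> p \<otimes>\<^bsub>?G\<^esub> inv\<^bsub>?G\<^esub> ?a i \<otimes>\<^bsub>?G\<^esub> inv\<^bsub>?G\<^esub> p \<in> generate ?G (?a ` {..<i})"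
      if i: "i < Suc (length cs)" and p: "p \<in> carrier ?G" for i p
    proof (cases i)
      case 0
      obtain g k where "p = (g, k)" "g \<in> carrier G" using p by (cases p) auto
      then have "?a i \<otimes>\<^bsub>?G\<^esub> p \<otimes>\<^bsub>?G\<^esub> inv\<^bsub>?G\<^esub> ?a i \<otimes>\<^bsub>?G\<^esub> inv\<^bsub>?G\<^esub> p = \<one>\<^bsub>?G\<^esub>"
        by (simp add: 0 inv_DirProd group_integer_group is_group)
      then show ?thesis by (simp only: generate.one)
    next
      case (Suc j)
      obtain g k where g: "p = (g, k)" "g \<in> carrier G" using p by (cases p) auto
      let ?c = "rev cs ! j"
      have "?a i \<otimes>\<^bsub>?G\<^esub> p \<otimes>\<^bsub>?G\<^esub> inv\<^bsub>?G\<^esub> ?a i \<otimes>\<^bsub>?G\<^esub> inv\<^bsub>?G\<^esub> p = (?c \<otimes> g \<otimes> inv ?c \<otimes> inv g, 0)"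
        using g nth[of j] i by (simp add: Suc inv_DirProd group_integer_group is_group)
      then show ?thesis
        using lift[OF central_series_nth[OF cs _ g(2), of j]] i Suc by simp
    qed
    show "generate ?G (?a ` {..<Suc (length cs)}) = carrier ?G"
    proof
      show "generate ?G (?a ` {..<Suc (length cs)}) \<subseteq> carrier ?G"
        by (rule P.generate_incl[OF gens])
      show "carrier ?G \<subseteq> generate ?G (?a ` {..<Suc (length cs)})"
      proof
        fix p assume "p \<in> carrier ?G"
        then obtain g k where p: "p = (g, k)" "g \<in> carrier G" by (cases p) auto
        have sub: "subgroup (generate ?G (?a ` {..<Suc (length cs)})) ?G"
          by (rule P.generate_is_subgroup[OF gens])
        have "(!) (rev cs) ` {..<length cs} = set (rev cs)"
          by (metis length_rev lessThan_atLeast0 nth_image order_refl take_all)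
        then have "(g, 0) \<in> generate ?G (?a ` {..<Suc (length cs)})"
          using lift[of g "length cs"] p(2) gen by simp
        moreover have "(\<one>, 1) \<in> generate ?G (?a ` {..<Suc (length cs)})"
          by (intro generate.incl image_eqI[of _ _ 0]) auto
        then have "(\<one>, 1) [^]\<^bsub>?G\<^esub> k \<in> generate ?G (?a ` {..<Suc (length cs)})"
          by (rule P.subgroup_int_pow_closed[OF sub])
        moreover have "(\<one>, 1) [^]\<^bsub>?G\<^esub> k = (\<one>, k)"
        proof (rule prod_eqI)
          have "group_hom ?G G fst" "group_hom ?G integer_group snd"
            using P.is_group is_group group_integer_group
            by (auto simp: group_hom_def group_hom_axioms_def hom_def)
          then show "fst ((\<one>, 1) [^]\<^bsub>?G\<^esub> k) = fst (\<one>, k)" "snd ((\<one>, 1) [^]\<^bsub>?G\<^esub> k) = snd (\<one>, k)"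
            using group_hom.hom_int_pow[of ?G G fst "(\<one>, 1)" k]
              group_hom.hom_int_pow[of ?G integer_group snd "(\<one>, 1)" k] by simp_all
        qed
        ultimately show "p \<in> generate ?G (?a ` {..<Suc (length cs)})"
          using subgroup.m_closed[OF sub, of "(g, 0)" "(\<one>, k)"] p by simp
      qed
    qed
  qed
qed

text \<open>\<open>Q\<close> is decided on all values of a codable type, while the problem concerns
  only the instances in \<open>D\<close>; outside \<open>D\<close> the answers are
  arbitrary.\<close>

lemma decidable_problem_if_dec:
  fixes Q :: "'b::codable \<Rightarrow> bool"
  assumes "dec Q" "\<And>x. x \<in> D \<Longrightarrow> enc x = encode (g x) \<and> (P x \<longleftrightarrow> Q (g x))"
  shows "decidable_problem enc D P"
proof -
  obtain p where "\<And>y. halts_with p [encode y] (of_bool (Q y))"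
    using assms(1) unfolding dec_def computable_def by auto
  then have "halts_with p [enc x] (if P x then 1 else 0)" if "x \<in> D" for x
    using assms(2)[OF that] by (metis of_bool_def)
  then show ?thesis unfolding decidable_problem_def by blast
qed

theorem theorem1:
  fixes G :: "('a, 'b) monoid_scheme" and X :: "'a set" and idx :: "'a \<Rightarrow> nat"
  assumes "nilpotent_group G"
    and "finite X" and "X \<subseteq> carrier G" and "generate G X = carrier G"
    and "inj_on idx X"
  shows "decidable_problem (encode_words idx) (lists (words X)) (identity_problem G)
       \<and> decidable_problem (encode_words idx) (lists (words X)) (subgroup_problem G)"
proof -
  from assms(1) obtain n where G: "group G" and nil: "lower_central G n = {\<one>\<^bsub>G\<^esub>}"
    unfolding nilpotent_group_def by blast
  interpret group G by (rule G)
  obtain cs where cs: "central_series G cs" "generate G (set cs) = carrier G"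
    using nilpotent_central_series[OF assms(2-4), of 0 n] nil by auto
  define a where "a = case_nat (\<one>\<^bsub>G\<^esub>, 1::int) (\<lambda>i. (rev cs ! i, 0))"
  define m where "m = Suc (length cs)"
  interpret P: central_series_group "G \<times>\<times> integer_group" a m
    unfolding a_def m_def by (rule central_series_group_times_integer[OF cs])
  define code :: "'a \<times> bool \<Rightarrow> nat" where "code = (\<lambda>(x, b). 2 * idx x + of_bool b)"
  define sym :: "'a \<times> bool \<Rightarrow> 'a" where "sym = (\<lambda>(x, b). if b then inv\<^bsub>G\<^esub> x else x)"
  have inj: "inj_on code (X \<times> UNIV)"
  proof (rule inj_onI)
    fix p q assume pq: "p \<in> X \<times> UNIV" "q \<in> X \<times> UNIV" "code p = code q"
    obtain x b y c where xy: "p = (x, b)" "q = (y, c)" by (cases p, cases q)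
    have eq: "2 * idx x + of_bool b = 2 * idx y + of_bool c" using pq(3) by (simp add: xy code_def)
    \<comment> \<open>The parity of the code tells a generator from its inverse.\<close>
    have "b = (\<not> even (2 * idx x + of_bool b))" "c = (\<not> even (2 * idx y + of_bool c))" by simp_all
    then have "b = c" unfolding eq by blast
    then have "idx x = idx y" using eq by simp
    then have "x = y" using assms(5) pq(1,2) by (simp add: xy inj_on_eq_iff)
    with \<open>b = c\<close> show "p = q" by (simp add: xy)
  qed
  have sym: "sym p \<in> carrier G" if "p \<in> X \<times> UNIV" for p
    using that assms(3) by (auto simp: sym_def)
  have "\<exists>w. set w \<subseteq> {..<2 * m} \<and> P.val w = (sym p, 0)" if "p \<in> X \<times> UNIV" for p
  proof -
    have "(sym p, 0) \<in> P.N m" using sym[OF that] by (simp add: P.N_def P.generated)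
    then show ?thesis using P.N_val[OF order_refl] by metis
  qed
  then obtain W where W: "\<And>p. p \<in> X \<times> UNIV \<Longrightarrow> set (W p) \<subseteq> {..<2 * m} \<and> P.val (W p) = (sym p, 0)"
    by metis
  \<comment> \<open>There are finitely many letters, so the chosen words \<open>W\<close> form a
    table that a program can contain.\<close>
  define table where "table l = (if l \<in> code ` (X \<times> UNIV) then W (inv_into (X \<times> UNIV) code l) else
    [])" for l
  have table_code: "table (code p) = W p" if "p \<in> X \<times> UNIV" for p
    using that inj by (simp add: table_def)
  interpret C: coded_group G a m table n
  proof
    show "lower_central G n = {\<one>\<^bsub>G\<^esub>}" by (rule nil)
    show "1 \<le> m" "a 0 = (\<one>\<^bsub>G\<^esub>, 1)" by (simp_all add: m_def a_def)
    have "{l. table l \<noteq> []} \<subseteq> code ` (X \<times> UNIV)" by (auto simp: table_def)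
    then show "finite {l. table l \<noteq> []}" by (rule finite_subset) (simp add: assms(2))
    show "set (table l) \<subseteq> {..<2 * m}" "snd (P.val (table l)) = 0" for l
    proof -
      have "set (table l) \<subseteq> {..<2 * m} \<and> snd (P.val (table l)) = 0"
      proof (cases "l \<in> code ` (X \<times> UNIV)")
        case True
        then obtain p where "p \<in> X \<times> UNIV" "l = code p" by blast
        with W[of p] table_code[of p] show ?thesis by simp
      qed (simp add: table_def)
      then show "set (table l) \<subseteq> {..<2 * m}" "snd (P.val (table l)) = 0" by blast+
    qed
  qed
  have elt: "C.elt (map code w) = word_value G w" if "w \<in> words X" for w
    using that unfolding words_def
  proof induction
    case Nil
    show ?case by (simp add: C.elt_def C.transl_def word_value_def)
  next
    case (Cons p w)
    then show ?case
      using W[OF Cons.hyps(1)] by (simp add: C.elt_Cons table_code word_value_def sym_def)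
  qed
  have code: "encode_words idx ws = encode (map (map code) ws)" for ws
    unfolding encode_words_def encode_word_def encode_list_def encode_nat_def code_def
    by (simp add: o_def)
  have vals: "C.elt ` set (map (map code) ws) = word_value G ` set ws" if "ws \<in> lists (words X)"
    for ws
    using that elt by (auto simp: image_image intro!: image_cong)
  show ?thesis
  proof
    show "decidable_problem (encode_words idx) (lists (words X)) (identity_problem G)"
      by (rule decidable_problem_if_dec[OF C.dec_identity_in, where g = "map (map code)"])
        (simp only: code vals C.identity_in_def identity_problem_def simp_thms)
    show "decidable_problem (encode_words idx) (lists (words X)) (subgroup_problem G)"
      by (rule decidable_problem_if_dec[OF C.dec_subgroup_of, where g = "map (map code)"])
        (simp only: code vals C.subgroup_of_def subgroup_problem_def simp_thms)
  qed
qed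

end
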